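(* Let $V$ be a complex vector space of dimension $n+1$ with a non-degenerate symmetric bilinear form $\langle\ ,\ \rangle$, and let $m\ge 1$. Let $\mathrm{Sym}_m$ be the space of complex symmetric $m\times m$ matrices, with the torus $T=T^{m-1}=\{(z_1,\ldots,z_m)\in(\mathbb{C}^* )^m : z_1\cdots z_m=1\}$ acting by scaling the $i$-th row and the $i$-th column by $z_i$ for each $i$. Let $\mathbb{S}_m$ be the toric variety $\mathbb{P}(\mathrm{Sym}_m)/\!/T^{m-1}$. Then $\mathbf{O}_n^m=\mathbb{P}(V)^m/\!/\mathrm{PO}(V)$ is isomorphic to the closed subvariety of $\mathbb{S}_m$ defined by the condition that the rank $r$ of the matrix satisfies $r\le n+1$.
   Context: $\mathrm{O}(V)$ is the orthogonal group of $(V,\langle\ ,\ \rangle)$, $\mathrm{PO}(V)=\mathrm{O}(V)/\{\pm I\}$, and $\mathbb{P}(V)\cong\mathbb{P}^n$ is the space of lines in $V$. The GIT quotient is $$\mathbf{O}_n^m=\mathrm{Proj}\Bigl(\bigoplus_{d\ge 0}\bigl(S^d(V^* )^{\otimes m}\bigr)^{\mathrm{O}(V)}\Bigr),$$ where the degree $d$ part is identified with the space of $\mathrm{O}(V)$-invariant polynomials on $V^m$ homogeneous of degree $d$ in each of the $m$ vector variables. The coordinate ring $\mathbb{C}[\mathrm{Sym}_m]$ is the polynomial ring in the entries $X_{ij}=X_{ji}$ ($1\le i\le j\le m$) of a general symmetric matrix, and $(z_1,\ldots,z_m)$ multiplies $X_{ij}$ by $z_iz_j$. The invariant ring $\mathbb{C}[\mathrm{Sym}_m]^T$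 is graded: its degree $d$ part consists of the polynomials that are multiplied by $(z_1\cdots z_m)^d$ under every $(z_1,\ldots,z_m)\in(\mathbb{C}^* )^m$. By definition $\mathbb{S}_m=\mathbb{P}(\mathrm{Sym}_m)/\!/T=\mathrm{Proj}\,\mathbb{C}[\mathrm{Sym}_m]^T$. The closed subvariety defined by the rank condition $r\le n+1$ is the one given by the homogeneous ideal $\mathcal{D}_m(n+1)\cap\mathbb{C}[\mathrm{Sym}_m]^T$, where $\mathcal{D}_m(n+1)\subset\mathbb{C}[\mathrm{Sym}_m]$ is the ideal generated by the $(n+2)\times(n+2)$ minors of $(X_{ij})$ (it is the zero ideal if $m\le n+1$). *)

theory Defs
  imports
    Complex_Main
    "HOL-Library.Poly_Mapping"
    "HOL-Algebra.QuotRing"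
    "HOL-Analysis.Abstract_Topology"
    "Jordan_Normal_Form.Determinant"
    "Jordan_Normal_Form.DL_Submatrix"
begin

section \<open>Graded algebras over the complex numbers\<close>

text \<open>
  A graded algebra is an \<open>\<nat>\<close>-graded ring \<open>A\<close> (as an explicit carrier) with its graded pieces
  \<open>grade A d\<close> and the structure map \<open>scalar A\<close> from the complex numbers to \<open>A\<close>.
\<close>

record 'a graded_algebra = "'a ring" +
  grade :: "nat \<Rightarrow> 'a set"
  scalar :: "complex \<Rightarrow> 'a"

definition homogeneous_elements :: "('a, 'z) graded_algebra_scheme \<Rightarrow> 'a set" where
  "homogeneous_elements A = (\<Union>d. grade A d)"

definition homogeneous_ideal :: "('a, 'z) graded_algebra_scheme \<Rightarrow> 'a set \<Rightarrow> bool" where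
  "homogeneous_ideal A I \<longleftrightarrow> ideal I A \<and> I = genideal A (I \<inter> homogeneous_elements A)"

definition irrelevant_ideal :: "('a, 'z) graded_algebra_scheme \<Rightarrow> 'a set" where
  "irrelevant_ideal A = genideal A (\<Union>d\<in>{0<..}. grade A d)"

definition quotient_algebra :: "('a, 'z) graded_algebra_scheme \<Rightarrow> 'a set \<Rightarrow> 'a set graded_algebra" where
  "quotient_algebra A I =
    \<lparr>carrier = carrier (A Quot I), monoid.mult = monoid.mult (A Quot I), one = one (A Quot I),
     zero = zero (A Quot I), add = add (A Quot I),
     grade = (\<lambda>d. (\<lambda>x. I +>\<^bsub>A\<^esub> x) ` grade A d),
     scalar = (\<lambda>c. I +>\<^bsub>A\<^esub> scalar A c)\<rparr>"


section \<open>Ringed spaces over the complex numbers\<close>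

text \<open>
  \<open>sections X U\<close> is the ring of sections over an open set \<open>U\<close>, \<open>restriction X U W\<close> restricts
  sections from \<open>U\<close> to \<open>W \<subseteq> U\<close>, and \<open>constants X U\<close> is the structure map from the complex
  numbers to \<open>sections X U\<close>.
\<close>

record ('p, 's) ringed_space =
  underlying :: "'p topology"
  sections :: "'p set \<Rightarrow> 's ring"
  restriction :: "'p set \<Rightarrow> 'p set \<Rightarrow> 's \<Rightarrow> 's"
  constants :: "'p set \<Rightarrow> complex \<Rightarrow> 's"

text \<open>
  Isomorphism of ringed spaces over the complex numbers: a homeomorphism \<open>\<phi>\<close> together with an
  isomorphism \<open>\<psi>\<close> from the structure sheaf of \<open>Y\<close> to the direct image of the structure sheaf of
  \<open>X\<close>. For locally ringed spaces the locality condition is automatic, because an isomorphism of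
  local rings is a local homomorphism.
\<close>

definition isomorphic_over_complex ::
    "('p, 's) ringed_space \<Rightarrow> ('q, 't) ringed_space \<Rightarrow> bool" where
  "isomorphic_over_complex X Y \<longleftrightarrow>
    (\<exists>\<phi> \<psi>. homeomorphic_map (underlying X) (underlying Y) \<phi> \<and>
      (let pre = (\<lambda>U. {p \<in> topspace (underlying X). \<phi> p \<in> U}) in
        (\<forall>U. openin (underlying Y) U \<longrightarrow>
          \<psi> U \<in> ring_iso (sections Y U) (sections X (pre U)) \<and>
          (\<forall>c. \<psi> U (constants Y U c) = constants X (pre U) c)) \<and>
        (\<forall>U W. openin (underlying Y) U \<and> openin (underlying Y) W \<and> W \<subseteq> U \<longrightarrow>
          (\<forall>s \<in> carrier (sections Y U).
            restriction X (pre U) (pre W) (\<psi> U s) = \<psi> W (restriction Y U W s)))))"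


section \<open>Proj of a graded algebra\<close>

definition proj_points :: "('a, 'z) graded_algebra_scheme \<Rightarrow> 'a set set" where
  "proj_points A = {P. primeideal P A \<and> homogeneous_ideal A P \<and> \<not> irrelevant_ideal A \<subseteq> P}"

text \<open>The closed sets are the sets of all points containing a given homogeneous ideal.\<close>

definition proj_topology :: "('a, 'z) graded_algebra_scheme \<Rightarrow> 'a set topology" where
  "proj_topology A =
    topology_generated_by {{P \<in> proj_points A. \<not> I \<subseteq> P} | I. homogeneous_ideal A I}"

text \<open>
  The fraction \<open>a / f\<close> in the homogeneous localization \<open>A\<^sub>(\<^sub>P\<^sub>)\<close> (the degree zero part of the
  localization at the homogeneous elements outside \<open>P\<close>), as the class of all pairs representing it.
\<close>

definition fraction :: "('a, 'z) graded_algebra_scheme \<Rightarrow> 'a set \<Rightarrow> 'a \<Rightarrow> 'a \<Rightarrow> ('a \<times> 'a) set" where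
  "fraction A P a f =
    {(b, g). (\<exists>d. b \<in> grade A d \<and> g \<in> grade A d) \<and> g \<notin> P \<and>
      (\<exists>t \<in> homogeneous_elements A - P.
        t \<otimes>\<^bsub>A\<^esub> (a \<otimes>\<^bsub>A\<^esub> g \<ominus>\<^bsub>A\<^esub> b \<otimes>\<^bsub>A\<^esub> f) = \<zero>\<^bsub>A\<^esub>)}"

definition homogeneous_localization ::
    "('a, 'z) graded_algebra_scheme \<Rightarrow> 'a set \<Rightarrow> ('a \<times> 'a) set ring" where
  "homogeneous_localization A P =
    \<lparr>carrier = {fraction A P a f | a f d. a \<in> grade A d \<and> f \<in> grade A d \<and> f \<notin> P},
     monoid.mult = (\<lambda>x y. \<Union>(a, f)\<in>x. \<Union>(b, g)\<in>y. fraction A P (a \<otimes>\<^bsub>A\<^esub> b) (f \<otimes>\<^bsub>A\<^esub> g)),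
     one = fraction A P \<one>\<^bsub>A\<^esub> \<one>\<^bsub>A\<^esub>,
     zero = fraction A P \<zero>\<^bsub>A\<^esub> \<one>\<^bsub>A\<^esub>,
     add = (\<lambda>x y. \<Union>(a, f)\<in>x. \<Union>(b, g)\<in>y.
       fraction A P ((a \<otimes>\<^bsub>A\<^esub> g) \<oplus>\<^bsub>A\<^esub> (b \<otimes>\<^bsub>A\<^esub> f)) (f \<otimes>\<^bsub>A\<^esub> g))\<rparr>"

text \<open>
  Sections of the structure sheaf over \<open>U\<close>: families of elements of the homogeneous localizations
  at the points of \<open>U\<close> that are locally given by one fraction.
\<close>

definition proj_sections ::
    "('a, 'z) graded_algebra_scheme \<Rightarrow> 'a set set \<Rightarrow> ('a set \<Rightarrow> ('a \<times> 'a) set) ring" where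
  "proj_sections A U =
    \<lparr>carrier = {s \<in> \<Pi>\<^sub>E P\<in>U. carrier (homogeneous_localization A P).
       \<forall>P\<in>U. \<exists>W. openin (proj_topology A) W \<and> P \<in> W \<and> W \<subseteq> U \<and>
         (\<exists>d. \<exists>a \<in> grade A d. \<exists>f \<in> grade A d. \<forall>Q\<in>W. f \<notin> Q \<and> s Q = fraction A Q a f)},
     monoid.mult = (\<lambda>s t. \<lambda>P\<in>U. s P \<otimes>\<^bsub>homogeneous_localization A P\<^esub> t P),
     one = (\<lambda>P\<in>U. \<one>\<^bsub>homogeneous_localization A P\<^esub>),
     zero = (\<lambda>P\<in>U. \<zero>\<^bsub>homogeneous_localization A P\<^esub>),
     add = (\<lambda>s t. \<lambda>P\<in>U. s P \<oplus>\<^bsub>homogeneous_localization A P\<^esub> t P)\<rparr>"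

definition Proj ::
    "('a, 'z) graded_algebra_scheme \<Rightarrow> ('a set, 'a set \<Rightarrow> ('a \<times> 'a) set) ringed_space" where
  "Proj A =
    \<lparr>underlying = proj_topology A,
     sections = proj_sections A,
     restriction = (\<lambda>U W s. restrict s W),
     constants = (\<lambda>U c. \<lambda>P\<in>U. fraction A P (scalar A c) \<one>\<^bsub>A\<^esub>)\<rparr>"

text \<open>
  The closed subscheme of \<open>Proj A\<close> defined by a homogeneous ideal \<open>I\<close>, as a ringed space in its
  own right. The canonical closed immersion into \<open>Proj A\<close> sends a homogeneous prime of \<open>A / I\<close> to
  its preimage in \<open>A\<close>; the image is the set of points of \<open>Proj A\<close> containing \<open>I\<close>.
\<close>

definition closed_subscheme_of_Proj ::
    "('a, 'z) graded_algebra_scheme \<Rightarrow> 'a set \<Rightarrow>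
      ('a set set, 'a set set \<Rightarrow> ('a set \<times> 'a set) set) ringed_space" where
  "closed_subscheme_of_Proj A I = Proj (quotient_algebra A I)"


section \<open>Orthogonal invariants of several vectors\<close>

text \<open>
  \<open>V\<close> is the whole type \<open>'v\<close> with scalar multiplication \<open>scale\<close>. A vector of \<open>V\<^sup>m\<close> is
  represented by a sequence \<open>v :: nat \<Rightarrow> 'v\<close> of which only \<open>v 0, \<dots>, v (m - 1)\<close> matter: the
  functions in \<open>polynomial_functions scale m\<close> do not depend on the other entries.
\<close>

definition nondegenerate_symmetric_form ::
    "(complex \<Rightarrow> 'v \<Rightarrow> 'v) \<Rightarrow> ('v::ab_group_add \<Rightarrow> 'v \<Rightarrow> complex) \<Rightarrow> bool" where
  "nondegenerate_symmetric_form scale B \<longleftrightarrow>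
    (\<forall>x. Vector_Spaces.linear scale (*) (\<lambda>y. B x y)) \<and>
    (\<forall>y. Vector_Spaces.linear scale (*) (\<lambda>x. B x y)) \<and>
    (\<forall>x y. B x y = B y x) \<and>
    (\<forall>x. (\<forall>y. B x y = 0) \<longrightarrow> x = 0)"

definition orthogonal_group ::
    "(complex \<Rightarrow> 'v \<Rightarrow> 'v) \<Rightarrow> ('v::ab_group_add \<Rightarrow> 'v \<Rightarrow> complex) \<Rightarrow> ('v \<Rightarrow> 'v) set" where
  "orthogonal_group scale B =
    {g. Vector_Spaces.linear scale scale g \<and> bij g \<and> (\<forall>x y. B (g x) (g y) = B x y)}"

inductive_set polynomial_functions ::
    "(complex \<Rightarrow> 'v \<Rightarrow> 'v) \<Rightarrow> nat \<Rightarrow> ((nat \<Rightarrow> 'v::ab_group_add) \<Rightarrow> complex) set"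
  for scale :: "complex \<Rightarrow> 'v \<Rightarrow> 'v" and m :: nat where
  const: "(\<lambda>v. c) \<in> polynomial_functions scale m"
| coord: "i < m \<Longrightarrow> Vector_Spaces.linear scale (*) l \<Longrightarrow>
    (\<lambda>v. l (v i)) \<in> polynomial_functions scale m"
| add: "f \<in> polynomial_functions scale m \<Longrightarrow> g \<in> polynomial_functions scale m \<Longrightarrow>
    (\<lambda>v. f v + g v) \<in> polynomial_functions scale m"
| mult: "f \<in> polynomial_functions scale m \<Longrightarrow> g \<in> polynomial_functions scale m \<Longrightarrow>
    (\<lambda>v. f v * g v) \<in> polynomial_functions scale m"

definition multihomogeneous_invariants ::
    "(complex \<Rightarrow> 'v \<Rightarrow> 'v) \<Rightarrow> ('v::ab_group_add \<Rightarrow> 'v \<Rightarrow> complex) \<Rightarrow> nat \<Rightarrow> nat \<Rightarrow>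
      ((nat \<Rightarrow> 'v) \<Rightarrow> complex) set" where
  "multihomogeneous_invariants scale B m d =
    {f \<in> polynomial_functions scale m.
      (\<forall>g \<in> orthogonal_group scale B. \<forall>v. f (\<lambda>i. g (v i)) = f v) \<and>
      (\<forall>i<m. \<forall>c v. f (v(i := scale c (v i))) = c ^ d * f v)}"

text \<open>
  The direct sum over \<open>d\<close> is taken inside the ring of polynomial functions, where the summands
  are independent for \<open>m \<ge> 1\<close>.
\<close>

definition orthogonal_invariants ::
    "(complex \<Rightarrow> 'v \<Rightarrow> 'v) \<Rightarrow> ('v::ab_group_add \<Rightarrow> 'v \<Rightarrow> complex) \<Rightarrow> nat \<Rightarrow>
      ((nat \<Rightarrow> 'v) \<Rightarrow> complex) graded_algebra" where
  "orthogonal_invariants scale B m =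
    \<lparr>carrier = {\<lambda>v. \<Sum>d\<le>N. h d v | N h. \<forall>d\<le>N. h d \<in> multihomogeneous_invariants scale B m d},
     monoid.mult = (\<lambda>f g v. f v * g v), one = (\<lambda>v. 1),
     zero = (\<lambda>v. 0), add = (\<lambda>f g v. f v + g v),
     grade = multihomogeneous_invariants scale B m,
     scalar = (\<lambda>c v. c)\<rparr>"


section \<open>Torus invariants of symmetric matrices\<close>

text \<open>
  The variable \<open>X\<^sub>i\<^sub>j\<close> with \<open>i \<le> j\<close> is indexed by the pair \<open>(i, j)\<close>, rows and columns being numbered
  \<open>0, \<dots>, m - 1\<close>. A polynomial maps each exponent vector, that is each monomial, to its
  coefficient; the product of the type \<open>\<Rightarrow>\<^sub>0\<close> is the convolution product.
\<close>

type_synonym sym_poly = "((nat \<times> nat) \<Rightarrow>\<^sub>0 nat) \<Rightarrow>\<^sub>0 complex"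

definition sym_polys :: "nat \<Rightarrow> sym_poly set" where
  "sym_polys m = {p. \<forall>a \<in> Poly_Mapping.keys p. Poly_Mapping.keys a \<subseteq> {(i, j). i \<le> j \<and> j < m}}"

definition sym_ring :: "nat \<Rightarrow> sym_poly ring" where
  "sym_ring m = \<lparr>carrier = sym_polys m, monoid.mult = (*), one = 1, zero = 0, add = (+)\<rparr>"

text \<open>The substitution \<open>X\<^sub>i\<^sub>j \<mapsto> z\<^sub>i z\<^sub>j X\<^sub>i\<^sub>j\<close>.\<close>

definition scale_entries :: "(nat \<Rightarrow> complex) \<Rightarrow> sym_poly \<Rightarrow> sym_poly" where
  "scale_entries z p = (\<Sum>a \<in> Poly_Mapping.keys p. Poly_Mapping.single a
    (Poly_Mapping.lookup p a *
      (\<Prod>(i, j) \<in> Poly_Mapping.keys a. (z i * z j) ^ Poly_Mapping.lookup a (i, j))))"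

text \<open>
  \<open>Proj (sym_invariants m)\<close> is the toric variety \<open>\<S>\<^sub>m\<close>. The grading is by \<open>d\<close> where
  \<open>(z\<^sub>1, \<dots>, z\<^sub>m)\<close>, not only with product one, acts by the character \<open>(z\<^sub>1 \<dots> z\<^sub>m)\<^sup>d\<close>.
\<close>

definition sym_invariants :: "nat \<Rightarrow> sym_poly graded_algebra" where
  "sym_invariants m =
    \<lparr>carrier = {p \<in> sym_polys m. \<forall>z. (\<forall>i<m. z i \<noteq> 0) \<and> (\<Prod>i<m. z i) = 1 \<longrightarrow> scale_entries z p = p},
     monoid.mult = (*), one = 1, zero = 0, add = (+),
     grade = (\<lambda>d. {p \<in> sym_polys m. \<forall>z. (\<forall>i<m. z i \<noteq> 0) \<longrightarrow>
       scale_entries z p = Poly_Mapping.single 0 ((\<Prod>i<m. z i) ^ d) * p}),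
     scalar = Poly_Mapping.single 0\<rparr>"

definition generic_symmetric_matrix :: "nat \<Rightarrow> sym_poly mat" where
  "generic_symmetric_matrix m =
    mat m m (\<lambda>(i, j). Poly_Mapping.single (Poly_Mapping.single (min i j, max i j) 1) 1)"

text \<open>
  The ideal \<open>\<D>\<^sub>m(k)\<close> of the symmetric matrices of rank at most \<open>k\<close>, generated by the minors
  of size \<open>k + 1\<close>; it is the zero ideal if \<open>m \<le> k\<close>.
\<close>

definition determinantal_ideal :: "nat \<Rightarrow> nat \<Rightarrow> sym_poly set" where
  "determinantal_ideal m k = genideal (sym_ring m)
    {Determinant.det (submatrix (generic_symmetric_matrix m) I J) | I J.
      I \<subseteq> {..<m} \<and> J \<subseteq> {..<m} \<and> card I = k + 1 \<and> card J = k + 1}"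

end

theory Submission
  imports Defs "HOL-Analysis.Derivative"
begin

text \<open>
  Write \<open>N = n + 1\<close> and choose an orthonormal basis of \<open>V\<close>. Sending \<open>X\<^sub>i\<^sub>j\<close> to
  \<open>\<langle>v\<^sub>i, v\<^sub>j\<rangle>\<close> is a graded homomorphism from the torus invariants to the orthogonal invariants;
  that it is onto is the first fundamental theorem for the orthogonal group, and that its kernel is
  generated by the minors of size \<open>N + 1\<close> is the second.

  Both follow from one principle for the polarization operators
  \<open>D\<^sub>i\<^sub>j = \<Sum>\<^sub>b y\<^sub>i\<^sub>b \<partial>/\<partial>y\<^sub>j\<^sub>b\<close>. These are adjoint to \<open>D\<^sub>j\<^sub>i\<close> for the Fischer inner product, so if
  \<open>U \<subseteq> W\<close> are stable spaces of polynomials, a nonzero orthogonal complement of \<open>U\<close> in \<open>W\<close> would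
  contain a highest weight vector; hence \<open>U = W\<close> as soon as \<open>U\<close> contains the highest weight vectors
  of \<open>W\<close>. By the Gram-Schmidt process an orthogonally invariant highest weight vector is determined
  by its weight, which is even and dominant, so it is a scalar times a product of leading principal
  minors of the Gram matrix. Such a product is a polynomial in the Gram matrix, and if it vanishes on
  Gram matrices of rank at most \<open>N\<close> then one of the factors has size larger than \<open>N\<close>.
\<close>

declare single_of_nat [simp del]

type_synonym 'x cpoly = "('x \<Rightarrow>\<^sub>0 nat) \<Rightarrow>\<^sub>0 complex"

abbreviation single where "single \<equiv> Poly_Mapping.single"
abbreviation cst :: "complex \<Rightarrow> 'x cpoly" where "cst \<equiv> Poly_Mapping.single 0"
definition var :: "'x \<Rightarrow> 'x cpoly" where
  "var k = single (single k 1) 1"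
abbreviation lookup where "lookup \<equiv> Poly_Mapping.lookup"
abbreviation keys where "keys \<equiv> Poly_Mapping.keys"

definition polys :: "'x set \<Rightarrow> 'x cpoly set" where
  "polys S = {p. \<forall>a\<in>keys p. keys a \<subseteq> S}"

lemma sym_polys_eq: "sym_polys m = polys {(i, j). i \<le> j \<and> j < m}"
  by (simp add: sym_polys_def polys_def)

lemma keys_add_nat: "keys (a + b) = keys a \<union> keys (b :: 'x \<Rightarrow>\<^sub>0 nat)"
  by (auto simp: in_keys_iff lookup_add)

lemma cpoly_sum_monomials: "(p :: 'x cpoly) = (\<Sum>a\<in>keys p. single a (lookup p a))"
proof (rule poly_mapping_eqI)
  fix b
  have "lookup (\<Sum>a\<in>keys p. single a (lookup p a)) b
      = (\<Sum>a\<in>keys p. if a = b then lookup p b else 0)"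
    by (auto simp: lookup_sum lookup_single when_def intro!: sum.cong)
  also have "\<dots> = lookup p b" by (auto simp: sum.delta in_keys_iff)
  finally show "lookup p b = lookup (\<Sum>a\<in>keys p. single a (lookup p a)) b" by simp
qed

lemma exponent_induct [case_names zero step]:
  fixes a :: "'x \<Rightarrow>\<^sub>0 nat"
  assumes "P 0" and step: "\<And>a k. P a \<Longrightarrow> P (single k 1 + a)"
  shows "P a"
proof (induction "\<Sum>k\<in>keys a. lookup a k" arbitrary: a)
  case 0
  then have "a = 0" by (auto simp: in_keys_iff intro!: poly_mapping_eqI)
  then show ?case using assms by simp
next
  case (Suc n)
  then obtain k where k: "k \<in> keys a" by fastforce
  let ?e = "single k (1::nat)"
  have a: "a = ?e + (a - ?e)"
    using k by (intro poly_mapping_eqI) (auto simp: lookup_add lookup_minus lookup_single when_def in_keys_iff)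
  have "keys a = insert k (keys (a - ?e))" by (subst a) (simp add: keys_add_nat)
  then have "(\<Sum>l\<in>keys a. lookup (a - ?e) l) = (\<Sum>l\<in>keys (a - ?e). lookup (a - ?e) l)"
    by (intro sum.mono_neutral_right) (auto simp: in_keys_iff)
  moreover have "(\<Sum>l\<in>keys a. lookup a l) = (\<Sum>l\<in>keys a. lookup ?e l) + (\<Sum>l\<in>keys a. lookup (a - ?e) l)"
    by (simp only: sum.distrib[symmetric] lookup_add[symmetric] a[symmetric])
  moreover have "(\<Sum>l\<in>keys a. lookup ?e l) = 1"
    using k by (simp add: lookup_single when_def)
  ultimately have "n = (\<Sum>l\<in>keys (a - ?e). lookup (a - ?e) l)" using Suc(2) by simp
  from Suc(1)[OF this] step a show ?case by metis
qed

lemma polys_cst [simp, intro]: "cst c \<in> polys S"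
  by (auto simp: polys_def split: if_splits)

lemma polys_zero [simp, intro]: "0 \<in> polys S" and polys_one [simp, intro]: "1 \<in> polys S"
  by (auto simp: polys_def)

lemma polys_var [intro]: "k \<in> S \<Longrightarrow> var k \<in> polys S"
  by (auto simp: polys_def var_def)

lemma polys_add [intro]: "p \<in> polys S \<Longrightarrow> q \<in> polys S \<Longrightarrow> p + q \<in> polys S"
  using keys_add[of p q] by (auto simp: polys_def)

lemma polys_uminus [intro]: "p \<in> polys S \<Longrightarrow> - p \<in> polys S"
  by (simp add: polys_def in_keys_iff)

lemma polys_diff [intro]: "p \<in> polys S \<Longrightarrow> q \<in> polys S \<Longrightarrow> p - q \<in> polys S"
  using polys_add[of p S "- q"] polys_uminus[of q S] by simp

lemma polys_mult [intro]: "p \<in> polys S \<Longrightarrow> q \<in> polys S \<Longrightarrow> p * q \<in> polys S"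
  using keys_mult[of p q] by (fastforce simp: polys_def keys_add_nat)

lemma polys_sum [intro]: "(\<And>i. i \<in> I \<Longrightarrow> f i \<in> polys S) \<Longrightarrow> sum f I \<in> polys S"
  by (induction I rule: infinite_finite_induct) auto

lemma polys_prod [intro]: "(\<And>i. i \<in> I \<Longrightarrow> f i \<in> polys S) \<Longrightarrow> prod f I \<in> polys S"
  by (induction I rule: infinite_finite_induct) auto

lemma polys_power [intro]: "p \<in> polys S \<Longrightarrow> p ^ n \<in> polys S"
  by (induction n) auto

lemma polys_mono: "S \<subseteq> T \<Longrightarrow> polys S \<subseteq> polys T"
  by (auto simp: polys_def)

lemma polys_induct [consumes 1, case_names cst var add mult]:
  assumes p: "p \<in> polys S"
    and cst: "\<And>c. P (cst c)" and var: "\<And>k. k \<in> S \<Longrightarrow> P (var k)"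
    and add: "\<And>p q. p \<in> polys S \<Longrightarrow> q \<in> polys S \<Longrightarrow> P p \<Longrightarrow> P q \<Longrightarrow> P (p + q)"
    and mult: "\<And>p q. p \<in> polys S \<Longrightarrow> q \<in> polys S \<Longrightarrow> P p \<Longrightarrow> P q \<Longrightarrow> P (p * q)"
  shows "P p"
proof -
  have mono: "keys a \<subseteq> S \<longrightarrow> single a c \<in> polys S \<and> P (single a c)" for a c
  proof (induction a rule: exponent_induct)
    case zero
    then show ?case using cst by simp
  next
    case (step a k)
    have "single (single k 1 + a) c = var k * single a c"
      by (simp add: mult_single var_def)
    then show ?case using step var mult polys_var[of k S]
      by (auto simp: keys_add_nat)
  qed
  have "(\<Sum>a\<in>A. single a (lookup p a)) \<in> polys S \<and> P (\<Sum>a\<in>A. single a (lookup p a))"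
    if "finite A" "A \<subseteq> keys p" for A
    using that
  proof (induction A)
    case empty
    then show ?case using cst[of 0] by simp
  next
    case (insert a A)
    then have "keys a \<subseteq> S" "a \<in> keys p" using p by (auto simp: polys_def)
    with insert mono[of a] add show ?case by auto
  qed
  from this[of "keys p"] show ?thesis using cpoly_sum_monomials[of p] by simp
qed

lemma polys_UNIV [simp]: "p \<in> polys UNIV"
  by (simp add: polys_def)

lemma lookup_cst_mult [simp]: "lookup (cst c * p) a = c * lookup p a"
proof -
  have "lookup (cst c * p) a = lookup (Poly_Mapping.map ((*) c) p) a"
    by (simp add: mult_map_scale_conv_mult)
  also have "\<dots> = c * lookup p a" by (simp add: Poly_Mapping.map.rep_eq when_def)
  finally show ?thesis .
qed

lemma lookup_var_mult:
  "lookup (var k * p) a = (if lookup a k = 0 then 0 else lookup p (a - single k 1))"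
proof -
  have "lookup (var k * single b c) a
    = (if lookup a k = 0 then 0 else lookup (single b c) (a - single k 1))"
    for b c
  proof -
    have "(single k 1 + b = a) = (lookup a k \<noteq> 0 \<and> b = a - single k 1)"
      by (auto simp: poly_mapping_eq_iff fun_eq_iff lookup_add lookup_minus lookup_single when_def)
    then show ?thesis by (auto simp: mult_single lookup_single when_def var_def)
  qed
  note * = this
  show ?thesis
    by (subst (1 2) cpoly_sum_monomials[of p])
      (simp add: sum_distrib_left lookup_sum *)
qed

section \<open>Substitution\<close>

definition psubst :: "(complex \<Rightarrow> 'b) \<Rightarrow> ('x \<Rightarrow> 'b) \<Rightarrow> 'x cpoly \<Rightarrow> 'b::comm_ring_1" where
  "psubst \<sigma> g p = (\<Sum>a\<in>keys p. \<sigma> (lookup p a) * (\<Prod>k\<in>keys a. g k ^ lookup a k))"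

lemma prod_keys_superset:
  assumes "finite T" "keys a \<subseteq> T"
  shows "(\<Prod>k\<in>keys a. g k ^ lookup a k) = (\<Prod>k\<in>T. g k ^ lookup (a :: 'x \<Rightarrow>\<^sub>0 nat) k)"
  using assms by (intro prod.mono_neutral_left) (auto simp: in_keys_iff)

lemma prod_keys_add:
  "(\<Prod>k\<in>keys (a + b). g k ^ lookup (a + b) k)
    = (\<Prod>k\<in>keys a. g k ^ lookup a k) * (\<Prod>k\<in>keys b. g k ^ lookup b k :: 'b::comm_monoid_mult)"
  for a b :: "'x \<Rightarrow>\<^sub>0 nat"
proof -
  let ?T = "keys a \<union> keys b"
  show ?thesis
    by (subst (1 2 3) prod_keys_superset[of ?T])
      (auto simp: keys_add_nat lookup_add power_add prod.distrib)
qed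

context
  fixes \<sigma> :: "complex \<Rightarrow> 'b::comm_ring_1"
  assumes \<sigma>: "\<And>x y. \<sigma> (x + y) = \<sigma> x + \<sigma> y" "\<And>x y. \<sigma> (x * y) = \<sigma> x * \<sigma> y" "\<sigma> 0 = 0" "\<sigma> 1 = 1"
begin

lemma psubst_superset:
  assumes "finite T" "keys p \<subseteq> T"
  shows "psubst \<sigma> g p = (\<Sum>a\<in>T. \<sigma> (lookup p a) * (\<Prod>k\<in>keys a. g k ^ lookup a k))"
  unfolding psubst_def using assms \<sigma> by (intro sum.mono_neutral_left) (auto simp: in_keys_iff)

lemma psubst_add: "psubst \<sigma> g (p + q) = psubst \<sigma> g p + psubst \<sigma> g q"
  by (subst (1 2 3) psubst_superset[of "keys p \<union> keys q"])
    (use keys_add[of p q] in \<open>auto simp: lookup_add \<sigma> algebra_simps sum.distrib\<close>)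

lemma psubst_single: "psubst \<sigma> g (single a c) = \<sigma> c * (\<Prod>k\<in>keys a. g k ^ lookup a k)"
  by (subst psubst_superset[of "{a}"]) auto

lemma psubst_cst [simp]: "psubst \<sigma> g (cst c) = \<sigma> c"
  by (simp add: psubst_single)

lemma psubst_var [simp]: "psubst \<sigma> g (var k) = g k"
  by (simp add: psubst_single \<sigma> var_def)

lemma psubst_zero: "psubst \<sigma> g 0 = 0" by (simp add: psubst_def)

lemma psubst_one: "psubst \<sigma> g 1 = 1"
  using psubst_cst[of g 1] \<sigma> by simp

lemma psubst_sum: "psubst \<sigma> g (sum f I) = (\<Sum>i\<in>I. psubst \<sigma> g (f i))"
  by (induction I rule: infinite_finite_induct) (auto simp: psubst_zero psubst_add)

lemma psubst_mult: "psubst \<sigma> g (p * q) = psubst \<sigma> g p * psubst \<sigma> g q"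
  by (subst (1 2 3 4) cpoly_sum_monomials)
    (simp only: sum_product psubst_sum psubst_single mult_single prod_keys_add \<sigma> mult.assoc mult.left_commute)

lemma psubst_prod: "psubst \<sigma> g (prod f I) = (\<Prod>i\<in>I. psubst \<sigma> g (f i))"
  by (induction I rule: infinite_finite_induct) (auto simp: psubst_one psubst_mult)

lemma psubst_power: "psubst \<sigma> g (p ^ n) = psubst \<sigma> g p ^ n"
  by (induction n) (auto simp: psubst_one psubst_mult)

lemma psubst_uminus: "psubst \<sigma> g (- p) = - psubst \<sigma> g p"
  using psubst_add[of g p "- p"] by (simp add: psubst_zero add_eq_0_iff)

lemma psubst_diff: "psubst \<sigma> g (p - q) = psubst \<sigma> g p - psubst \<sigma> g q"
  using psubst_add[of g p "- q"] by (simp add: psubst_uminus)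

lemma psubst_comm_ring_hom: "comm_ring_hom (psubst \<sigma> g)"
  by unfold_locales (auto simp: psubst_zero psubst_one psubst_add psubst_mult)

lemma psubst_cong:
  assumes "p \<in> polys S" "\<And>k. k \<in> S \<Longrightarrow> g k = h k"
  shows "psubst \<sigma> g p = psubst \<sigma> h p"
  using assms(1) by (induction rule: polys_induct) (auto simp: psubst_add psubst_mult assms(2))

end

abbreviation eval :: "('x \<Rightarrow> complex) \<Rightarrow> 'x cpoly \<Rightarrow> complex" where
  "eval \<equiv> psubst (\<lambda>c. c)"

abbreviation compose :: "('x \<Rightarrow> 'y cpoly) \<Rightarrow> 'x cpoly \<Rightarrow> 'y cpoly" where
  "compose \<equiv> psubst cst"

lemmas eval_simps [simp] =
  psubst_add[where \<sigma> = "\<lambda>c. c", simplified] psubst_mult[where \<sigma> = "\<lambda>c. c", simplified]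
  psubst_zero[where \<sigma> = "\<lambda>c. c", simplified] psubst_one[where \<sigma> = "\<lambda>c. c", simplified]
  psubst_cst[where \<sigma> = "\<lambda>c. c", simplified] psubst_var[where \<sigma> = "\<lambda>c. c", simplified]
  psubst_sum[where \<sigma> = "\<lambda>c. c", simplified] psubst_prod[where \<sigma> = "\<lambda>c. c", simplified]
  psubst_power[where \<sigma> = "\<lambda>c. c", simplified] psubst_uminus[where \<sigma> = "\<lambda>c. c", simplified]
  psubst_diff[where \<sigma> = "\<lambda>c. c", simplified]

lemma cst_hom:
  "cst (x + y) = cst x + (cst y :: 'x cpoly)" "cst (x * y) = cst x * (cst y :: 'x cpoly)"
  "cst 0 = (0 :: 'x cpoly)" "cst 1 = (1 :: 'x cpoly)"
  by (simp_all add: single_add mult_single)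

lemmas compose_simps [simp] =
  psubst_add[OF cst_hom] psubst_mult[OF cst_hom] psubst_zero[OF cst_hom] psubst_one[OF cst_hom]
  psubst_cst[OF cst_hom] psubst_var[OF cst_hom] psubst_sum[OF cst_hom] psubst_prod[OF cst_hom]
  psubst_power[OF cst_hom] psubst_uminus[OF cst_hom] psubst_diff[OF cst_hom]

lemmas eval_hom = psubst_comm_ring_hom[where \<sigma> = "\<lambda>c. c", simplified]
lemmas eval_cong = psubst_cong[where \<sigma> = "\<lambda>c. c", simplified]

lemma eval_compose: "eval x (compose g p) = eval (\<lambda>k. eval x (g k)) p"
  using polys_UNIV[of p] by (induction rule: polys_induct) auto

lemma compose_in_polys:
  assumes "p \<in> polys S" "\<And>k. k \<in> S \<Longrightarrow> g k \<in> polys T"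
  shows "compose g p \<in> polys T"
  using assms(1) by (induction rule: polys_induct) (auto simp: assms(2))

section \<open>Partial derivatives\<close>

definition pderv :: "'x \<Rightarrow> 'x cpoly \<Rightarrow> 'x cpoly" where
  "pderv k p = (\<Sum>a\<in>keys p. single (a - single k 1)
     (of_nat (lookup a k) * lookup p a))"

lemma lookup_pderv:
  "lookup (pderv k p) b = of_nat (lookup b k + 1) * lookup p (single k 1 + b)"
proof -
  let ?e = "single k (1::nat)"
  have eq: "(if a - ?e = b then of_nat (lookup a k) * lookup p a else 0)
      = (if a = ?e + b then of_nat (lookup b k + 1) * lookup p (?e + b) else 0)" for a
  proof (cases "lookup a k = 0")
    case True
    then show ?thesis by (auto simp: lookup_add)
  next
    case False
    then have "a - ?e = b \<longleftrightarrow> a = ?e + b"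
      by (auto simp: poly_mapping_eq_iff fun_eq_iff lookup_add lookup_minus lookup_single when_def)
    then show ?thesis by (auto simp: lookup_add)
  qed
  have "lookup (pderv k p) b = (\<Sum>a\<in>keys p. if a - ?e = b then of_nat (lookup a k) * lookup p a else 0)"
    by (auto simp: pderv_def lookup_sum lookup_single when_def intro!: sum.cong)
  also have "\<dots> = of_nat (lookup b k + 1) * lookup p (?e + b)"
    by (simp only: eq) (auto simp: in_keys_iff sum.delta)
  finally show ?thesis .
qed

lemma pderv_add [simp]: "pderv k (p + q) = pderv k p + pderv k q"
  by (intro poly_mapping_eqI) (simp add: lookup_pderv lookup_add algebra_simps)

lemma pderv_cst_mult [simp]: "pderv k (cst c * p) = cst c * pderv k p"
  by (intro poly_mapping_eqI) (simp add: lookup_pderv)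

lemma pderv_cst [simp]: "pderv k (cst c) = 0"
  by (intro poly_mapping_eqI)
    (auto simp: lookup_pderv lookup_single when_def poly_mapping_eq_iff fun_eq_iff lookup_add split: if_splits)

lemma pderv_zero [simp]: "pderv k 0 = 0" by (simp add: pderv_def)

lemma pderv_one [simp]: "pderv k 1 = 0" using pderv_cst[of k 1] by simp

lemma pderv_var_mult: "pderv k (var l * p) = (if k = l then p else 0) + var l * pderv k p"
proof (rule poly_mapping_eqI)
  fix b
  let ?e = "\<lambda>k. single k (1::nat)"
  show "lookup (pderv k (var l * p)) b = lookup ((if k = l then p else 0) + var l * pderv k p) b"
  proof (cases "k = l")
    case True
    have "lookup b l \<noteq> 0 \<Longrightarrow> ?e l + (b - ?e l) = b"
      by (auto simp: poly_mapping_eq_iff fun_eq_iff lookup_add lookup_minus lookup_single when_def)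
    moreover have "of_nat (lookup b l - 1 + 1) = (of_nat (lookup b l) :: complex)" if "lookup b l \<noteq> 0"
      using that by (metis One_nat_def Suc_eq_plus1 Suc_pred neq0_conv)
    ultimately show ?thesis using True
      by (auto simp: lookup_pderv lookup_var_mult lookup_add lookup_minus distrib_right)
  next
    case False
    have "?e k + b - ?e l = ?e k + (b - ?e l)" if "lookup b l \<noteq> 0"
      using False that
      by (auto simp: poly_mapping_eq_iff fun_eq_iff lookup_add lookup_minus lookup_single when_def)
    then show ?thesis using False
      by (auto simp: lookup_pderv lookup_var_mult lookup_add lookup_minus lookup_single)
  qed
qed

lemma pderv_mult [simp]: "pderv k (p * q) = pderv k p * q + p * pderv k q"
proof -
  have "\<forall>q. pderv k (p * q) = pderv k p * q + p * pderv k q"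
    using polys_UNIV[of p]
  proof (induction rule: polys_induct)
    case (var l)
    then show ?case using pderv_var_mult[of k l 1] by (simp add: pderv_var_mult)
  next
    case (mult p q)
    then show ?case by (simp add: mult.assoc) (simp add: algebra_simps)
  qed (simp_all add: distrib_left distrib_right add_ac)
  then show ?thesis by blast
qed

lemma pderv_var: "pderv k (var l) = (if k = l then 1 else 0)"
  using pderv_var_mult[of k l 1] by simp

lemma pderv_polys [intro]: "p \<in> polys S \<Longrightarrow> pderv k p \<in> polys S"
  by (induction rule: polys_induct) (auto simp: pderv_var)

lemma has_field_derivative_eval:
  assumes "p \<in> polys S" "finite S"
    and x: "\<And>k. k \<in> S \<Longrightarrow> ((\<lambda>t. x t k) has_field_derivative x' k) (at t)"
  shows "((\<lambda>t. eval (x t) p) has_field_derivative (\<Sum>k\<in>S. eval (x t) (pderv k p) * x' k)) (at t)"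
  using assms(1)
proof (induction rule: polys_induct)
  case (cst c)
  then show ?case by simp
next
  case (var k)
  have "(\<Sum>l\<in>S. eval (x t) (pderv l (var k)) * x' l) = (\<Sum>l\<in>S. if l = k then x' l else 0)"
    by (intro sum.cong) (auto simp: pderv_var)
  also have "\<dots> = x' k" using var assms by simp
  finally show ?case using x[OF var] by simp
next
  case (add p q)
  then show ?case by (auto intro!: derivative_eq_intros simp: sum.distrib algebra_simps)
next
  case (mult p q)
  show ?case
    by (auto intro!: derivative_eq_intros mult.IH simp: sum.distrib algebra_simps sum_distrib_left)
qed

lemma eval_eq_zero_imp_zero:
  fixes p :: "'a cpoly"
  assumes "\<And>x. eval x p = 0"
  shows "p = 0"
proof (rule poly_mapping_eqI)
  fix a
  have "\<forall>p :: 'a cpoly. (\<forall>x. eval x p = 0) \<longrightarrow> lookup p a = 0"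
  proof (induction a rule: exponent_induct)
    case zero
    have "lookup p 0 = eval (\<lambda>_. 0) p" for p :: "'a cpoly"
      using polys_UNIV[of p]
    proof (induction rule: polys_induct)
      case (mult p q)
      have "lookup (p * q) 0 = lookup p 0 * lookup q 0" for p q :: "'a cpoly"
        using polys_UNIV[of p]
      proof (induction p arbitrary: q rule: polys_induct)
        case (mult p q)
        then show ?case by (metis mult.assoc)
      next
        case (var k)
        have "single k (Suc 0) \<noteq> 0"
          by (metis lookup_single_eq lookup_zero nat.distinct(1))
        then show ?case by (simp add: lookup_var_mult) (simp add: var_def lookup_single when_def)
      qed (simp_all add: distrib_right lookup_add)
      then show ?case using mult by simp
    next
      case (var k)
      show ?case using lookup_var_mult[of k 1 0] by simp
    qed (simp_all add: lookup_add lookup_single when_def)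
    then show ?case by simp
  next
    case (step a k)
    show ?case
    proof (intro allI impI)
      fix p :: "'a cpoly" assume p: "\<forall>x. eval x p = 0"
      have "eval x (pderv k p) = 0" for x
      proof -
        define S where "S = insert k (\<Union>a\<in>keys p. keys a)"
        have S: "p \<in> polys S" "finite S" "k \<in> S" by (auto simp: polys_def S_def)
        have D: "((\<lambda>t. eval (\<lambda>l. x l + (if l = k then t else 0)) p) has_field_derivative
           (\<Sum>l\<in>S. eval (\<lambda>l. x l + (if l = k then 0 else 0)) (pderv l p) * (if l = k then 1 else 0))) (at 0)"
        proof (intro has_field_derivative_eval S)
          show "((\<lambda>t. x l + (if l = k then t else 0)) has_field_derivative (if l = k then 1 else 0)) (at 0)" for l
            by (cases "l = k") (auto intro!: derivative_eq_intros)
        qed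
        have "((\<lambda>t. eval (\<lambda>l. x l + (if l = k then t else 0)) p) has_field_derivative 0) (at 0)"
          using p by simp
        from DERIV_unique[OF D this]
        have "0 = (\<Sum>l\<in>S. eval (\<lambda>l. x l + (if l = k then 0 else 0)) (pderv l p) * (if l = k then 1 else 0))"
          by (rule sym)
        also have "\<dots> = (\<Sum>l\<in>S. if l = k then eval x (pderv k p) else 0)"
          by (intro sum.cong) auto
        also have "\<dots> = eval x (pderv k p)" using S by simp
        finally show ?thesis by (rule sym)
      qed
      then have "lookup (pderv k p) a = 0" using step by blast
      then show "lookup p (single k 1 + a) = 0"
        using of_nat_neq_0[of "lookup a k", where 'a = complex] by (simp add: lookup_pderv)
    qed
  qed
  then show "lookup p a = lookup 0 a" using assms by simp
qed

lemma cpoly_eqI: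
  assumes "\<And>x. eval x p = eval x q" shows "p = q"
  using eval_eq_zero_imp_zero[of "p - q"] assms by simp

section \<open>The Fischer inner product\<close>

definition mfact :: "('x \<Rightarrow>\<^sub>0 nat) \<Rightarrow> nat" where
  "mfact a = (\<Prod>k\<in>keys a. fact (lookup a k))"

lemma mfact_pos: "mfact a > 0"
  by (simp add: mfact_def prod_pos)

lemma mfact_single_add: "mfact (single k 1 + a) = (lookup a k + 1) * mfact a"
proof -
  let ?T = "insert k (keys a)" and ?b = "single k 1 + a"
  have *: "mfact c = (\<Prod>l\<in>?T. fact (lookup c l))" if "keys c \<subseteq> ?T" for c :: "'a \<Rightarrow>\<^sub>0 nat"
    unfolding mfact_def using that by (intro prod.mono_neutral_left) (auto simp: in_keys_iff)
  have "mfact ?b = (\<Prod>l\<in>?T. fact (lookup ?b l))" by (rule *) (auto simp: keys_add_nat)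
  also have "\<dots> = fact (lookup a k + 1) * (\<Prod>l\<in>?T - {k}. fact (lookup ?b l))"
    by (subst prod.remove[of _ k]) (auto simp: lookup_add)
  also have "(\<Prod>l\<in>?T - {k}. fact (lookup ?b l)) = (\<Prod>l\<in>?T - {k}. (fact (lookup a l) :: nat))"
    by (intro prod.cong) (auto simp: lookup_add lookup_single)
  also have "fact (lookup a k + 1) * \<dots> = (lookup a k + 1) * (\<Prod>l\<in>?T. fact (lookup a l))"
    by (subst (2) prod.remove[of _ k]) (auto simp: algebra_simps)
  also have "\<dots> = (lookup a k + 1) * mfact a" by (subst *[of a]) auto
  finally show ?thesis .
qed

definition fischer :: "'x cpoly \<Rightarrow> 'x cpoly \<Rightarrow> complex" where
  "fischer p q = (\<Sum>a\<in>keys p. lookup p a * cnj (lookup q a) * of_nat (mfact a))"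

lemma fischer_superset:
  assumes "finite T" "keys p \<subseteq> T"
  shows "fischer p q = (\<Sum>a\<in>T. lookup p a * cnj (lookup q a) * of_nat (mfact a))"
  unfolding fischer_def using assms by (intro sum.mono_neutral_left) (auto simp: in_keys_iff)

lemma fischer_add_left: "fischer (p + q) r = fischer p r + fischer q r"
  by (subst (1 2 3) fischer_superset[of "keys p \<union> keys q"])
    (use keys_add[of p q] in \<open>auto simp: lookup_add algebra_simps sum.distrib\<close>)

lemma fischer_commute: "fischer p q = cnj (fischer q p)"
  by (subst (1 2) fischer_superset[of "keys p \<union> keys q"]) (auto simp: algebra_simps)

lemma fischer_add_right: "fischer p (q + r) = fischer p q + fischer p r"
  by (simp add: fischer_def lookup_add algebra_simps sum.distrib)

lemma fischer_cst_left: "fischer (cst c * p) q = c * fischer p q"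
  by (subst (1 2) fischer_superset[of "keys p"])
    (auto simp: in_keys_iff sum_distrib_left mult.assoc)

lemma fischer_cst_right: "fischer p (cst c * q) = cnj c * fischer p q"
  by (simp add: fischer_def sum_distrib_left) (simp add: mult_ac)

lemma fischer_zero_left [simp]: "fischer 0 q = 0" and fischer_zero_right [simp]: "fischer p 0 = 0"
  by (simp_all add: fischer_def)

lemma fischer_diff_left: "fischer (p - q) r = fischer p r - fischer q r"
  using fischer_add_left[of "p - q" q r] by simp

lemma fischer_sum_left: "fischer (sum f I) r = (\<Sum>i\<in>I. fischer (f i) r)"
  by (induction I rule: infinite_finite_induct) (auto simp: fischer_add_left)

lemma fischer_self: "fischer p p = of_real (\<Sum>a\<in>keys p. (cmod (lookup p a))\<^sup>2 * mfact a)"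
  by (simp add: fischer_def complex_norm_square flip: of_real_power)

lemma fischer_self_nonneg: "Re (fischer p p) \<ge> 0"
  by (simp add: fischer_self sum_nonneg)

lemma fischer_self_pos: "p \<noteq> 0 \<Longrightarrow> Re (fischer p p) > 0"
  unfolding fischer_self Re_complex_of_real
  by (intro sum_pos) (auto simp: in_keys_iff mfact_pos)

lemma fischer_self_eq_zero: "fischer p p = 0 \<Longrightarrow> p = 0"
  using fischer_self_pos[of p] by fastforce

lemma fischer_var_mult: "fischer (var k * p) q = fischer p (pderv k q)"
proof -
  have single: "fischer (single b c) q = c * cnj (lookup q b) * of_nat (mfact b)" for b c q
    by (subst fischer_superset[of "{b}"]) auto
  have "fischer (var k * single b c) q = fischer (single b c) (pderv k q)" for b c
    by (simp only: var_def mult_single single mfact_single_add lookup_pderv mult_1)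
      (simp add: algebra_simps)
  then show ?thesis
    by (subst (1 2) cpoly_sum_monomials[of p]) (simp add: sum_distrib_left fischer_sum_left)
qed

lemma fischer_pderv: "fischer (pderv k p) q = fischer p (var k * q)"
  by (metis fischer_commute fischer_var_mult)

definition subspace_of :: "'x cpoly set \<Rightarrow> bool" where
  "subspace_of W \<longleftrightarrow> 0 \<in> W \<and> (\<forall>p\<in>W. \<forall>q\<in>W. p + q \<in> W) \<and> (\<forall>c. \<forall>p\<in>W. cst c * p \<in> W)"

lemma subspace_diff: "subspace_of W \<Longrightarrow> p \<in> W \<Longrightarrow> q \<in> W \<Longrightarrow> p - q \<in> W"
proof -
  assume W: "subspace_of W" "p \<in> W" "q \<in> W"
  have "p - q = p + cst (- 1) * q" by (simp add: single_uminus)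
  with W show ?thesis unfolding subspace_of_def by metis
qed

lemma keys_cst_mult: "keys (cst c * p) \<subseteq> keys p"
  by (auto simp: in_keys_iff)

text \<open>Gram--Schmidt, adding one monomial of \<open>T\<close> at a time.\<close>

lemma fischer_projection:
  assumes W: "subspace_of W" and "finite T"
  shows "\<exists>p\<in>W. keys p \<subseteq> T \<and> (\<forall>w\<in>W. keys w \<subseteq> T \<longrightarrow> fischer (f - p) w = 0)"
  using \<open>finite T\<close>
proof (induction T arbitrary: f)
  case empty
  have "(0 :: 'a cpoly) \<in> W" using W by (simp add: subspace_of_def)
  then show ?case by (intro bexI[of _ 0]) auto
next
  case (insert a T)
  show ?case
  proof (cases "\<exists>w\<in>W. keys w \<subseteq> insert a T \<and> lookup w a \<noteq> 0")
    case False
    obtain p where p: "p \<in> W" "keys p \<subseteq> T" "\<forall>w\<in>W. keys w \<subseteq> T \<longrightarrow> fischer (f - p) w = 0"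
      using insert.IH by blast
    have "keys w \<subseteq> T" if "w \<in> W" "keys w \<subseteq> insert a T" for w
      using False that by (auto simp: in_keys_iff)
    with p show ?thesis by (intro bexI[of _ p]) auto
  next
    case True
    then obtain w0 where w0: "w0 \<in> W" "keys w0 \<subseteq> insert a T" "lookup w0 a \<noteq> 0" by blast
    obtain q where q: "q \<in> W" "keys q \<subseteq> T" "\<And>w. w \<in> W \<Longrightarrow> keys w \<subseteq> T \<Longrightarrow> fischer (w0 - q) w = 0"
      using insert.IH[of w0] by blast
    obtain p where p: "p \<in> W" "keys p \<subseteq> T" "\<And>w. w \<in> W \<Longrightarrow> keys w \<subseteq> T \<Longrightarrow> fischer (f - p) w = 0"
      using insert.IH[of f] by blast
    define w1 where "w1 = w0 - q"
    have w1: "w1 \<in> W" "keys w1 \<subseteq> insert a T" "lookup w1 a = lookup w0 a"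
      "\<And>w. w \<in> W \<Longrightarrow> keys w \<subseteq> T \<Longrightarrow> fischer w1 w = 0"
      using w0 q insert.hyps keys_diff[of w0 q]
      by (auto simp: w1_def subspace_diff[OF W] lookup_minus in_keys_iff)
    then have w1': "\<And>w. w \<in> W \<Longrightarrow> keys w \<subseteq> T \<Longrightarrow> fischer w w1 = 0"
      by (metis complex_cnj_zero fischer_commute)
    have "w1 \<noteq> 0" using w1 w0 by auto
    then have nz: "fischer w1 w1 \<noteq> 0" using fischer_self_eq_zero by blast
    define c where "c = fischer f w1 / fischer w1 w1"
    define r where "r = p + cst c * w1"
    have "r \<in> W" using p(1) w1(1) W unfolding r_def subspace_of_def by blast
    moreover have "keys r \<subseteq> insert a T"
      using p(2) w1(2) keys_add[of p "cst c * w1"] keys_cst_mult[of c w1] by (auto simp: r_def)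
    moreover have "fischer (f - r) w = 0" if w: "w \<in> W" "keys w \<subseteq> insert a T" for w
    proof -
      define d where "d = lookup w a / lookup w1 a"
      define u where "u = w - cst d * w1"
      have u: "u \<in> W" unfolding u_def
        using W w w1 by (intro subspace_diff) (auto simp: subspace_of_def)
      have "lookup u a = 0" using w0 by (simp add: u_def d_def lookup_minus w1)
      then have "a \<notin> keys u" by (simp add: in_keys_iff)
      moreover have "keys u \<subseteq> insert a T"
        using keys_diff[of w "cst d * w1"] keys_cst_mult[of d w1] w(2) w1(2) unfolding u_def by blast
      ultimately have "keys u \<subseteq> T" by blast
      with u have z: "fischer (f - p) u = 0" "fischer w1 u = 0" using p w1 by auto
      have wu: "w = u + cst d * w1" by (simp add: u_def)
      have "fischer (f - r) w1 = fischer f w1 - fischer p w1 - c * fischer w1 w1"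
        by (simp add: r_def fischer_diff_left fischer_add_left fischer_cst_left)
      also have "\<dots> = 0" using nz w1' p by (simp add: c_def)
      finally have "fischer (f - r) w1 = 0" .
      moreover have "fischer (f - r) u = fischer (f - p) u - c * fischer w1 u"
        by (simp add: r_def fischer_diff_left fischer_add_left fischer_cst_left)
      ultimately show ?thesis using z by (simp add: wu fischer_add_right fischer_cst_right)
    qed
    ultimately show ?thesis by (intro bexI[of _ r]) auto
  qed
qed

section \<open>Polarization operators\<close>

definition pol :: "nat \<Rightarrow> nat \<Rightarrow> nat \<Rightarrow> (nat \<times> nat) cpoly \<Rightarrow> (nat \<times> nat) cpoly" where
  "pol L i j p = (\<Sum>b<L. var (i, b) * pderv (j, b) p)"

abbreviation grid :: "nat \<Rightarrow> nat \<Rightarrow> (nat \<times> nat) set" where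
  "grid M L \<equiv> {..<M} \<times> {..<L}"

lemma pol_add [simp]: "pol L i j (p + q) = pol L i j p + pol L i j q"
  by (simp add: pol_def algebra_simps sum.distrib)

lemma pol_cst [simp]: "pol L i j (cst c) = 0" and pol_zero [simp]: "pol L i j 0 = 0"
  and pol_one [simp]: "pol L i j 1 = 0"
  by (simp_all add: pol_def)

lemma pol_cst_mult [simp]: "pol L i j (cst c * p) = cst c * pol L i j p"
  by (simp add: pol_def sum_distrib_left mult.left_commute)

lemma pol_mult [simp]: "pol L i j (p * q) = pol L i j p * q + p * pol L i j q"
  by (simp add: pol_def algebra_simps sum.distrib sum_distrib_left sum_distrib_right)

lemma pol_sum [simp]: "pol L i j (sum f I) = (\<Sum>x\<in>I. pol L i j (f x))"
  by (induction I rule: infinite_finite_induct) auto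

lemma pol_uminus [simp]: "pol L i j (- p) = - pol L i j p"
  using pol_add[of L i j p "- p"] by (simp add: add_eq_0_iff)

lemma pol_diff [simp]: "pol L i j (p - q) = pol L i j p - pol L i j q"
  using pol_add[of L i j p "- q"] by simp

lemma pol_var: "pol L i j (var (k, b)) = (if k = j \<and> b < L then var (i, b) else 0)"
proof -
  have "pol L i j (var (k, b)) = (\<Sum>c<L. if c = b then (if k = j then var (i, b) else 0) else 0)"
    unfolding pol_def by (intro sum.cong) (auto simp: pderv_var)
  then show ?thesis by simp
qed

lemma pol_polys: "p \<in> polys (grid M L) \<Longrightarrow> i < M \<Longrightarrow> pol L i j p \<in> polys (grid M L)"
  by (auto simp: pol_def)

lemma fischer_pol: "fischer (pol L i j p) q = fischer p (pol L j i q)"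
proof -
  have "fischer r (sum f I) = (\<Sum>x\<in>I. fischer r (f x))" for r :: "(nat \<times> nat) cpoly" and f and I :: "nat set"
    by (induction I rule: infinite_finite_induct) (auto simp: fischer_add_right)
  then show ?thesis
    by (simp add: pol_def fischer_sum_left fischer_var_mult fischer_pderv)
qed

lemma pol_commutator:
  "pol L i j (pol L k l p) - pol L k l (pol L i j p)
    = (if j = k then pol L i l p else 0) - (if l = i then pol L k j p else 0)"
  using polys_UNIV[of p]
proof (induction rule: polys_induct)
  case (var x)
  obtain a b where "x = (a, b)" by (rule prod.exhaust)
  then show ?case by (auto simp: pol_var)
next
  case (add p q)
  have "pol L i j (pol L k l (p + q)) - pol L k l (pol L i j (p + q))
    = (pol L i j (pol L k l p) - pol L k l (pol L i j p))
    + (pol L i j (pol L k l q) - pol L k l (pol L i j q))"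
    by simp
  also have "\<dots> = (if j = k then pol L i l (p + q) else 0) - (if l = i then pol L k j (p + q) else 0)"
    unfolding add.IH by simp
  finally show ?case .
next
  case (mult p q)
  have "pol L i j (pol L k l (p * q)) - pol L k l (pol L i j (p * q))
    = (pol L i j (pol L k l p) - pol L k l (pol L i j p)) * q
    + p * (pol L i j (pol L k l q) - pol L k l (pol L i j q))"
    by (simp add: algebra_simps)
  also have "\<dots> = (if j = k then pol L i l (p * q) else 0) - (if l = i then pol L k j (p * q) else 0)"
    unfolding mult.IH by (simp add: algebra_simps)
  finally show ?case .
qed auto

definition row_degree :: "nat \<Rightarrow> (nat \<times> nat \<Rightarrow>\<^sub>0 nat) \<Rightarrow> nat \<Rightarrow> nat" where
  "row_degree L a i = (\<Sum>b<L. lookup a (i, b))"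

lemma row_degree_single_add:
  "b < L \<Longrightarrow> row_degree L (single (i, b) 1 + a) r = row_degree L a r + (if r = i then 1 else 0)"
  by (simp add: row_degree_def lookup_add lookup_single when_def sum.distrib)

lemma lookup_pol_diag: "lookup (pol L i i p) a = of_nat (row_degree L a i) * lookup p a"
proof -
  have "lookup (var k * pderv k p) a = of_nat (lookup a k) * lookup p a" for k
  proof (cases "lookup a k = 0")
    case True
    then show ?thesis by (simp add: lookup_var_mult)
  next
    case False
    then have "single k 1 + (a - single k 1) = a"
      by (auto simp: poly_mapping_eq_iff fun_eq_iff lookup_add lookup_minus lookup_single when_def)
    moreover have "of_nat (lookup a k - 1 + 1) = (of_nat (lookup a k) :: complex)" using False by simp
    ultimately show ?thesis using False
      by (simp only: lookup_var_mult lookup_pderv if_False lookup_minus lookup_single_eq)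
  qed
  then show ?thesis by (simp add: pol_def lookup_sum row_degree_def sum_distrib_right)
qed

lemma keys_pol:
  assumes "a \<in> keys (pol L i j p)"
  obtains b c where "b < L" "a = single (i, b) 1 + c"
    "single (j, b) 1 + c \<in> keys p"
proof -
  have "(\<Sum>b<L. lookup (var (i, b) * pderv (j, b) p) a) \<noteq> 0"
    using assms by (simp add: pol_def in_keys_iff lookup_sum)
  then obtain b where b: "b < L" "lookup (var (i, b) * pderv (j, b) p) a \<noteq> 0"
    by (metis (no_types, lifting) lessThan_iff sum.neutral)
  define c where "c = a - single (i, b) 1"
  have nz: "lookup a (i, b) \<noteq> 0" "lookup (pderv (j, b) p) c \<noteq> 0"
    using b(2) by (auto simp: lookup_var_mult c_def split: if_splits)
  then have "a = single (i, b) 1 + c"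
    by (auto simp: c_def poly_mapping_eq_iff fun_eq_iff lookup_add lookup_minus lookup_single when_def)
  moreover have "single (j, b) 1 + c \<in> keys p"
    using nz(2) by (auto simp: lookup_pderv in_keys_iff)
  ultimately show ?thesis using that b by blast
qed

definition weight_vector :: "nat \<Rightarrow> nat \<Rightarrow> (nat \<Rightarrow> nat) \<Rightarrow> (nat \<times> nat) cpoly \<Rightarrow> bool" where
  "weight_vector M L \<alpha> p \<longleftrightarrow> (\<forall>a\<in>keys p. \<forall>i<M. row_degree L a i = \<alpha> i)"

lemma weight_vector_iff_pol:
  "weight_vector M L \<alpha> p \<longleftrightarrow> (\<forall>i<M. pol L i i p = cst (of_nat (\<alpha> i)) * p)"
proof -
  have "pol L i i p = cst (of_nat (\<alpha> i)) * p \<longleftrightarrow> (\<forall>a\<in>keys p. row_degree L a i = \<alpha> i)" for i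
    by (auto simp: poly_mapping_eq_iff fun_eq_iff lookup_pol_diag in_keys_iff)
  then show ?thesis by (auto simp: weight_vector_def)
qed

lemma highest_weight_dominant:
  assumes "weight_vector M L \<alpha> g" "g \<noteq> 0" "i < M" "j < M" "i \<noteq> j" "pol L i j g = 0"
  shows "\<alpha> j \<le> \<alpha> i"
proof -
  have "pol L i j (pol L j i g) = cst (of_nat (\<alpha> i)) * g - cst (of_nat (\<alpha> j)) * g"
    using pol_commutator[of L i j j i g] assms by (simp add: weight_vector_iff_pol)
  then have "fischer (pol L j i g) (pol L j i g) = (of_nat (\<alpha> i) - of_nat (\<alpha> j)) * fischer g g"
    by (metis fischer_pol fischer_commute fischer_cst_left fischer_diff_left left_diff_distrib)
  then have "Re (fischer (pol L j i g) (pol L j i g)) = (real (\<alpha> i) - real (\<alpha> j)) * Re (fischer g g)"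
    by (simp add: fischer_self)
  then have "(real (\<alpha> i) - real (\<alpha> j)) * Re (fischer g g) \<ge> 0"
    using fischer_self_nonneg by metis
  with fischer_self_pos[OF assms(2)] show ?thesis by (simp add: zero_le_mult_iff)
qed

definition pol_stable :: "nat \<Rightarrow> nat \<Rightarrow> (nat \<times> nat) cpoly set \<Rightarrow> bool" where
  "pol_stable M L W \<longleftrightarrow> subspace_of W \<and> (\<forall>i<M. \<forall>j<M. \<forall>p\<in>W. pol L i j p \<in> W)"

lemma finite_bounded_exponents:
  assumes "finite S"
  shows "finite {a :: 'x \<Rightarrow>\<^sub>0 nat. keys a \<subseteq> S \<and> (\<forall>k\<in>S. lookup a k \<le> d)}" (is "finite ?A")
proof (rule finite_imageD)
  show "finite ((\<lambda>a. restrict (lookup a) S) ` ?A)"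
    by (rule finite_subset[OF _ finite_PiE[OF assms, of "\<lambda>_. {..d}"]]) (auto simp: PiE_def extensional_def)
  show "inj_on (\<lambda>a. restrict (lookup a) S) ?A"
  proof (rule inj_onI)
    fix a b assume ab: "a \<in> ?A" "b \<in> ?A" "restrict (lookup a) S = restrict (lookup b) S"
    have "lookup a k = lookup b k" for k
    proof (cases "k \<in> S")
      case True
      then show ?thesis using ab(3) by (metis restrict_apply')
    next
      case False
      then have "k \<notin> keys a" "k \<notin> keys b" using ab by auto
      then show ?thesis by (simp add: in_keys_iff)
    qed
    then show "a = b" by (rule poly_mapping_eqI)
  qed
qed

lemma highest_weight_exists:
  assumes Q: "pol_stable M L Q" and "p \<in> Q" "p \<noteq> 0"
    and bound: "\<And>g a i. g \<in> Q \<Longrightarrow> a \<in> keys g \<Longrightarrow> i < M \<Longrightarrow> row_degree L a i \<le> d"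
  obtains g \<alpha> where "g \<in> Q" "g \<noteq> 0" "weight_vector M L \<alpha> g"
    "\<And>i j. i < j \<Longrightarrow> j < M \<Longrightarrow> pol L i j g = 0"
proof -
  define pot where "pot a = (\<Sum>i<M. (M - i) * row_degree L a i)" for a
  define P where "P g \<longleftrightarrow> g \<in> Q \<and> g \<noteq> 0 \<and> (\<exists>\<alpha>. weight_vector M L \<alpha> g)" for g
  define R where "R n \<longleftrightarrow> (\<exists>g. P g \<and> (\<exists>a\<in>keys g. pot a = n))" for n
  obtain g where g: "g \<in> Q \<and> g \<noteq> 0"
    and min: "\<And>h. h \<in> Q \<and> h \<noteq> 0 \<Longrightarrow> card (keys g) \<le> card (keys h)"
    using ex_has_least_nat[of "\<lambda>h. h \<in> Q \<and> h \<noteq> 0" p "\<lambda>h. card (keys h)"] assms(2,3) by auto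
  have "row_degree L a i = row_degree L b i" if ab: "a \<in> keys g" "b \<in> keys g" "i < M" for a b i
  proof (rule ccontr)
    assume ne: "row_degree L a i \<noteq> row_degree L b i"
    define h where "h = pol L i i g - cst (of_nat (row_degree L b i)) * g"
    have "h \<in> Q" using Q g ab unfolding h_def pol_stable_def
      by (auto intro!: subspace_diff simp: subspace_of_def)
    moreover have lh: "lookup h c = (of_nat (row_degree L c i) - of_nat (row_degree L b i)) * lookup g c" for c
      by (simp add: h_def lookup_minus lookup_pol_diag left_diff_distrib)
    moreover have "lookup h a \<noteq> 0" using ne ab by (simp add: lh in_keys_iff)
    then have "h \<noteq> 0" by auto
    moreover have "keys h \<subset> keys g"
      using ab lh by (auto simp: in_keys_iff psubset_eq set_eq_iff)
    then have "card (keys h) < card (keys g)" by (simp add: psubset_card_mono)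
    moreover note min[of h]
    ultimately show False by auto
  qed
  moreover obtain a0 where a0: "a0 \<in> keys g" using g keys_eq_empty by fastforce
  ultimately have "weight_vector M L (row_degree L a0) g"
    unfolding weight_vector_def by blast
  then have "R (pot a0)" using g a0 by (auto simp: R_def P_def)
  moreover have "n \<le> (\<Sum>i<M. (M - i) * d)" if "R n" for n
    using that bound unfolding R_def P_def pot_def by (auto intro!: sum_mono)
  ultimately obtain n where n: "R n" and max: "\<And>n'. R n' \<Longrightarrow> n' \<le> n"
    using GreatestI_nat[of R "pot a0" "\<Sum>i<M. (M - i) * d"] Greatest_le_nat[of R _ "\<Sum>i<M. (M - i) * d"]
    by blast
  obtain f a where f: "P f" "a \<in> keys f" "pot a = n" using n by (auto simp: R_def)
  then obtain \<alpha> where \<alpha>: "weight_vector M L \<alpha> f" and fQ: "f \<in> Q" "f \<noteq> 0" by (auto simp: P_def)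
  have "pol L i j f = 0" if ij: "i < j" "j < M" for i j
  proof (rule ccontr)
    assume nz: "pol L i j f \<noteq> 0"
    have wt: "row_degree L c r = \<alpha> r + (if r = i then 1 else 0) - (if r = j then 1 else 0)
        \<and> (r = j \<longrightarrow> \<alpha> j > 0)" if "c \<in> keys (pol L i j f)" "r < M" for c r
    proof -
      from that(1) obtain b d where bd: "b < L" "c = single (i, b) 1 + d"
        "single (j, b) 1 + d \<in> keys f" by (rule keys_pol)
      have "row_degree L (single (j, b) 1 + d) r = \<alpha> r"
        using bd \<alpha> that by (auto simp: weight_vector_def)
      then show ?thesis using bd ij
        by (auto simp: row_degree_single_add simp del: One_nat_def split: if_splits)
    qed
    have "P (pol L i j f)" unfolding P_def
    proof (intro conjI exI)
      show "pol L i j f \<in> Q" using Q fQ ij by (auto simp: pol_stable_def)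
      show "weight_vector M L (\<lambda>r. \<alpha> r + (if r = i then 1 else 0) - (if r = j then 1 else 0)) (pol L i j f)"
        using wt by (auto simp: weight_vector_def)
    qed fact
    moreover obtain c where c: "c \<in> keys (pol L i j f)" using nz keys_eq_empty by fastforce
    ultimately have "R (pot c)" by (auto simp: R_def)
    then have "pot c \<le> n" by (rule max)
    moreover have "pot c > n"
    proof -
      from c obtain b d where bd: "b < L" "c = single (i, b) 1 + d"
        "single (j, b) 1 + d \<in> keys f" by (rule keys_pol)
      have pot: "pot (single (r, b) 1 + d) = pot d + (M - r)" if "r < M" for r
      proof -
        have "pot (single (r, b) 1 + d)
          = (\<Sum>i<M. (M - i) * row_degree L d i + (if i = r then M - r else 0))"
          unfolding pot_def using bd(1) by (intro sum.cong) (auto simp: row_degree_single_add distrib_left simp del: One_nat_def)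
        then show ?thesis using that by (simp add: sum.distrib pot_def)
      qed
      have "pot (single (j, b) 1 + d) = pot a"
        unfolding pot_def using bd f \<alpha> by (intro sum.cong) (auto simp: weight_vector_def)
      then show ?thesis using pot[of i] pot[of j] ij bd f by simp
    qed
    ultimately show False by simp
  qed
  with \<alpha> fQ show ?thesis using that by blast
qed

theorem highest_weight_criterion:
  assumes W: "pol_stable M L W" and U: "pol_stable M L U" and "U \<subseteq> W" "W \<subseteq> polys (grid M L)"
    and hw: "\<And>g \<alpha>. g \<in> W \<Longrightarrow> g \<noteq> 0 \<Longrightarrow> weight_vector M L \<alpha> g \<Longrightarrow>
      (\<And>i j. i < j \<Longrightarrow> j < M \<Longrightarrow> pol L i j g = 0) \<Longrightarrow> g \<in> U"
  shows "W \<subseteq> U"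
proof
  fix f assume f: "f \<in> W"
  define tot where "tot a = (\<Sum>k\<in>grid M L. lookup a k)" for a :: "nat \<times> nat \<Rightarrow>\<^sub>0 nat"
  define d where "d = Max (insert 0 (tot ` keys f))"
  define T where "T = {a. keys a \<subseteq> grid M L \<and> tot a \<le> d}"
  have le_tot: "lookup a k \<le> tot a" if "k \<in> grid M L" for a k
    unfolding tot_def using that by (intro member_le_sum) auto
  have "T \<subseteq> {a. keys a \<subseteq> grid M L \<and> (\<forall>k\<in>grid M L. lookup a k \<le> d)}"
    using le_tot order_trans unfolding T_def by blast
  then have "finite T" by (rule finite_subset) (rule finite_bounded_exponents, simp)
  have fT: "keys f \<subseteq> T" using f assms(4) by (fastforce simp: T_def d_def polys_def)
  have tot_add: "tot (single k 1 + a) = tot a + 1" if "k \<in> grid M L" for k a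
  proof -
    have "(\<Sum>l\<in>grid M L. lookup (single k 1) l) = (1::nat)"
      using that by (simp add: lookup_single when_def)
    then show ?thesis by (simp add: tot_def lookup_add sum.distrib)
  qed
  have polT: "keys (pol L i j p) \<subseteq> T" if p: "keys p \<subseteq> T" and ij: "i < M" "j < M" for p i j
  proof
    fix a assume "a \<in> keys (pol L i j p)"
    then obtain b c where bc: "b < L" "a = single (i, b) 1 + c"
        "single (j, b) 1 + c \<in> keys p" by (rule keys_pol)
    then have "single (j, b) 1 + c \<in> T" using p by blast
    then show "a \<in> T" using bc ij by (auto simp: T_def tot_add keys_add_nat simp del: One_nat_def)
  qed
  obtain p where p: "p \<in> U" "keys p \<subseteq> T" "\<And>w. w \<in> U \<Longrightarrow> keys w \<subseteq> T \<Longrightarrow> fischer (f - p) w = 0"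
    using fischer_projection[of U T f] U \<open>finite T\<close> by (auto simp: pol_stable_def)
  define Q where "Q = {g \<in> W. keys g \<subseteq> T \<and> (\<forall>w\<in>U. keys w \<subseteq> T \<longrightarrow> fischer g w = 0)}"
  have "pol_stable M L Q" unfolding pol_stable_def
  proof (intro conjI allI impI ballI)
    have "keys (p + q) \<subseteq> T" if "keys p \<subseteq> T" "keys q \<subseteq> T" for p q :: "(nat \<times> nat) cpoly"
      using that keys_add[of p q] by blast
    moreover have "keys (cst c * p) \<subseteq> T" if "keys p \<subseteq> T" for p :: "(nat \<times> nat) cpoly" and c
      using that keys_cst_mult[of c p] by blast
    ultimately show "subspace_of Q" using W
      by (auto simp: Q_def subspace_of_def pol_stable_def fischer_add_left fischer_cst_left)
  next
    fix i j g assume ij: "i < M" "j < M" and g: "g \<in> Q"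
    have "fischer (pol L i j g) w = 0" if "w \<in> U" "keys w \<subseteq> T" for w
    proof -
      have "pol L j i w \<in> U" "keys (pol L j i w) \<subseteq> T"
        using that ij U polT by (auto simp: pol_stable_def)
      then show ?thesis using g by (simp add: fischer_pol Q_def)
    qed
    then show "pol L i j g \<in> Q" using W g ij polT by (auto simp: Q_def pol_stable_def)
  qed
  have "f - p = 0"
  proof (rule ccontr)
    assume nz: "f - p \<noteq> 0"
    have "f - p \<in> Q"
      using f p fT assms(1,3) subspace_diff[of W f p] keys_diff[of f p]
      by (auto simp: Q_def pol_stable_def)
    moreover have "row_degree L a i \<le> d" if "g \<in> Q" "a \<in> keys g" "i < M" for g a i
    proof -
      have "row_degree L a i = (\<Sum>r\<in>{i}. \<Sum>b<L. lookup a (r, b))"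
        by (simp add: row_degree_def)
      also have "\<dots> = (\<Sum>k\<in>{i} \<times> {..<L}. lookup a k)"
        by (simp only: sum.cartesian_product split_def prod.collapse)
      also have "\<dots> \<le> tot a" unfolding tot_def using \<open>i < M\<close> by (intro sum_mono2) auto
      also have "\<dots> \<le> d" using that by (auto simp: Q_def T_def)
      finally show ?thesis .
    qed
    ultimately obtain g \<alpha> where g: "g \<in> Q" "g \<noteq> 0" "weight_vector M L \<alpha> g"
      "\<And>i j. i < j \<Longrightarrow> j < M \<Longrightarrow> pol L i j g = 0"
      using highest_weight_exists[OF \<open>pol_stable M L Q\<close> _ nz, of d] by blast
    then have "g \<in> U" by (intro hw) (auto simp: Q_def)
    then have "fischer g g = 0" using g by (simp add: Q_def)
    then show False using g fischer_self_eq_zero by blast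
  qed
  then show "f \<in> U" using p by simp
qed

section \<open>Gram matrices and their minors\<close>

definition gram :: "nat \<Rightarrow> (nat \<times> nat \<Rightarrow> complex) \<Rightarrow> nat \<Rightarrow> nat \<Rightarrow> complex" where
  "gram L v i j = (\<Sum>b<L. v (i, b) * v (j, b))"

definition gram_entry :: "nat \<Rightarrow> nat \<Rightarrow> nat \<Rightarrow> (nat \<times> nat) cpoly" where
  "gram_entry L i j = (\<Sum>b<L. var (i, b) * var (j, b))"

lemma gram_commute: "gram L v i j = gram L v j i"
  by (simp add: gram_def mult.commute)

lemma gram_entry_commute: "gram_entry L i j = gram_entry L j i"
  by (simp add: gram_entry_def mult.commute)

lemma eval_gram_entry [simp]: "eval v (gram_entry L i j) = gram L v i j"
  by (simp add: gram_entry_def gram_def)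

lemma gram_entry_polys: "i < M \<Longrightarrow> j < M \<Longrightarrow> gram_entry L i j \<in> polys (grid M L)"
  by (auto simp: gram_entry_def)

lemma pol_gram_entry:
  "pol L i j (gram_entry L x y)
    = (if x = j then gram_entry L i y else 0) + (if y = j then gram_entry L x i else 0)"
  by (auto simp: gram_entry_def pol_var algebra_simps sum.distrib)

definition index_minor :: "(nat \<Rightarrow> nat \<Rightarrow> 'a::comm_ring_1) \<Rightarrow> nat \<Rightarrow> (nat \<Rightarrow> nat) \<Rightarrow> (nat \<Rightarrow> nat) \<Rightarrow> 'a" where
  "index_minor A k r s = Determinant.det (Matrix.mat k k (\<lambda>(a, b). A (r a) (s b)))"

lemma index_minor_leibniz:
  "index_minor A k r s = (\<Sum>\<pi> | \<pi> permutes {0..<k}. signof \<pi> * (\<Prod>a = 0..<k. A (r a) (s (\<pi> a))))"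
proof -
  have "(\<Prod>a = 0..<k. Matrix.mat k k (\<lambda>(a, b). A (r a) (s b)) $$ (a, \<pi> a)) = (\<Prod>a = 0..<k. A (r a) (s (\<pi> a)))"
    if "\<pi> permutes {0..<k}" for \<pi>
    using permutes_in_image[OF that] by (intro prod.cong) auto
  then show ?thesis
    by (auto simp: index_minor_def Determinant.det_def intro!: sum.cong)
qed

lemma index_minor_cong:
  assumes "\<And>a b. a < k \<Longrightarrow> b < k \<Longrightarrow> A (r a) (s b) = B (r' a) (s' b)"
  shows "index_minor A k r s = index_minor B k r' s'"
  unfolding index_minor_def by (rule arg_cong[of _ _ Determinant.det]) (auto intro!: eq_matI assms)

lemma index_minor_hom:
  assumes "comm_ring_hom h"
  shows "h (index_minor A k r s) = index_minor (\<lambda>i j. h (A i j)) k r s"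
proof -
  interpret comm_ring_hom h by fact
  have "map_mat h (Matrix.mat k k (\<lambda>(a, b). A (r a) (s b))) = Matrix.mat k k (\<lambda>(a, b). h (A (r a) (s b)))"
    by (rule eq_matI) auto
  then show ?thesis unfolding index_minor_def by (simp only: hom_det[symmetric])
qed

lemma index_minor_identical_rows:
  assumes "a < k" "b < k" "a \<noteq> b" "r a = r b"
  shows "index_minor A k r s = 0"
  unfolding index_minor_def
  by (rule det_identical_rows[of _ k a b]) (use assms in \<open>auto intro!: eq_vecI\<close>)

lemma index_minor_transpose:
  "index_minor A k r s = index_minor (\<lambda>i j. A j i) k s r"
proof -
  have "transpose_mat (Matrix.mat k k (\<lambda>(a, b). A (r a) (s b))) = Matrix.mat k k (\<lambda>(a, b). A (r b) (s a))"
    by (rule eq_matI) auto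
  moreover have "Determinant.det (transpose_mat (Matrix.mat k k (\<lambda>(a, b). A (r a) (s b))))
      = Determinant.det (Matrix.mat k k (\<lambda>(a, b). A (r a) (s b)))"
    by (rule det_transpose) (rule mat_carrier)
  ultimately show ?thesis unfolding index_minor_def by simp
qed

lemma index_minor_identical_cols:
  assumes "a < k" "b < k" "a \<noteq> b" "s a = s b"
  shows "index_minor A k r s = 0"
  by (subst index_minor_transpose) (rule index_minor_identical_rows[OF assms])

lemma index_minor_in_polys:
  assumes "\<And>a b. a < k \<Longrightarrow> b < k \<Longrightarrow> A (r a) (s b) \<in> polys S"
  shows "index_minor A k r s \<in> polys S"
  unfolding index_minor_leibniz
proof (intro polys_sum polys_mult)
  fix \<pi> assume "\<pi> \<in> {\<pi>. \<pi> permutes {0..<k}}"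
  then have "\<pi> a < k" if "a < k" for a using permutes_in_image[of \<pi> "{0..<k}" a] that by auto
  then show "(\<Prod>a = 0..<k. A (r a) (s (\<pi> a))) \<in> polys S" by (intro polys_prod assms) auto
qed (auto simp: sign_def)

lemma index_minor_Suc_laplace:
  "index_minor A (Suc k) r s
    = (\<Sum>b<Suc k. A (r 0) (s b) * ((-1) ^ b * index_minor A k (\<lambda>a. r (Suc a)) (\<lambda>c. s (if c < b then c else Suc c))))"
proof -
  let ?A = "Matrix.mat (Suc k) (Suc k) (\<lambda>(a, b). A (r a) (s b))"
  have "index_minor A (Suc k) r s = (\<Sum>b<Suc k. ?A $$ (0, b) * cofactor ?A 0 b)"
    unfolding index_minor_def by (rule laplace_expansion_row) auto
  also have "\<dots> = (\<Sum>b<Suc k. A (r 0) (s b) * ((-1) ^ b * index_minor A k (\<lambda>a. r (Suc a)) (\<lambda>c. s (if c < b then c else Suc c))))"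
  proof (intro sum.cong refl)
    fix b assume b: "b \<in> {..<Suc k}"
    have "mat_delete ?A 0 b = Matrix.mat k k (\<lambda>(a, c). A (r (Suc a)) (s (if c < b then c else Suc c)))"
      by (rule eq_matI) (auto simp: mat_delete_def)
    with b show "?A $$ (0, b) * cofactor ?A 0 b = A (r 0) (s b) *
        ((-1) ^ b * index_minor A k (\<lambda>a. r (Suc a)) (\<lambda>c. s (if c < b then c else Suc c)))"
      by (simp add: cofactor_def index_minor_def)
  qed
  finally show ?thesis .
qed

abbreviation gram_minor :: "nat \<Rightarrow> nat \<Rightarrow> (nat \<Rightarrow> nat) \<Rightarrow> (nat \<Rightarrow> nat) \<Rightarrow> (nat \<times> nat) cpoly" where
  "gram_minor L \<equiv> index_minor (gram_entry L)"

lemma eval_gram_minor: "eval v (gram_minor L k r s) = index_minor (gram L v) k r s"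
  by (subst index_minor_hom[OF eval_hom]) simp

lemma pol_prod:
  assumes "finite I"
  shows "pol L i j (prod f I) = (\<Sum>a\<in>I. pol L i j (f a) * prod f (I - {a}))"
  using assms
proof (induction I)
  case (insert x I)
  have "prod f (insert x I - {a}) = f x * prod f (I - {a})" if "a \<in> I" for a
    using insert that by (subst insert_Diff_if) auto
  then show ?case using insert by (simp add: sum_distrib_left algebra_simps)
qed simp

lemma pol_gram_minor:
  "pol L i j (gram_minor L k r s)
    = (\<Sum>a<k. if r a = j then gram_minor L k (r(a := i)) s else 0)
    + (\<Sum>b<k. if s b = j then gram_minor L k r (s(b := i)) else 0)"
proof -
  let ?P = "{\<pi>. \<pi> permutes {0..<k}}"
  let ?t = "\<lambda>r s \<pi>. (\<Prod>a = 0..<k. gram_entry L (r a) (s (\<pi> a)))"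
  have *: "pol L i j (?t r s \<pi>) = (\<Sum>a<k. if r a = j then ?t (r(a := i)) s \<pi> else 0)
      + (\<Sum>b<k. if s b = j then ?t r (s(b := i)) \<pi> else 0)" if \<pi>: "\<pi> permutes {0..<k}" for \<pi>
  proof -
    have inj: "\<pi> a = \<pi> c \<longleftrightarrow> a = c" for a c using permutes_inj[OF \<pi>] by (auto dest: injD)
    have 1: "(if r a = j then gram_entry L i (s (\<pi> a)) else 0) * (\<Prod>c\<in>{0..<k} - {a}. gram_entry L (r c) (s (\<pi> c)))
        = (if r a = j then ?t (r(a := i)) s \<pi> else 0)" if "a < k" for a
      using that by (subst (2) prod.remove[of _ a]) (auto intro!: arg_cong2[of _ _ _ _ "(*)"] prod.cong)
    have 2: "(if s (\<pi> a) = j then gram_entry L (r a) i else 0) * (\<Prod>c\<in>{0..<k} - {a}. gram_entry L (r c) (s (\<pi> c)))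
        = (if s (\<pi> a) = j then ?t r (s(\<pi> a := i)) \<pi> else 0)" if "a < k" for a
      using that by (subst (2) prod.remove[of _ a]) (auto simp: inj intro!: arg_cong2[of _ _ _ _ "(*)"] prod.cong)
    have "pol L i j (?t r s \<pi>) = (\<Sum>a<k. if r a = j then ?t (r(a := i)) s \<pi> else 0)
        + (\<Sum>a<k. if s (\<pi> a) = j then ?t r (s(\<pi> a := i)) \<pi> else 0)"
      by (simp add: pol_prod pol_gram_entry distrib_right sum.distrib 1 2 lessThan_atLeast0 cong: sum.cong_simp)
    also have "(\<Sum>a<k. if s (\<pi> a) = j then ?t r (s(\<pi> a := i)) \<pi> else 0)
        = (\<Sum>b<k. if s b = j then ?t r (s(b := i)) \<pi> else 0)"
      using permutes_imp_bij[OF \<pi>]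
      by (intro sum.reindex_bij_betw[of \<pi> "{..<k}" "{..<k}" "\<lambda>b. if s b = j then ?t r (s(b := i)) \<pi> else 0"])
        (simp add: lessThan_atLeast0)
    finally show ?thesis .
  qed
  have sgn: "pol L i j (signof \<pi> * p) = signof \<pi> * pol L i j p" for \<pi> p
    by (simp add: sign_def)
  have if_sum: "(\<Sum>\<pi>\<in>?P. signof \<pi> * (if b then f \<pi> else 0)) = (if b then (\<Sum>\<pi>\<in>?P. signof \<pi> * f \<pi>) else 0)"
    for b and f :: "(nat \<Rightarrow> nat) \<Rightarrow> (nat \<times> nat) cpoly"
    by simp
  have "pol L i j (gram_minor L k r s) = (\<Sum>\<pi>\<in>?P. signof \<pi> * pol L i j (?t r s \<pi>))"
    by (simp only: index_minor_leibniz pol_sum sgn)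
  also have "\<dots> = (\<Sum>\<pi>\<in>?P. (\<Sum>a<k. signof \<pi> * (if r a = j then ?t (r(a := i)) s \<pi> else 0))
      + (\<Sum>b<k. signof \<pi> * (if s b = j then ?t r (s(b := i)) \<pi> else 0)))"
    by (intro sum.cong refl) (simp only: mem_Collect_eq * distrib_left sum_distrib_left)
  also have "\<dots> = (\<Sum>a<k. \<Sum>\<pi>\<in>?P. signof \<pi> * (if r a = j then ?t (r(a := i)) s \<pi> else 0))
      + (\<Sum>b<k. \<Sum>\<pi>\<in>?P. signof \<pi> * (if s b = j then ?t r (s(b := i)) \<pi> else 0))"
    unfolding sum.distrib by (subst (1 2) sum.swap) (rule refl)
  also have "\<dots> = (\<Sum>a<k. if r a = j then gram_minor L k (r(a := i)) s else 0)
      + (\<Sum>b<k. if s b = j then gram_minor L k r (s(b := i)) else 0)"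
    unfolding if_sum index_minor_leibniz ..
  finally show ?thesis .
qed

abbreviation leading_minor :: "nat \<Rightarrow> nat \<Rightarrow> (nat \<times> nat) cpoly" where
  "leading_minor L k \<equiv> gram_minor L k (\<lambda>i. i) (\<lambda>i. i)"

lemma pol_leading_minor_raise:
  assumes "i < j"
  shows "pol L i j (leading_minor L k) = 0"
proof -
  have "gram_minor L k ((\<lambda>i. i)(a := i)) (\<lambda>i. i) = 0" if "a < k" "a = j" for a
    by (rule index_minor_identical_rows[of a k i]) (use that assms in auto)
  moreover have "gram_minor L k (\<lambda>i. i) ((\<lambda>i. i)(a := i)) = 0" if "a < k" "a = j" for a
    by (rule index_minor_identical_cols[of a k i]) (use that assms in auto)
  ultimately show ?thesis by (simp add: pol_gram_minor)
qed

lemma pol_leading_minor_diag: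
  "pol L i i (leading_minor L k) = cst (of_nat (if i < k then 2 else 0)) * leading_minor L k"
proof -
  have "(\<lambda>i. i)(a := a) = (\<lambda>i::nat. i)" for a by auto
  then have "pol L i i (leading_minor L k)
     = (\<Sum>a<k. if a = i then leading_minor L k else 0) + (\<Sum>a<k. if a = i then leading_minor L k else 0)"
    unfolding pol_gram_minor by (intro arg_cong2[of _ _ _ _ "(+)"] sum.cong) auto
  then show ?thesis by simp
qed

lemma leading_minor_polys: "k \<le> M \<Longrightarrow> leading_minor L k \<in> polys (grid M L)"
  by (intro index_minor_in_polys gram_entry_polys) auto

lemma leading_minor_weight: "weight_vector M L (\<lambda>i. if i < k then 2 else 0) (leading_minor L k)"
  by (simp add: weight_vector_iff_pol pol_leading_minor_diag)

lemma index_minor_diagonal: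
  assumes "\<And>a b. a < k \<Longrightarrow> b < k \<Longrightarrow> a \<noteq> b \<Longrightarrow> A a b = 0"
  shows "index_minor A k (\<lambda>i. i) (\<lambda>i. i) = (\<Prod>i<k. A i i)"
proof -
  have "index_minor A k (\<lambda>i. i) (\<lambda>i. i) = prod_list (diag_mat (Matrix.mat k k (\<lambda>(a, b). A a b)))"
    unfolding index_minor_def by (rule det_lower_triangular[of k]) (auto simp: assms)
  also have "diag_mat (Matrix.mat k k (\<lambda>(a, b). A a b)) = map (\<lambda>i. A i i) [0..<k]"
    by (auto simp: diag_mat_def)
  also have "prod_list \<dots> = (\<Prod>i<k. A i i)"
    by (simp add: prod.distinct_set_conv_list[symmetric] lessThan_atLeast0)
  finally show ?thesis .
qed

section \<open>The actions of the groups\<close>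

definition add_row :: "nat \<Rightarrow> (nat \<Rightarrow> complex) \<Rightarrow> (nat \<times> nat \<Rightarrow> complex) \<Rightarrow> nat \<times> nat \<Rightarrow> complex" where
  "add_row i c v = (\<lambda>(j, b). v (j, b) + (if i < j then c j * v (i, b) else 0))"

lemma eval_add_row:
  assumes f: "f \<in> polys (grid M L)" and raise: "\<And>j. i < j \<Longrightarrow> j < M \<Longrightarrow> pol L i j f = 0"
  shows "eval (add_row i c v) f = eval v f"
proof -
  define x where "x t = add_row i (\<lambda>j. t * c j) v" for t
  have "((\<lambda>t. eval (x t) f) has_field_derivative 0) (at t within UNIV)" for t
  proof -
    have "((\<lambda>t. eval (x t) f) has_field_derivative
        (\<Sum>k\<in>grid M L. eval (x t) (pderv k f) * (if i < fst k then c (fst k) * v (i, snd k) else 0))) (at t)"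
      by (rule has_field_derivative_eval[OF f])
        (auto simp: x_def add_row_def intro!: derivative_eq_intros)
    also have "(\<Sum>k\<in>grid M L. eval (x t) (pderv k f) * (if i < fst k then c (fst k) * v (i, snd k) else 0))
       = (\<Sum>j<M. \<Sum>b<L. eval (x t) (pderv (j, b) f) * (if i < j then c j * v (i, b) else 0))"
      by (simp add: sum.cartesian_product split_def)
    also have "\<dots> = (\<Sum>j<M. if i < j then c j * eval (x t) (pol L i j f) else 0)"
    proof (intro sum.cong refl)
      fix j
      have "x t (i, b) = v (i, b)" for b by (simp add: x_def add_row_def)
      then show "(\<Sum>b<L. eval (x t) (pderv (j, b) f) * (if i < j then c j * v (i, b) else 0))
          = (if i < j then c j * eval (x t) (pol L i j f) else 0)"
        by (simp add: pol_def sum_distrib_left mult_ac)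
    qed
    also have "\<dots> = 0" using raise by (intro sum.neutral) auto
    finally show ?thesis by simp
  qed
  then obtain d where "\<And>t. eval (x t) f = d"
    using has_field_derivative_zero_constant[of UNIV "\<lambda>t. eval (x t) f"] by auto
  then have "eval (x 1) f = eval (x 0) f" by simp
  moreover have "x 1 = add_row i c v" "x 0 = v" by (auto simp: x_def add_row_def)
  ultimately show ?thesis by simp
qed

lemma eval_scale_rows:
  assumes f: "f \<in> polys (grid M L)" "weight_vector M L \<alpha> f"
  shows "eval (\<lambda>(i, b). c i * v (i, b)) f = (\<Prod>i<M. c i ^ \<alpha> i) * eval v f"
proof -
  have "(\<Prod>k\<in>keys a. (case k of (i, b) \<Rightarrow> c i * v (i, b)) ^ lookup a k)
      = (\<Prod>i<M. c i ^ \<alpha> i) * (\<Prod>k\<in>keys a. v k ^ lookup a k)" if a: "a \<in> keys f" for a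
  proof -
    have sub: "keys a \<subseteq> grid M L" using f a by (auto simp: polys_def)
    have "(\<Prod>k\<in>keys a. (case k of (i, b) \<Rightarrow> c i * v (i, b)) ^ lookup a k)
        = (\<Prod>k\<in>grid M L. (case k of (i, b) \<Rightarrow> c i * v (i, b)) ^ lookup a k)"
      by (rule prod_keys_superset) (use sub in auto)
    also have "\<dots> = (\<Prod>k\<in>grid M L. c (fst k) ^ lookup a k) * (\<Prod>k\<in>grid M L. v k ^ lookup a k)"
      by (simp add: prod.distrib[symmetric] split_def power_mult_distrib)
    also have "(\<Prod>k\<in>grid M L. c (fst k) ^ lookup a k) = (\<Prod>i<M. \<Prod>b<L. c i ^ lookup a (i, b))"
      by (simp add: prod.cartesian_product split_def)
    also have "\<dots> = (\<Prod>i<M. c i ^ \<alpha> i)"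
      using f(2) a by (intro prod.cong refl) (auto simp: weight_vector_def row_degree_def power_sum[symmetric])
    also have "(\<Prod>k\<in>grid M L. v k ^ lookup a k) = (\<Prod>k\<in>keys a. v k ^ lookup a k)"
      by (rule prod_keys_superset[symmetric]) (use sub in auto)
    finally show ?thesis .
  qed
  then show ?thesis by (simp add: psubst_def sum_distrib_left mult.left_commute cong: sum.cong)
qed

definition orthogonal_matrix :: "nat \<Rightarrow> (nat \<Rightarrow> nat \<Rightarrow> complex) \<Rightarrow> bool" where
  "orthogonal_matrix L g \<longleftrightarrow> (\<forall>a<L. \<forall>b<L. (\<Sum>c<L. g a c * g b c) = (if a = b then 1 else 0))"

definition act :: "nat \<Rightarrow> (nat \<Rightarrow> nat \<Rightarrow> complex) \<Rightarrow> (nat \<times> nat \<Rightarrow> complex) \<Rightarrow> nat \<times> nat \<Rightarrow> complex" where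
  "act L g v = (\<lambda>(i, b). \<Sum>c<L. g b c * v (i, c))"

definition orthogonally_invariant :: "nat \<Rightarrow> (nat \<times> nat) cpoly \<Rightarrow> bool" where
  "orthogonally_invariant L f \<longleftrightarrow> (\<forall>g v. orthogonal_matrix L g \<longrightarrow> eval (act L g v) f = eval v f)"

lemma orthogonal_matrix_transpose:
  assumes "orthogonal_matrix L g" "a < L" "b < L"
  shows "(\<Sum>c<L. g c a * g c b) = (if a = b then 1 else 0)"
proof -
  let ?G = "Matrix.mat L L (\<lambda>(a, b). g a b)"
  have "?G * transpose_mat ?G = 1\<^sub>m L"
    using assms(1) by (intro eq_matI) (auto simp: orthogonal_matrix_def scalar_prod_def lessThan_atLeast0)
  then have "transpose_mat ?G * ?G = 1\<^sub>m L"
    by (rule mat_mult_left_right_inverse[rotated 2]) auto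
  then have "(transpose_mat ?G * ?G) $$ (a, b) = 1\<^sub>m L $$ (a, b)" by simp
  then show ?thesis using assms(2,3) by (simp add: scalar_prod_def lessThan_atLeast0)
qed

lemma gram_act: "orthogonal_matrix L g \<Longrightarrow> gram L (act L g v) i j = gram L v i j"
proof -
  assume g: "orthogonal_matrix L g"
  have "gram L (act L g v) i j = (\<Sum>b<L. \<Sum>c<L. \<Sum>d<L. v (i, c) * v (j, d) * (g b c * g b d))"
    by (simp add: gram_def act_def sum_product mult_ac)
  also have "\<dots> = (\<Sum>c<L. \<Sum>d<L. v (i, c) * v (j, d) * (\<Sum>b<L. g b c * g b d))"
  proof -
    have "(\<Sum>b<L. \<Sum>d<L. v (i, c) * v (j, d) * (g b c * g b d))
      = (\<Sum>d<L. v (i, c) * v (j, d) * (\<Sum>b<L. g b c * g b d))" for c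
      by (subst sum.swap) (simp add: sum_distrib_left)
    then show ?thesis by (subst sum.swap) simp
  qed
  also have "\<dots> = (\<Sum>c<L. \<Sum>d<L. if c = d then v (i, c) * v (j, d) else 0)"
    by (intro sum.cong refl) (simp add: orthogonal_matrix_transpose[OF g])
  also have "\<dots> = gram L v i j" by (simp add: gram_def)
  finally show ?thesis .
qed

lemma eval_curve:
  assumes f: "f \<in> polys (grid M L)" and "j < M"
  shows "((\<lambda>t. eval (\<lambda>(r, b). v (r, b) + (if r = j then t * v (i, b) else 0)) f)
    has_field_derivative eval v (pol L i j f)) (at 0)"
proof -
  let ?x = "\<lambda>t (r, b). v (r, b) + (if r = j then t * v (i, b) else 0)"
  have "((\<lambda>t. eval (?x t) f) has_field_derivative
     (\<Sum>k\<in>grid M L. eval (?x 0) (pderv k f) * (if fst k = j then v (i, snd k) else 0))) (at 0)"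
    by (rule has_field_derivative_eval[OF f]) (auto intro!: derivative_eq_intros)
  also have "?x 0 = v" by auto
  also have "(\<Sum>k\<in>grid M L. eval v (pderv k f) * (if fst k = j then v (i, snd k) else 0))
     = (\<Sum>r<M. \<Sum>b<L. eval v (pderv (r, b) f) * (if r = j then v (i, b) else 0))"
    by (simp add: sum.cartesian_product split_def)
  also have "\<dots> = (\<Sum>r<M. if r = j then eval v (pol L i j f) else 0)"
    by (intro sum.cong refl) (auto simp: pol_def mult.commute)
  also have "\<dots> = eval v (pol L i j f)" using \<open>j < M\<close> by simp
  finally show ?thesis .
qed

lemma orthogonally_invariant_pol:
  assumes f: "f \<in> polys (grid M L)" "j < M" and inv: "orthogonally_invariant L f"
  shows "orthogonally_invariant L (pol L i j f)"
  unfolding orthogonally_invariant_def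
proof (intro allI impI)
  fix g v assume g: "orthogonal_matrix L g"
  let ?x = "\<lambda>v t (r, b). v (r, b) + (if r = j then t * v (i, b) else 0)"
  have "?x (act L g v) t = act L g (?x v t)" for t
    by (auto simp: act_def algebra_simps sum.distrib sum_distrib_left)
  then have "eval (?x (act L g v) t) f = eval (?x v t) f" for t
    using inv g by (simp only: orthogonally_invariant_def)
  then have "((\<lambda>t. eval (?x v t) f) has_field_derivative eval (act L g v) (pol L i j f)) (at 0)"
    using eval_curve[OF f, of "act L g v" i] by simp
  then show "eval (act L g v) (pol L i j f) = eval v (pol L i j f)"
    using eval_curve[OF f] DERIV_unique by blast
qed

section \<open>Highest weight vectors among the orthogonal invariants\<close>

lemma poly_eval_line:
  "poly (psubst (\<lambda>c. [:c:]) (\<lambda>k. [:x k, y k:]) p) t = eval (\<lambda>k. x k + t * y k) p"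
  using polys_UNIV[of p]
  by (induction rule: polys_induct)
    (simp_all add: psubst_add[of "\<lambda>c. [:c:]"] psubst_mult[of "\<lambda>c. [:c:]"]
      psubst_cst[of "\<lambda>c. [:c:]"] psubst_var[of "\<lambda>c. [:c:]"])

lemma eval_nonzero_common:
  assumes "p \<noteq> 0" "q \<noteq> 0"
  obtains v where "eval v p \<noteq> 0" "eval v q \<noteq> 0"
proof -
  obtain x y where xy: "eval x p \<noteq> 0" "eval y q \<noteq> 0" using assms eval_eq_zero_imp_zero by metis
  define P where "P p = psubst (\<lambda>c. [:c:]) (\<lambda>k. [:x k, y k - x k:]) p" for p
  have P: "poly (P p) t = eval (\<lambda>k. x k + t * (y k - x k)) p" for p t
    by (simp only: P_def poly_eval_line)
  have "poly (P p) 0 \<noteq> 0" "poly (P q) 1 \<noteq> 0" using xy by (simp_all add: P)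
  then have "P p \<noteq> 0" "P q \<noteq> 0" by auto
  then have "P p * P q \<noteq> 0" by simp
  then obtain t where "poly (P p * P q) t \<noteq> 0" using poly_all_0_iff_0 by blast
  then show ?thesis using that by (auto simp: P)
qed

definition highest_weight :: "nat \<Rightarrow> nat \<Rightarrow> (nat \<Rightarrow> nat) \<Rightarrow> (nat \<times> nat) cpoly \<Rightarrow> bool" where
  "highest_weight M L \<alpha> f \<longleftrightarrow> f \<in> polys (grid M L) \<and> weight_vector M L \<alpha> f \<and>
    (\<forall>i j. i < j \<longrightarrow> j < M \<longrightarrow> pol L i j f = 0)"

definition unit_rows :: "nat \<Rightarrow> nat \<times> nat \<Rightarrow> complex" where
  "unit_rows k = (\<lambda>(i, b). if i = b \<and> i < k then 1 else 0)"

lemma gram_unit_rows: "i < k \<Longrightarrow> i < L \<Longrightarrow> gram L (unit_rows k) i j = (if i = j then 1 else 0)"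
  by (cases "i = j") (auto simp: gram_def unit_rows_def if_distrib cong: if_cong intro!: sum.neutral)

lemma eval_leading_minor_unit_rows:
  "k \<le> r \<Longrightarrow> k \<le> L \<Longrightarrow> eval (unit_rows r) (leading_minor L k) = 1"
  unfolding eval_gram_minor by (subst index_minor_diagonal) (auto simp: gram_unit_rows)

lemma highest_weight_leading_minor:
  "k \<le> M \<Longrightarrow> highest_weight M L (\<lambda>i. if i < k then 2 else 0) (leading_minor L k)"
  by (simp add: highest_weight_def leading_minor_polys leading_minor_weight pol_leading_minor_raise)

lemma orthogonally_invariant_gram_minor: "orthogonally_invariant L (gram_minor L k r s)"
  by (auto simp: orthogonally_invariant_def eval_gram_minor gram_act intro!: index_minor_cong)

lemma gram_add_row:
  "i \<le> r \<Longrightarrow> gram L (add_row r c w) i j = gram L w i j + (if r < j then c j * gram L w i r else 0)"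
  by (simp add: gram_def add_row_def sum_distrib_left sum.distrib algebra_simps)

lemma gram_schmidt:
  assumes "L \<le> M" "r \<le> L" and minors: "\<And>k. k \<le> L \<Longrightarrow> eval v (leading_minor L k) \<noteq> 0"
  shows "\<exists>w. (\<forall>f \<alpha>. highest_weight M L \<alpha> f \<longrightarrow> eval w f = eval v f) \<and>
    (\<forall>i<r. \<forall>j<M. i \<noteq> j \<longrightarrow> gram L w i j = 0) \<and> (\<forall>i<r. gram L w i i \<noteq> 0)"
  using \<open>r \<le> L\<close>
proof (induction r)
  case 0
  then show ?case by auto
next
  case (Suc r)
  then have "r \<le> L" by simp
  from Suc.IH[OF this] obtain w where inv: "\<And>f \<alpha>. highest_weight M L \<alpha> f \<Longrightarrow> eval w f = eval v f"
    and orth: "\<And>i j. i < r \<Longrightarrow> j < M \<Longrightarrow> i \<noteq> j \<Longrightarrow> gram L w i j = 0"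
    and nz: "\<And>i. i < r \<Longrightarrow> gram L w i i \<noteq> 0" by blast
  have "eval w (leading_minor L (Suc r)) = (\<Prod>i<Suc r. gram L w i i)"
    unfolding eval_gram_minor
  proof (rule index_minor_diagonal)
    fix a b assume "a < Suc r" "b < Suc r" "a \<noteq> b"
    then show "gram L w a b = 0"
      using orth[of a b] orth[of b a] Suc.prems \<open>L \<le> M\<close> gram_commute[of L w a b]
      by (cases "a < r") auto
  qed
  moreover have "eval w (leading_minor L (Suc r)) \<noteq> 0"
    using minors[of "Suc r"] inv[OF highest_weight_leading_minor[of "Suc r" M L]] Suc.prems \<open>L \<le> M\<close> by simp
  ultimately have r: "gram L w r r \<noteq> 0" by simp
  define c where "c j = - gram L w r j / gram L w r r" for j
  let ?w = "add_row r c w"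
  have "eval ?w f = eval v f" if "highest_weight M L \<alpha> f" for f \<alpha>
    using eval_add_row[of f M L r c w] that inv[OF that] by (auto simp: highest_weight_def)
  moreover have "gram L ?w i j = 0" if "i < Suc r" "j < M" "i \<noteq> j" for i j
  proof (cases "i = r")
    case True
    then show ?thesis using that orth[of j r] r Suc.prems \<open>L \<le> M\<close> gram_commute[of L w r j]
      by (auto simp: gram_add_row c_def)
  next
    case False
    then show ?thesis using that orth[of i j] orth[of i r] Suc.prems \<open>L \<le> M\<close> by (auto simp: gram_add_row)
  qed
  moreover have "gram L ?w i i \<noteq> 0" if "i < Suc r" for i
    using that r nz[of i] by (cases "i = r") (auto simp: gram_add_row)
  ultimately show ?case by blast
qed

lemma generic_point:
  assumes "L \<le> M" and minors: "\<And>k. k \<le> L \<Longrightarrow> eval v (leading_minor L k) \<noteq> 0"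
  obtains c where "\<And>i. i \<ge> L \<Longrightarrow> c i = 0"
    "\<And>f \<alpha>. highest_weight M L \<alpha> f \<Longrightarrow> orthogonally_invariant L f \<Longrightarrow>
      eval v f = (\<Prod>i<M. c i ^ \<alpha> i) * eval (unit_rows L) f"
proof -
  obtain w where inv: "\<And>f \<alpha>. highest_weight M L \<alpha> f \<Longrightarrow> eval w f = eval v f"
    and orth: "\<And>i j. i < L \<Longrightarrow> j < M \<Longrightarrow> i \<noteq> j \<Longrightarrow> gram L w i j = 0"
    and nz: "\<And>i. i < L \<Longrightarrow> gram L w i i \<noteq> 0"
    using gram_schmidt[OF assms(1) order.refl minors] by blast
  define s where "s i = csqrt (gram L w i i)" for i
  have s: "s i * s i = gram L w i i" for i
    by (simp add: s_def power2_eq_square[symmetric])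
  then have s0: "s i \<noteq> 0" if "i < L" for i using nz[OF that] by (metis mult_zero_left)
  define g where "g b c = w (b, c) / s b" for b c
  define c where "c i = (if i < L then s i else 0)" for i
  have g: "orthogonal_matrix L g"
    unfolding orthogonal_matrix_def
  proof (intro allI impI)
    fix a b assume ab: "a < L" "b < L"
    have "(\<Sum>c<L. g a c * g b c) = gram L w a b / (s a * s b)"
      by (simp add: g_def gram_def sum_divide_distrib)
    then show "(\<Sum>c<L. g a c * g b c) = (if a = b then 1 else 0)"
      using ab orth[of a b] assms(1) s[of a] s0[of a] nz[of a] by auto
  qed
  have pt: "act L g w (i, b) = c i * unit_rows L (i, b)" if "i < M" "b < L" for i b
  proof -
    have "act L g w (i, b) = gram L w b i / s b"
      by (simp add: act_def g_def gram_def sum_divide_distrib)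
    moreover have "gram L w b b / s b = s b"
      using s[of b] s0[OF that(2)] by (metis nonzero_mult_div_cancel_left)
    ultimately show ?thesis
      using that orth[of b i] by (auto simp: c_def unit_rows_def)
  qed
  show ?thesis
  proof (rule that)
    show "c i = 0" if "i \<ge> L" for i using that by (simp add: c_def)
    fix f \<alpha> assume f: "highest_weight M L \<alpha> f" "orthogonally_invariant L f"
    then have fp: "f \<in> polys (grid M L)" "weight_vector M L \<alpha> f" by (auto simp: highest_weight_def)
    have "eval v f = eval (act L g w) f" using inv f g by (simp add: orthogonally_invariant_def)
    also have "\<dots> = eval (\<lambda>(i, b). c i * unit_rows L (i, b)) f"
      by (rule eval_cong[OF fp(1)]) (auto simp: pt)
    also have "\<dots> = (\<Prod>i<M. c i ^ \<alpha> i) * eval (unit_rows L) f" by (rule eval_scale_rows[OF fp])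
    finally show "eval v f = (\<Prod>i<M. c i ^ \<alpha> i) * eval (unit_rows L) f" .
  qed
qed

lemma telescope_antimono:
  fixes A :: "nat \<Rightarrow> nat"
  assumes "\<And>k. A (Suc k) \<le> A k" "i \<le> n"
  shows "(\<Sum>k\<in>{i<..n}. A (k - 1) - A k) = A i - A n"
  using assms(2)
proof (induction n rule: dec_induct)
  case (step n)
  have "A n \<le> A i" using lift_Suc_antimono_le[of A i n] assms step by auto
  moreover have "{i<..Suc n} = insert (Suc n) {i<..n}" using step by auto
  ultimately show ?case using step assms(1)[of n] by simp
qed auto

theorem highest_weight_invariant_form:
  assumes LM: "L \<le> M" and f: "highest_weight M L \<alpha> f" "orthogonally_invariant L f" "f \<noteq> 0"
  obtains c e where "c \<noteq> 0" "f = cst c * (\<Prod>k\<in>{1..L}. leading_minor L k ^ e k)"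
proof -
  define H where "H = (\<Prod>k\<le>L. leading_minor L k)"
  have "eval (unit_rows L) H = 1"
    by (simp add: H_def eval_leading_minor_unit_rows)
  then have "H \<noteq> 0" by auto
  have generic: "\<exists>v c. eval v h \<noteq> 0 \<and> (\<forall>i\<ge>L. c i = 0) \<and> (\<forall>f \<alpha>. highest_weight M L \<alpha> f \<longrightarrow> orthogonally_invariant L f \<longrightarrow>
      eval v f = (\<Prod>i<M. c i ^ \<alpha> i) * eval (unit_rows L) f)" if "h \<noteq> 0" for h
  proof -
    obtain v where v: "eval v h \<noteq> 0" "eval v H \<noteq> 0"
      using eval_nonzero_common[OF \<open>h \<noteq> 0\<close> \<open>H \<noteq> 0\<close>] by blast
    then have "eval v (leading_minor L k) \<noteq> 0" if "k \<le> L" for k using that by (simp add: H_def)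
    from generic_point[OF LM this] v(1) show ?thesis by metis
  qed
  let ?F = "eval (unit_rows L) f"
  have fp: "f \<in> polys (grid M L)" "weight_vector M L \<alpha> f" using f by (auto simp: highest_weight_def)
  obtain v c where vc: "eval v f \<noteq> 0" "\<And>i. i \<ge> L \<Longrightarrow> c i = 0" "eval v f = (\<Prod>i<M. c i ^ \<alpha> i) * ?F"
    using generic[OF f(3)] f by blast
  have F: "?F \<noteq> 0" using vc by auto
  have zero: "\<alpha> j = 0" if "L \<le> j" "j < M" for j
  proof (rule ccontr)
    assume "\<alpha> j \<noteq> 0"
    then have "c j ^ \<alpha> j = 0" using vc(2)[OF that(1)] by simp
    then have "(\<Prod>i<M. c i ^ \<alpha> i) = 0" using that by (intro prod_zero) auto
    then show False using vc by simp
  qed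
  have even: "even (\<alpha> i)" if "i < L" for i
  proof (rule ccontr)
    assume odd: "odd (\<alpha> i)"
    define d where "d j = (if j = i then - 1 else 1 :: complex)" for j
    define g where "g a b = (if a = b then d a else 0)" for a b
    have "orthogonal_matrix L g"
    proof -
      have "(\<Sum>c<L. g a c * g b c) = (\<Sum>c<L. if c = a then (if a = b then 1 else 0) else 0)" for a b
        by (intro sum.cong) (auto simp: g_def d_def)
      then show ?thesis by (simp add: orthogonal_matrix_def)
    qed
    then have "eval (act L g (unit_rows L)) f = ?F" using f by (simp add: orthogonally_invariant_def)
    moreover have "eval (act L g (unit_rows L)) f = eval (\<lambda>(j, b). d j * unit_rows L (j, b)) f"
    proof (rule eval_cong[OF fp(1)])
      fix k assume k: "k \<in> grid M L"
      obtain j b where [simp]: "k = (j, b)" by (cases k)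
      have "act L g (unit_rows L) (j, b) = (\<Sum>c<L. if c = b then d b * unit_rows L (j, c) else 0)"
        unfolding act_def prod.case by (intro sum.cong) (auto simp: g_def)
      then show "act L g (unit_rows L) k = (case k of (j, b) \<Rightarrow> d j * unit_rows L (j, b))"
        using k by (simp add: unit_rows_def)
    qed
    moreover have "\<dots> = (\<Prod>j<M. d j ^ \<alpha> j) * ?F" by (rule eval_scale_rows[OF fp])
    moreover have "(\<Prod>j<M. d j ^ \<alpha> j) = (\<Prod>j<M. if j = i then - 1 else 1)"
      using odd by (intro prod.cong) (auto simp: d_def)
    ultimately show False using F that LM by simp
  qed
  define A where "A k = (if k < L then \<alpha> k else 0)" for k
  have A: "A (Suc k) \<le> A k" for k
    using highest_weight_dominant[OF fp(2) f(3), of k "Suc k"] f(1) LM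
    by (auto simp: A_def highest_weight_def)
  define e where "e k = (A (k - 1) - A k) div 2" for k
  have e2: "2 * e k = A (k - 1) - A k" for k
    using even by (simp add: e_def A_def)
  have sum_e: "(\<Sum>k\<in>{1..L}. (if i < k then 2 else 0) * e k) = \<alpha> i" if "i < M" for i
  proof -
    have "(\<Sum>k\<in>{1..L}. (if i < k then 2 else 0) * e k) = (\<Sum>k\<in>{i<..L}. 2 * e k)"
      by (intro sum.mono_neutral_cong_right) auto
    also have "\<dots> = A i" using telescope_antimono[of A i L] A
      by (cases "i \<le> L") (auto simp: e2 A_def)
    also have "\<dots> = \<alpha> i" using zero that by (auto simp: A_def)
    finally show ?thesis .
  qed
  define G where "G = cst ?F * (\<Prod>k\<in>{1..L}. leading_minor L k ^ e k)"
  have "f - G = 0"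
  proof (rule ccontr)
    assume "f - G \<noteq> 0"
    from generic[OF this] obtain v c where v: "eval v (f - G) \<noteq> 0" and
      vc: "\<And>f \<alpha>. highest_weight M L \<alpha> f \<Longrightarrow> orthogonally_invariant L f \<Longrightarrow>
        eval v f = (\<Prod>i<M. c i ^ \<alpha> i) * eval (unit_rows L) f" by blast
    have "eval v (leading_minor L k) = (\<Prod>i<M. c i ^ (if i < k then 2 else 0))" if "k \<in> {1..L}" for k
      using vc[OF highest_weight_leading_minor[of k M L] orthogonally_invariant_gram_minor] that LM
      by (simp add: eval_leading_minor_unit_rows)
    then have "eval v G = ?F * (\<Prod>k\<in>{1..L}. \<Prod>i<M. c i ^ ((if i < k then 2 else 0) * e k))"
      by (simp add: G_def prod_power_distrib power_mult)
    also have "\<dots> = ?F * (\<Prod>i<M. c i ^ (\<Sum>k\<in>{1..L}. (if i < k then 2 else 0) * e k))"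
      by (subst prod.swap) (simp add: power_sum)
    also have "(\<Prod>i<M. c i ^ (\<Sum>k\<in>{1..L}. (if i < k then 2 else 0) * e k)) = (\<Prod>i<M. c i ^ \<alpha> i)"
      by (intro prod.cong refl) (simp only: sum_e lessThan_iff)
    also have "?F * \<dots> = eval v f" by (simp add: vc[OF f(1,2)])
    finally show False using v by simp
  qed
  then show ?thesis using that[OF F, of e] by (simp add: G_def)
qed

section \<open>The fundamental theorems for the orthogonal group\<close>

definition gram_subst :: "nat \<Rightarrow> sym_poly \<Rightarrow> (nat \<times> nat) cpoly" where
  "gram_subst L = compose (\<lambda>(i, j). gram_entry L i j)"

definition sym_entry :: "nat \<Rightarrow> nat \<Rightarrow> sym_poly" where
  "sym_entry i j = var (min i j, max i j)"

abbreviation upper :: "nat \<Rightarrow> (nat \<times> nat) set" where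
  "upper m \<equiv> {(i, j). i \<le> j \<and> j < m}"

lemma gram_subst_simps [simp]:
  "gram_subst L (p + q) = gram_subst L p + gram_subst L q"
  "gram_subst L (p * q) = gram_subst L p * gram_subst L q"
  "gram_subst L (p - q) = gram_subst L p - gram_subst L q"
  "gram_subst L (cst c) = cst c" "gram_subst L 0 = 0" "gram_subst L 1 = 1"
  "gram_subst L (var k) = gram_entry L (fst k) (snd k)"
  "gram_subst L (sum f I) = (\<Sum>i\<in>I. gram_subst L (f i))"
  by (simp_all add: gram_subst_def split_def)

lemma gram_subst_sym_entry [simp]: "gram_subst L (sym_entry i j) = gram_entry L i j"
  by (cases "i \<le> j") (simp_all add: sym_entry_def gram_entry_commute min_def max_def)

lemma comm_ring_hom_gram_subst: "comm_ring_hom (gram_subst L)"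
  unfolding gram_subst_def by (rule psubst_comm_ring_hom[OF cst_hom])

lemma gram_subst_minor [simp]: "gram_subst L (index_minor sym_entry k r s) = gram_minor L k r s"
  by (simp add: index_minor_hom[OF comm_ring_hom_gram_subst])

lemma eval_gram_subst: "eval v (gram_subst L q) = eval (\<lambda>(i, j). gram L v i j) q"
  by (simp add: gram_subst_def eval_compose split_def)

lemma sym_entry_polys: "i < m \<Longrightarrow> j < m \<Longrightarrow> sym_entry i j \<in> sym_polys m"
  by (auto simp: sym_entry_def sym_polys_eq)

lemma gram_subst_polys: "q \<in> sym_polys m \<Longrightarrow> gram_subst L q \<in> polys (grid m L)"
  unfolding gram_subst_def sym_polys_eq
  by (rule compose_in_polys) (auto intro: gram_entry_polys)

lemma orthogonally_invariant_gram_subst: "orthogonally_invariant L (gram_subst L q)"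
  by (auto simp: orthogonally_invariant_def eval_gram_subst gram_act)

lemma pol_gram_subst:
  assumes "q \<in> sym_polys M" "i < M" "j < M"
  shows "pol L i j (gram_subst L q) \<in> gram_subst L ` sym_polys M"
  using assms(1) unfolding sym_polys_eq
proof (induction rule: polys_induct)
  case (cst c)
  then show ?case by (auto intro!: image_eqI[of _ _ 0])
next
  case (var k)
  obtain x y where k: "k = (x, y)" "x < M" "y < M" using var by auto
  have eq: "pol L i j (gram_subst L (var k))
    = gram_subst L ((if x = j then sym_entry i y else 0) + (if y = j then sym_entry x i else 0))"
    by (simp add: k pol_gram_entry)
  show ?case unfolding eq
    using k assms sym_entry_polys[of _ M] by (intro imageI polys_add) (auto simp: sym_polys_eq)
next
  case (add p q)
  then obtain p' q' where pq: "p' \<in> polys (upper M)" "q' \<in> polys (upper M)"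
    "pol L i j (gram_subst L p) = gram_subst L p'" "pol L i j (gram_subst L q) = gram_subst L q'" by auto
  then have eq: "pol L i j (gram_subst L (p + q)) = gram_subst L (p' + q')" by simp
  show ?case unfolding eq using pq by (intro imageI polys_add)
next
  case (mult p q)
  then obtain p' q' where pq: "p' \<in> polys (upper M)" "q' \<in> polys (upper M)"
    "pol L i j (gram_subst L p) = gram_subst L p'" "pol L i j (gram_subst L q) = gram_subst L q'" by auto
  then have eq: "pol L i j (gram_subst L (p * q)) = gram_subst L (p' * q + p * q')" by simp
  show ?case unfolding eq using pq mult.hyps by (intro imageI polys_add polys_mult)
qed

lemma pol_stable_image: "pol_stable M L (gram_subst L ` sym_polys M)"
  unfolding pol_stable_def subspace_of_def
proof (intro conjI ballI allI impI)
  show "0 \<in> gram_subst L ` sym_polys M" by (rule image_eqI[of _ _ 0]) (auto simp: sym_polys_eq)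
next
  fix p q assume "p \<in> gram_subst L ` sym_polys M" "q \<in> gram_subst L ` sym_polys M"
  then show "p + q \<in> gram_subst L ` sym_polys M"
    by (auto simp: sym_polys_eq simp flip: gram_subst_simps(1))
next
  fix c p assume "p \<in> gram_subst L ` sym_polys M"
  then obtain q where q: "q \<in> sym_polys M" "p = gram_subst L q" by auto
  then have eq: "cst c * p = gram_subst L (cst c * q)" by simp
  show "cst c * p \<in> gram_subst L ` sym_polys M"
    unfolding eq using q by (intro imageI) (auto simp: sym_polys_eq)
next
  fix i j p assume "i < M" "j < M" "p \<in> gram_subst L ` sym_polys M"
  then show "pol L i j p \<in> gram_subst L ` sym_polys M" using pol_gram_subst by auto
qed

lemma pol_stable_invariants:
  "pol_stable M L {f \<in> polys (grid M L). orthogonally_invariant L f}"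
  by (auto simp: pol_stable_def subspace_of_def pol_polys orthogonally_invariant_pol)
    (auto simp: orthogonally_invariant_def)

lemma sym_minor_polys:
  "(\<And>a. a < k \<Longrightarrow> r a < m) \<Longrightarrow> (\<And>a. a < k \<Longrightarrow> s a < m) \<Longrightarrow> index_minor sym_entry k r s \<in> sym_polys m"
  unfolding sym_polys_eq by (rule index_minor_in_polys) (auto simp: sym_polys_eq[symmetric] intro: sym_entry_polys)

lemma highest_weight_invariant_gram_subst:
  assumes LM: "L \<le> M" and f: "highest_weight M L \<alpha> f" "orthogonally_invariant L f"
  shows "f \<in> gram_subst L ` sym_polys M"
proof (cases "f = 0")
  case True
  then show ?thesis by (auto intro!: image_eqI[of _ _ 0] simp: sym_polys_eq)
next
  case False
  obtain c e where f: "f = cst c * (\<Prod>k\<in>{1..L}. leading_minor L k ^ e k)"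
    using highest_weight_invariant_form[OF LM f False] by blast
  let ?q = "cst c * (\<Prod>k\<in>{1..L}. index_minor sym_entry k (\<lambda>i. i) (\<lambda>i. i) ^ e k)"
  interpret comm_ring_hom "gram_subst L" by (rule comm_ring_hom_gram_subst)
  have "f = gram_subst L ?q" by (simp add: f hom_prod hom_power)
  moreover have "?q \<in> sym_polys M"
    using LM sym_minor_polys[of _ "\<lambda>i. i" M "\<lambda>i. i"] unfolding sym_polys_eq
    by (intro polys_mult polys_prod polys_power) auto
  ultimately show ?thesis by blast
qed

lemma compose_compose: "compose g (compose h p) = compose (\<lambda>k. compose g (h k)) p"
  using polys_UNIV[of p] by (induction rule: polys_induct) auto

lemma compose_var_eq:
  assumes "p \<in> polys S" "\<And>k. k \<in> S \<Longrightarrow> g k = var k"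
  shows "compose g p = p"
  using assms(1) by (induction rule: polys_induct) (auto simp: assms(2))

definition restrict_rows :: "nat \<Rightarrow> (nat \<times> nat) cpoly \<Rightarrow> (nat \<times> nat) cpoly" where
  "restrict_rows m = compose (\<lambda>(i, b). if i < m then var (i, b) else 0)"

definition restrict_sym :: "nat \<Rightarrow> sym_poly \<Rightarrow> sym_poly" where
  "restrict_sym m = compose (\<lambda>(i, j). if i < m \<and> j < m then var (i, j) else 0)"

lemma restrict_rows_gram_subst: "restrict_rows m (gram_subst L q) = gram_subst L (restrict_sym m q)"
proof -
  have "(case k of (i, j) \<Rightarrow> compose (\<lambda>(i, b). if i < m then var (i, b) else 0) (gram_entry L i j))
    = compose (\<lambda>(i, j). gram_entry L i j) (case k of (i, j) \<Rightarrow> if i < m \<and> j < m then var (i, j) else 0)" for k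
    by (cases k) (auto simp: gram_entry_def)
  then show ?thesis
    by (simp add: restrict_rows_def restrict_sym_def gram_subst_def compose_compose split_def)
qed

lemma restrict_rows_id: "p \<in> polys (grid m L) \<Longrightarrow> restrict_rows m p = p"
  unfolding restrict_rows_def by (rule compose_var_eq) auto

lemma restrict_sym_polys: "q \<in> sym_polys M \<Longrightarrow> restrict_sym m q \<in> sym_polys m"
  unfolding restrict_sym_def sym_polys_eq by (rule compose_in_polys) auto

theorem first_fundamental_theorem:
  assumes f: "f \<in> polys (grid m N)" "orthogonally_invariant N f"
  obtains q where "q \<in> sym_polys m" "f = gram_subst N q"
proof -
  let ?M = "m + N"
  let ?W = "{f \<in> polys (grid ?M N). orthogonally_invariant N f}"
  have "?W \<subseteq> gram_subst N ` sym_polys ?M"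
  proof (rule highest_weight_criterion[OF pol_stable_invariants pol_stable_image])
    show "gram_subst N ` sym_polys ?M \<subseteq> ?W"
      using gram_subst_polys orthogonally_invariant_gram_subst by auto
    show "g \<in> gram_subst N ` sym_polys ?M" if "g \<in> ?W" "weight_vector ?M N \<alpha> g"
      "\<And>i j. i < j \<Longrightarrow> j < ?M \<Longrightarrow> pol N i j g = 0" for g \<alpha>
      using that by (intro highest_weight_invariant_gram_subst[of N ?M \<alpha>]) (auto simp: highest_weight_def)
  qed auto
  moreover have "grid m N \<subseteq> grid ?M N" by auto
  then have "f \<in> ?W" using f polys_mono by blast
  ultimately obtain q where q: "q \<in> sym_polys ?M" "f = gram_subst N q" by blast
  have "f = restrict_rows m f" using f by (simp add: restrict_rows_id)
  also have "\<dots> = gram_subst N (restrict_sym m q)" by (simp add: q restrict_rows_gram_subst)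
  finally show ?thesis using that restrict_sym_polys[OF q(1)] by blast
qed

inductive_set minor_ideal :: "nat \<Rightarrow> nat \<Rightarrow> sym_poly set" for m k where
  zero: "0 \<in> minor_ideal m k"
| step: "x \<in> minor_ideal m k \<Longrightarrow> q \<in> sym_polys m \<Longrightarrow> (\<And>a. a < k \<Longrightarrow> r a < m) \<Longrightarrow>
    (\<And>a. a < k \<Longrightarrow> s a < m) \<Longrightarrow> x + q * index_minor sym_entry k r s \<in> minor_ideal m k"

lemma minor_ideal_polys: "x \<in> minor_ideal m k \<Longrightarrow> x \<in> sym_polys m"
proof (induction rule: minor_ideal.induct)
  case (step x q r s)
  then show ?case using sym_minor_polys[of k r m s] by (auto simp: sym_polys_eq)
qed (simp add: sym_polys_eq)

lemma minor_ideal_add: "y \<in> minor_ideal m k \<Longrightarrow> x \<in> minor_ideal m k \<Longrightarrow> x + y \<in> minor_ideal m k"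
proof (induction rule: minor_ideal.induct)
  case (step y q r s)
  then have "(x + y) + q * index_minor sym_entry k r s \<in> minor_ideal m k" by (intro minor_ideal.step) auto
  then show ?case by (simp add: add.assoc)
qed simp

lemma minor_ideal_mult: "x \<in> minor_ideal m k \<Longrightarrow> p \<in> sym_polys m \<Longrightarrow> p * x \<in> minor_ideal m k"
proof (induction rule: minor_ideal.induct)
  case (step x q r s)
  then have "p * x + (p * q) * index_minor sym_entry k r s \<in> minor_ideal m k"
    by (intro minor_ideal.step) (auto simp: sym_polys_eq)
  then show ?case by (simp add: distrib_left mult.assoc)
qed (simp add: minor_ideal.zero)

lemma minor_ideal_minor:
  "(\<And>a. a < k \<Longrightarrow> r a < m) \<Longrightarrow> (\<And>a. a < k \<Longrightarrow> s a < m) \<Longrightarrow> index_minor sym_entry k r s \<in> minor_ideal m k"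
  using minor_ideal.step[OF minor_ideal.zero, of 1 m k r s] by (auto simp: sym_polys_eq)

lemma minor_ideal_sum: "(\<And>i. i \<in> I \<Longrightarrow> f i \<in> minor_ideal m k) \<Longrightarrow> sum f I \<in> minor_ideal m k"
  by (induction I rule: infinite_finite_induct) (auto intro: minor_ideal.zero minor_ideal_add)

lemma minor_ideal_larger_minor:
  assumes "k \<le> l"
  shows "(\<And>a. a < l \<Longrightarrow> r a < m) \<Longrightarrow> (\<And>a. a < l \<Longrightarrow> s a < m) \<Longrightarrow> index_minor sym_entry l r s \<in> minor_ideal m k"
  using assms
proof (induction l arbitrary: r s rule: dec_induct)
  case base
  then show ?case by (rule minor_ideal_minor)
next
  case (step l)
  have neg: "(- 1) ^ b \<in> sym_polys m" for b unfolding sym_polys_eq by (intro polys_power) auto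
  show ?case unfolding index_minor_Suc_laplace
    by (intro minor_ideal_sum minor_ideal_mult step.IH sym_entry_polys neg) (auto simp: step.prems)
qed

lemma pol_stable_minor_ideal: "pol_stable M L (gram_subst L ` minor_ideal M k)"
proof -
  let ?U = "gram_subst L ` minor_ideal M k"
  have add: "p + q \<in> ?U" if "p \<in> ?U" "q \<in> ?U" for p q
    using that by (auto simp flip: gram_subst_simps(1) intro: minor_ideal_add)
  have mult: "p * q \<in> ?U" if "p \<in> gram_subst L ` sym_polys M" "q \<in> ?U" for p q
    using that by (auto simp flip: gram_subst_simps(2) intro: minor_ideal_mult)
  have zero: "0 \<in> ?U" by (rule image_eqI[of _ _ 0]) (auto intro: minor_ideal.zero)
  have sum: "sum f I \<in> ?U" if "\<And>i. i \<in> I \<Longrightarrow> f i \<in> ?U" for f and I :: "nat set"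
    using that by (induction I rule: infinite_finite_induct) (auto intro: add simp: zero simp del: image_iff)
  have minor: "gram_minor L k r s \<in> ?U" if "\<And>a. a < k \<Longrightarrow> r a < M" "\<And>a. a < k \<Longrightarrow> s a < M" for r s
    using imageI[OF minor_ideal_minor[OF that], where f = "gram_subst L"] by simp
  have "pol L i j (gram_subst L x) \<in> ?U" if "x \<in> minor_ideal M k" "i < M" "j < M" for i j x
    using that
  proof (induction rule: minor_ideal.induct)
    case (step x q r s)
    have "pol L i j (gram_minor L k r s) \<in> ?U" unfolding pol_gram_minor
      by (intro add sum) (auto intro!: minor simp: zero step simp del: image_iff)
    then have "pol L i j (gram_subst L x) + (pol L i j (gram_subst L q) * gram_minor L k r s
       + gram_subst L q * pol L i j (gram_minor L k r s)) \<in> ?U"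
      using step pol_gram_subst[of q M i j L] by (intro add mult minor) auto
    then show ?case by simp
  qed (simp add: zero)
  moreover have "cst c * p \<in> ?U" if "p \<in> ?U" for c p
  proof (rule mult[OF _ that])
    show "cst c \<in> gram_subst L ` sym_polys M"
      by (rule image_eqI[of _ _ "cst c"]) (auto simp: sym_polys_eq)
  qed
  ultimately show ?thesis using add zero unfolding pol_stable_def subspace_of_def by blast
qed

lemma eval_gram_subst_low_rank_pol:
  assumes f: "f \<in> polys (grid M L)" "j < M"
    and zero: "\<And>v. (\<And>i b. N \<le> b \<Longrightarrow> v (i, b) = 0) \<Longrightarrow> eval v f = 0"
    and v: "\<And>i b. N \<le> b \<Longrightarrow> v (i, b) = 0"
  shows "eval v (pol L i j f) = 0"
proof -
  have "((\<lambda>t. eval (\<lambda>(r, b). v (r, b) + (if r = j then t * v (i, b) else 0)) f)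
    has_field_derivative 0) (at 0)"
    using v by (subst zero) auto
  then show ?thesis using eval_curve[OF f] DERIV_unique by blast
qed

lemma vanishing_subset_minor_ideal:
  fixes L N
  defines "W \<equiv> {f \<in> gram_subst L ` sym_polys L.
    \<forall>v. (\<forall>i b. N \<le> b \<longrightarrow> v (i, b) = 0) \<longrightarrow> eval v f = 0}"
  shows "W \<subseteq> gram_subst L ` minor_ideal L (N + 1)"
proof -
  let ?U = "gram_subst L ` minor_ideal L (N + 1)"
  have "pol_stable L L W"
    unfolding pol_stable_def
  proof (intro conjI allI impI ballI)
    show "subspace_of W" using pol_stable_image[of L L]
      by (auto simp: pol_stable_def W_def subspace_of_def simp del: image_iff)
    fix i j f assume ij: "i < L" "j < L" and f: "f \<in> W"
    have "f \<in> polys (grid L L)" using f gram_subst_polys by (auto simp: W_def)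
    from eval_gram_subst_low_rank_pol[OF this ij(2), of N]
    have "eval v (pol L i j f) = 0" if "\<forall>i b. N \<le> b \<longrightarrow> v (i, b) = 0" for v
      using f that by (auto simp: W_def)
    then show "pol L i j f \<in> W" using f ij pol_stable_image[of L L] by (auto simp: W_def pol_stable_def)
  qed
  then have "W \<subseteq> W \<inter> ?U"
  proof (rule highest_weight_criterion)
    show "pol_stable L L (W \<inter> ?U)"
      using \<open>pol_stable L L W\<close> pol_stable_minor_ideal[of L L "N + 1"]
      by (auto simp: pol_stable_def subspace_of_def simp del: image_iff)
    show "W \<subseteq> polys (grid L L)" using gram_subst_polys by (auto simp: W_def)
    fix g \<alpha> assume g: "g \<in> W" "g \<noteq> 0" "weight_vector L L \<alpha> g"
      "\<And>i j. i < j \<Longrightarrow> j < L \<Longrightarrow> pol L i j g = 0"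
    have "highest_weight L L \<alpha> g" "orthogonally_invariant L g"
      using g gram_subst_polys orthogonally_invariant_gram_subst
      by (auto simp: highest_weight_def W_def)
    with g(2) obtain c e where ce: "c \<noteq> 0" "g = cst c * (\<Prod>k\<in>{1..L}. leading_minor L k ^ e k)"
      using highest_weight_invariant_form[of L L \<alpha> g] by blast
    have "eval (unit_rows N) g = 0" using g(1) by (auto simp: W_def unit_rows_def)
    then obtain k where k: "k \<in> {1..L}" "eval (unit_rows N) (leading_minor L k) ^ e k = 0"
      using ce by auto
    then have "N < k" using eval_leading_minor_unit_rows[of k N L]
      by (metis atLeastAtMost_iff not_le power_one zero_neq_one)
    have "e k \<noteq> 0" using k(2) by (intro notI) simp
    interpret comm_ring_hom "gram_subst L" by (rule comm_ring_hom_gram_subst)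
    let ?D = "\<lambda>k. index_minor sym_entry k (\<lambda>i. i) (\<lambda>i. i)"
    define q where "q = cst c * (?D k ^ (e k - 1) * (\<Prod>l\<in>{1..L} - {k}. ?D l ^ e l))"
    have D: "gram_subst L (?D l) = leading_minor L l" for l by simp
    define P where "P = (\<Prod>l\<in>{1..L} - {k}. leading_minor L l ^ e l)"
    have "g = cst c * (leading_minor L k ^ e k * P)"
      unfolding ce(2) P_def by (simp only: prod.remove[OF finite_atLeastAtMost k(1)])
    also have "leading_minor L k ^ e k = leading_minor L k ^ (e k - 1) * leading_minor L k"
      using \<open>e k \<noteq> 0\<close> by (intro power_minus_mult[symmetric]) simp
    also have "cst c * (leading_minor L k ^ (e k - 1) * leading_minor L k * P)
      = cst c * (leading_minor L k ^ (e k - 1) * P) * leading_minor L k"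
      by (simp only: mult_ac)
    also have "\<dots> = gram_subst L (q * ?D k)"
      unfolding q_def gram_subst_simps hom_prod hom_power D P_def ..
    finally have "g = gram_subst L (q * ?D k)" .
    moreover have "q * ?D k \<in> minor_ideal L (N + 1)"
    proof (rule minor_ideal_mult)
      show "?D k \<in> minor_ideal L (N + 1)"
        using \<open>N < k\<close> k by (intro minor_ideal_larger_minor) auto
      show "q \<in> sym_polys L" using k sym_minor_polys[of _ "\<lambda>i. i" L "\<lambda>i. i"]
        unfolding q_def sym_polys_eq by (intro polys_mult polys_prod polys_power polys_cst) auto
    qed
    ultimately show "g \<in> W \<inter> ?U" using g by blast
  qed auto
  then show ?thesis by blast
qed

lemma restrict_sym_minor_ideal:
  assumes "x \<in> minor_ideal M k"
  shows "restrict_sym m x \<in> minor_ideal m k"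
  using assms
proof (induction rule: minor_ideal.induct)
  case zero
  then show ?case by (simp add: restrict_sym_def minor_ideal.zero)
next
  case (step x q r s)
  interpret comm_ring_hom "restrict_sym m"
    unfolding restrict_sym_def by (rule psubst_comm_ring_hom[OF cst_hom])
  have entry: "restrict_sym m (sym_entry i j) = (if i < m \<and> j < m then sym_entry i j else 0)" for i j
    by (auto simp: restrict_sym_def sym_entry_def)
  have minor: "restrict_sym m (index_minor sym_entry k r s)
      = index_minor (\<lambda>i j. restrict_sym m (sym_entry i j)) k r s"
    by (rule index_minor_hom) unfold_locales
  have "restrict_sym m (index_minor sym_entry k r s) \<in> minor_ideal m k"
  proof (cases "(\<forall>a<k. r a < m) \<and> (\<forall>a<k. s a < m)")
    case True
    then have "restrict_sym m (index_minor sym_entry k r s) = index_minor sym_entry k r s"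
      unfolding minor by (intro index_minor_cong) (simp add: entry)
    with True show ?thesis by (simp add: minor_ideal_minor)
  next
    case False
    have "(\<Prod>a = 0..<k. restrict_sym m (sym_entry (r a) (s (\<pi> a)))) = 0" if \<pi>: "\<pi> permutes {0..<k}" for \<pi>
    proof -
      consider a where "a < k" "\<not> r a < m" | b where "b < k" "\<not> s b < m" using False by blast
      then obtain a where "a < k" "\<not> r a < m \<or> \<not> s (\<pi> a) < m"
      proof cases
        case (2 b)
        then have "b \<in> \<pi> ` {0..<k}" using permutes_image[OF \<pi>] by simp
        then show ?thesis using 2 that by auto
      qed blast
      then show ?thesis by (intro prod_zero) (auto simp: entry intro!: bexI[of _ a])
    qed
    then have "restrict_sym m (index_minor sym_entry k r s) = 0"
      unfolding minor unfolding index_minor_leibniz by (intro sum.neutral) auto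
    then show ?thesis by (simp add: minor_ideal.zero)
  qed
  then show ?case using step restrict_sym_polys[of q M m]
    by (simp add: hom_add hom_mult minor_ideal_add minor_ideal_mult)
qed

text \<open>Every symmetric matrix \<open>X\<close> is the Gram matrix of the rows of \<open>(1 + X/4 | i (1 - X/4))\<close>.\<close>

lemma gram_subst_injective:
  assumes p: "p \<in> sym_polys m" and zero: "gram_subst (2 * m) p = 0"
  shows "p = 0"
proof (rule eval_eq_zero_imp_zero)
  fix x :: "nat \<times> nat \<Rightarrow> complex"
  define X where "X i j = x (min i j, max i j)" for i j :: nat
  have X: "X i j = X j i" for i j by (simp add: X_def min.commute max.commute)
  define d where "d i b = (if i = b then 1 else 0 :: complex)" for i b :: nat
  define v where "v = (\<lambda>(i, b). if b < m then d i b + X i b / 4 else \<i> * (d i (b - m) - X i (b - m) / 4))"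
  have g: "gram (2 * m) v i j = X i j" if "i < m" "j < m" for i j
  proof -
    have "gram (2 * m) v i j = (\<Sum>b<m. v (i, b) * v (j, b)) + (\<Sum>b = m..<2 * m. v (i, b) * v (j, b))"
      unfolding gram_def lessThan_atLeast0 by (intro sum.atLeastLessThan_concat[symmetric]) simp_all
    also have "(\<Sum>b = m..<2 * m. v (i, b) * v (j, b)) = (\<Sum>b<m. v (i, b + m) * v (j, b + m))"
    proof -
      have "{m..<2 * m} = {0 + m..<m + m}" by (simp add: mult_2)
      then show ?thesis by (simp only: sum.shift_bounds_nat_ivl lessThan_atLeast0)
    qed
    also have "(\<Sum>b<m. v (i, b) * v (j, b)) + (\<Sum>b<m. v (i, b + m) * v (j, b + m))
      = (\<Sum>b<m. d i b * (X j b / 2) + d j b * (X i b / 2))"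
      unfolding sum.distrib[symmetric] by (intro sum.cong refl) (simp add: v_def algebra_simps)
    also have "\<dots> = X i j"
    proof -
      have "(\<Sum>b<m. d i b * (X j b / 2) + d j b * (X i b / 2))
        = (\<Sum>b<m. (if b = i then X j i / 2 else 0) + (if b = j then X i j / 2 else 0))"
        by (intro sum.cong refl) (auto simp: d_def)
      then show ?thesis using that X[of j i] by (simp add: sum.distrib)
    qed
    finally show ?thesis .
  qed
  have "eval x p = eval (\<lambda>(i, j). gram (2 * m) v i j) p"
    by (rule eval_cong[OF p[unfolded sym_polys_eq]]) (auto simp: g X_def)
  also have "\<dots> = eval v (gram_subst (2 * m) p)" by (simp add: eval_gram_subst)
  finally show "eval x p = 0" by (simp add: zero)
qed

theorem second_fundamental_theorem:
  assumes q: "q \<in> sym_polys m" and zero: "\<And>v. eval (\<lambda>(i, j). gram N v i j) q = 0"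
  shows "q \<in> minor_ideal m (N + 1)"
proof -
  let ?L = "2 * m"
  have qL: "q \<in> sym_polys ?L" using q by (fastforce simp: sym_polys_eq polys_def)
  have "eval v (gram_subst ?L q) = 0" if v: "\<And>i b. N \<le> b \<Longrightarrow> v (i, b) = 0" for v
  proof -
    define w where "w = (\<lambda>(i :: nat, b). if b < ?L then v (i, b) else 0)"
    have "gram ?L v i j = gram N w i j" for i j
    proof -
      have "gram ?L v i j = (\<Sum>b\<in>{..<?L} \<inter> {..<N}. v (i, b) * v (j, b))"
        unfolding gram_def
      proof (intro sum.mono_neutral_right ballI)
        fix b assume "b \<in> {..<?L} - {..<?L} \<inter> {..<N}"
        then have "N \<le> b" by auto
        then show "v (i, b) * v (j, b) = 0" using v by simp
      qed auto
      also have "\<dots> = gram N w i j"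
        unfolding gram_def by (intro sum.mono_neutral_cong_left) (auto simp: w_def)
      finally show ?thesis .
    qed
    then show ?thesis using zero[of w] by (simp add: eval_gram_subst)
  qed
  then have "gram_subst ?L q \<in> gram_subst ?L ` minor_ideal ?L (N + 1)"
    using vanishing_subset_minor_ideal[of ?L N] qL by auto
  then obtain q' where q': "q' \<in> minor_ideal ?L (N + 1)" "gram_subst ?L q = gram_subst ?L q'" by blast
  have "gram_subst ?L q = restrict_rows m (gram_subst ?L q)"
    by (rule restrict_rows_id[OF gram_subst_polys[OF q], symmetric])
  also have "\<dots> = gram_subst ?L (restrict_sym m q')" by (simp add: q' restrict_rows_gram_subst)
  finally have zero: "gram_subst ?L (q - restrict_sym m q') = 0"
    by (simp only: gram_subst_simps(3) diff_self)
  have r: "restrict_sym m q' \<in> minor_ideal m (N + 1)" by (rule restrict_sym_minor_ideal[OF q'(1)])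
  have "q - restrict_sym m q' \<in> sym_polys m"
    using q minor_ideal_polys[OF r] unfolding sym_polys_eq by (rule polys_diff)
  from gram_subst_injective[OF this zero] have "q = restrict_sym m q'" by (simp only: right_minus_eq)
  with r show ?thesis by (simp only:)
qed

section \<open>The determinantal ideal\<close>

lemma cring_sym_ring: "cring (sym_ring m)"
proof (rule cringI)
  show "abelian_group (sym_ring m)"
  proof (rule abelian_groupI)
    fix x assume "x \<in> carrier (sym_ring m)"
    then show "\<exists>y\<in>carrier (sym_ring m). y \<oplus>\<^bsub>sym_ring m\<^esub> x = \<zero>\<^bsub>sym_ring m\<^esub>"
      by (intro bexI[of _ "- x"]) (auto simp: sym_ring_def sym_polys_eq)
  qed (auto simp: sym_ring_def sym_polys_eq add_ac)
  show "Group.comm_monoid (sym_ring m)"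
    by (rule Group.comm_monoidI) (auto simp: sym_ring_def sym_polys_eq mult_ac)
qed (auto simp: sym_ring_def distrib_right)

lemma index_minor_permute_rows:
  assumes "\<pi> permutes {0..<k}"
  shows "index_minor A k (\<lambda>a. r (\<pi> a)) s = signof \<pi> * index_minor A k r s"
proof -
  let ?A = "Matrix.mat k k (\<lambda>(a, b). A (r a) (s b))"
  have "Matrix.mat k k (\<lambda>(a, b). A (r (\<pi> a)) (s b)) = Matrix.mat k k (\<lambda>(i, j). ?A $$ (\<pi> i, j))"
    using permutes_in_image[OF assms] by (intro eq_matI) auto
  then show ?thesis
    unfolding index_minor_def using det_permute_rows[OF mat_carrier assms, of "\<lambda>(a, b). A (r a) (s b)"]
    by (simp only:)
qed

lemma index_minor_permute_cols:
  assumes "\<pi> permutes {0..<k}"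
  shows "index_minor A k r (\<lambda>a. s (\<pi> a)) = signof \<pi> * index_minor A k r s"
  by (subst (1 2) index_minor_transpose) (rule index_minor_permute_rows[OF assms])

lemma pick_permutes:
  assumes r: "inj_on r {0..<k}"
  obtains \<pi> where "\<pi> permutes {0..<k}" "\<And>a. a < k \<Longrightarrow> r a = pick (r ` {0..<k}) (\<pi> a)"
proof -
  let ?I = "r ` {0..<k}"
  have card: "card ?I = k" using card_image[OF r] by simp
  have bij: "bij_betw (pick ?I) {0..<k} ?I"
  proof (rule bij_betw_imageI)
    have mono: "pick ?I a < pick ?I b" if "a < b" "b < k" for a b
      using pick_mono_le[of b ?I a] that card by simp
    show inj: "inj_on (pick ?I) {0..<k}"
      by (rule inj_onI) (metis atLeastLessThan_iff linorder_neqE_nat mono less_irrefl)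
    have "pick ?I ` {0..<k} \<subseteq> ?I" using pick_in_set_le[of _ ?I] card by (auto simp del: image_iff)
    then show "pick ?I ` {0..<k} = ?I"
      by (intro card_subset_eq) (auto simp: card card_image[OF inj])
  qed
  define \<pi> where "\<pi> a = (if a < k then inv_into {0..<k} (pick ?I) (r a) else a)" for a
  have "bij_betw (\<lambda>a. inv_into {0..<k} (pick ?I) (r a)) {0..<k} {0..<k}"
    using bij_betw_trans[OF bij_betw_imageI[OF r refl] bij_betw_inv_into[OF bij]] by (simp add: comp_def)
  then have "bij_betw \<pi> {0..<k} {0..<k}"
    by (rule bij_betw_cong[THEN iffD1, rotated]) (simp add: \<pi>_def)
  then have "\<pi> permutes {0..<k}" by (rule bij_imp_permutes) (simp add: \<pi>_def)
  moreover have "r a = pick ?I (\<pi> a)" if "a < k" for a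
    using that bij_betw_inv_into_right[OF bij, of "r a"] by (simp add: \<pi>_def)
  ultimately show ?thesis using that by blast
qed

lemma det_submatrix_generic:
  assumes I: "I \<subseteq> {..<m}" "card I = k" and J: "J \<subseteq> {..<m}" "card J = k"
  shows "Determinant.det (submatrix (generic_symmetric_matrix m) I J) = index_minor sym_entry k (pick I) (pick J)"
proof -
  have sub: "{i. i < m \<and> i \<in> I} = I" "{i. i < m \<and> i \<in> J} = J" using I J by auto
  have "pick I a < m" "pick J a < m" if "a < k" for a
    using pick_in_set_le[of a I] pick_in_set_le[of a J] I J that by auto
  then have "submatrix (generic_symmetric_matrix m) I J = Matrix.mat k k (\<lambda>(a, b). sym_entry (pick I a) (pick J b))"
    by (intro eq_matI)
      (auto simp: dim_submatrix submatrix_index generic_symmetric_matrix_def sub I(2) J(2) sym_entry_def var_def)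
  then show ?thesis by (simp add: index_minor_def)
qed

lemma index_minor_zero_sum:
  "index_minor (\<lambda>i j. \<Sum>b<N. v (i, b) * v (j, b)) (Suc N) r s = (0 :: 'a::comm_ring_1)"
proof -
  let ?w = "\<lambda>i b. if b < N then v (i, b) else 0"
  let ?A = "Matrix.mat (Suc N) (Suc N) (\<lambda>(a, b). ?w (r a) b)"
  let ?B = "Matrix.mat (Suc N) (Suc N) (\<lambda>(b, a). ?w (s a) b)"
  have "Matrix.mat (Suc N) (Suc N) (\<lambda>(a, b). \<Sum>c<N. v (r a, c) * v (s b, c)) = ?A * ?B"
    by (intro eq_matI) (auto simp: scalar_prod_def lessThan_atLeast0)
  moreover have "Determinant.det (?A * ?B) = Determinant.det ?A * Determinant.det ?B"
    by (rule det_mult) auto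
  moreover have "Determinant.det ?B = 0"
  proof -
    have "(\<Prod>a = 0..<Suc N. ?w (s (\<pi> a)) a) = 0" for \<pi> by (rule prod_zero) auto
    then have "index_minor (\<lambda>b a. ?w a b) (Suc N) (\<lambda>i. i) s = 0"
      unfolding index_minor_leibniz by (intro sum.neutral) (auto intro!: prod_zero bexI[of _ N])
    then show ?thesis by (simp add: index_minor_def)
  qed
  ultimately show ?thesis by (simp add: index_minor_def)
qed

theorem determinantal_ideal_iff:
  "q \<in> determinantal_ideal m N \<longleftrightarrow> q \<in> sym_polys m \<and> (\<forall>v. eval (\<lambda>(i, j). gram N v i j) q = 0)"
proof
  let ?S = "{Determinant.det (submatrix (generic_symmetric_matrix m) I J) | I J.
      I \<subseteq> {..<m} \<and> J \<subseteq> {..<m} \<and> card I = N + 1 \<and> card J = N + 1}"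
  interpret cring "sym_ring m" by (rule cring_sym_ring)
  have pick: "pick I a < m" if "I \<subseteq> {..<m}" "card I = N + 1" "a < Suc N" for I a
    using pick_in_set_le[of a I] that by auto
  have S: "?S \<subseteq> {index_minor sym_entry (Suc N) r s | r s. (\<forall>a<Suc N. r a < m) \<and> (\<forall>a<Suc N. s a < m)}"
  proof
    fix x assume "x \<in> ?S"
    then obtain I J where IJ: "I \<subseteq> {..<m}" "J \<subseteq> {..<m}" "card I = N + 1" "card J = N + 1"
      and x: "x = Determinant.det (submatrix (generic_symmetric_matrix m) I J)" by blast
    have "x = index_minor sym_entry (Suc N) (pick I) (pick J)"
      using det_submatrix_generic[OF IJ(1) _ IJ(2), of "Suc N"] IJ(3,4) x by simp
    then show "x \<in> {index_minor sym_entry (Suc N) r s | r s. (\<forall>a<Suc N. r a < m) \<and> (\<forall>a<Suc N. s a < m)}"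
      using pick[OF IJ(1,3)] pick[OF IJ(2,4)] by blast
  qed
  have ScarR: "?S \<subseteq> carrier (sym_ring m)"
  proof
    fix x assume "x \<in> ?S"
    then obtain r s where "\<And>a. a < Suc N \<Longrightarrow> r a < m" "\<And>a. a < Suc N \<Longrightarrow> s a < m"
      "x = index_minor sym_entry (Suc N) r s" using S by blast
    then show "x \<in> carrier (sym_ring m)" using sym_minor_polys[of "Suc N" r m s] by (simp add: sym_ring_def)
  qed
  {
    let ?K = "{q \<in> sym_polys m. \<forall>v. eval (\<lambda>(i, j). gram N v i j) q = 0}"
    have "ideal ?K (sym_ring m)"
    proof (rule idealI)
      show "subgroup ?K (add_monoid (sym_ring m))"
      proof (rule add.subgroupI)
        fix a assume a: "a \<in> ?K"
        have "\<ominus>\<^bsub>sym_ring m\<^esub> a = - a"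
          using a by (intro minus_equality) (auto simp: sym_ring_def sym_polys_eq)
        with a show "\<ominus>\<^bsub>sym_ring m\<^esub> a \<in> ?K" by (auto simp: sym_polys_eq)
      qed (auto simp: sym_ring_def sym_polys_eq)
    qed (rule ring_axioms, auto simp: sym_ring_def sym_polys_eq)
    moreover have "?S \<subseteq> ?K"
    proof
      fix x assume "x \<in> ?S"
      then obtain r s where rs: "\<And>a. a < Suc N \<Longrightarrow> r a < m" "\<And>a. a < Suc N \<Longrightarrow> s a < m"
        "x = index_minor sym_entry (Suc N) r s" using S by blast
      have "eval (\<lambda>(i, j). gram N v i j) x = 0" for v
      proof -
        have "eval (\<lambda>(i, j). gram N v i j) x = eval v (gram_subst N x)" by (rule eval_gram_subst[symmetric])
        also have "\<dots> = index_minor (gram N v) (Suc N) r s" by (simp add: rs(3) eval_gram_minor)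
        also have "\<dots> = index_minor (\<lambda>i j. \<Sum>b<N. v (i, b) * v (j, b)) (Suc N) r s"
          by (rule index_minor_cong) (simp add: gram_def)
        also have "\<dots> = 0" by (rule index_minor_zero_sum)
        finally show ?thesis .
      qed
      then show "x \<in> ?K" using sym_minor_polys[OF rs(1,2)] rs(3) by auto
    qed
    ultimately have "determinantal_ideal m N \<subseteq> ?K"
      unfolding determinantal_ideal_def by (intro genideal_minimal)
    then show "q \<in> sym_polys m \<and> (\<forall>v. eval (\<lambda>(i, j). gram N v i j) q = 0)"
      if "q \<in> determinantal_ideal m N" using that by blast
  }
  {
    assume q: "q \<in> sym_polys m \<and> (\<forall>v. eval (\<lambda>(i, j). gram N v i j) q = 0)"
    interpret D: ideal "determinantal_ideal m N" "sym_ring m"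
      unfolding determinantal_ideal_def by (rule genideal_ideal[OF ScarR])
    have D_add: "x + y \<in> determinantal_ideal m N"
      if "x \<in> determinantal_ideal m N" "y \<in> determinantal_ideal m N" for x y
      using D.a_closed[OF that] by (simp add: sym_ring_def)
    have D_mult: "p * x \<in> determinantal_ideal m N" if "x \<in> determinantal_ideal m N" "p \<in> sym_polys m" for p x
      using D.I_l_closed[OF that(1), of p] that(2) by (simp add: sym_ring_def)
    have D_zero: "0 \<in> determinantal_ideal m N"
      using D.zero_closed by (simp add: sym_ring_def)
    have minor: "index_minor sym_entry (N + 1) r s \<in> determinantal_ideal m N"
      if rs: "\<And>a. a < N + 1 \<Longrightarrow> r a < m" "\<And>a. a < N + 1 \<Longrightarrow> s a < m" for r s
    proof (cases "inj_on r {0..<N + 1} \<and> inj_on s {0..<N + 1}")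
      case False
      then consider a b where "a < N + 1" "b < N + 1" "a \<noteq> b" "r a = r b"
        | a b where "a < N + 1" "b < N + 1" "a \<noteq> b" "s a = s b"
        unfolding inj_on_def by (meson atLeastLessThan_iff)
      then have "index_minor sym_entry (N + 1) r s = 0"
        by cases (rule index_minor_identical_rows index_minor_identical_cols; assumption)+
      then show ?thesis using D_zero by simp
    next
      case True
      obtain \<pi> where \<pi>: "\<pi> permutes {0..<N + 1}" "\<And>a. a < N + 1 \<Longrightarrow> r a = pick (r ` {0..<N + 1}) (\<pi> a)"
        using pick_permutes True by blast
      obtain \<rho> where \<rho>: "\<rho> permutes {0..<N + 1}" "\<And>a. a < N + 1 \<Longrightarrow> s a = pick (s ` {0..<N + 1}) (\<rho> a)"
        using pick_permutes True by blast
      let ?I = "r ` {0..<N + 1}" and ?J = "s ` {0..<N + 1}"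
      have IJ: "?I \<subseteq> {..<m}" "?J \<subseteq> {..<m}" using rs by (intro image_subsetI; simp)+
      have card: "card ?I = N + 1" "card ?J = N + 1"
        using card_image[of r "{0..<N + 1}"] card_image[of s "{0..<N + 1}"] True by simp_all
      have "index_minor sym_entry (N + 1) r s
         = index_minor sym_entry (N + 1) (\<lambda>a. pick ?I (\<pi> a)) (\<lambda>a. pick ?J (\<rho> a))"
        by (rule index_minor_cong) (simp only: \<pi>(2)[symmetric] \<rho>(2)[symmetric])
      also have "\<dots> = signof \<pi> * (signof \<rho> * index_minor sym_entry (N + 1) (pick ?I) (pick ?J))"
        by (simp only: index_minor_permute_rows[OF \<pi>(1)] index_minor_permute_cols[OF \<rho>(1)])
      also have "\<dots> = (signof \<pi> * signof \<rho>) * Determinant.det (submatrix (generic_symmetric_matrix m) ?I ?J)"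
        by (simp only: det_submatrix_generic[OF IJ(1) card(1) IJ(2) card(2)] mult.assoc)
      also have "\<dots> \<in> determinantal_ideal m N"
      proof (rule D_mult)
        show "Determinant.det (submatrix (generic_symmetric_matrix m) ?I ?J) \<in> determinantal_ideal m N"
          using genideal_self[OF ScarR] IJ card unfolding determinantal_ideal_def by blast
        show "signof \<pi> * signof \<rho> \<in> sym_polys m"
          by (auto simp: sign_def sym_polys_eq)
      qed
      finally show ?thesis .
    qed
    have "x \<in> determinantal_ideal m N" if "x \<in> minor_ideal m (N + 1)" for x
      using that
    proof (induction rule: minor_ideal.induct)
      case (step x q r s)
      show ?case by (intro D_add D_mult minor step)
    qed (rule D_zero)
    then show "q \<in> determinantal_ideal m N" using second_fundamental_theorem[of q m N] q by blast
  }
qed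

section \<open>Functoriality of Proj under isomorphisms of graded algebras\<close>

lemma image_left_inverse: "(\<And>x. x \<in> S \<Longrightarrow> g (f x) = x) \<Longrightarrow> g ` f ` S = S"
proof -
  assume "\<And>x. x \<in> S \<Longrightarrow> g (f x) = x"
  then have "(\<lambda>x. g (f x)) ` S = (\<lambda>x. x) ` S" by (rule image_cong[OF refl])
  then show ?thesis by (simp add: image_image)
qed

locale graded_iso =
  fixes A :: "('a, 'y) graded_algebra_scheme" and A' :: "('b, 'z) graded_algebra_scheme"
    and h :: "'a \<Rightarrow> 'b" and k :: "'b \<Rightarrow> 'a"
  assumes cring: "cring A" "cring A'"
    and closed: "\<And>x. x \<in> carrier A \<Longrightarrow> h x \<in> carrier A'" "\<And>y. y \<in> carrier A' \<Longrightarrow> k y \<in> carrier A"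
    and inverse: "\<And>x. x \<in> carrier A \<Longrightarrow> k (h x) = x" "\<And>y. y \<in> carrier A' \<Longrightarrow> h (k y) = y"
    and hom: "\<And>x y. x \<in> carrier A \<Longrightarrow> y \<in> carrier A \<Longrightarrow> h (x \<otimes>\<^bsub>A\<^esub> y) = h x \<otimes>\<^bsub>A'\<^esub> h y"
      "\<And>x y. x \<in> carrier A \<Longrightarrow> y \<in> carrier A \<Longrightarrow> h (x \<oplus>\<^bsub>A\<^esub> y) = h x \<oplus>\<^bsub>A'\<^esub> h y"
      "h \<one>\<^bsub>A\<^esub> = \<one>\<^bsub>A'\<^esub>"
    and grade_closed: "\<And>d. grade A d \<subseteq> carrier A"
    and grade: "\<And>d. h ` grade A d = grade A' d"
    and scalar_closed: "\<And>c. scalar A c \<in> carrier A"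
    and scalar: "\<And>c. h (scalar A c) = scalar A' c"
begin

lemma symmetric: "graded_iso A' A k h"
proof (rule graded_iso.intro)
  interpret A: cring A by (rule cring)
  interpret A': cring A' by (rule cring)
  show "cring A'" "cring A" by (rule cring)+
  show "k (x \<otimes>\<^bsub>A'\<^esub> y) = k x \<otimes>\<^bsub>A\<^esub> k y" if "x \<in> carrier A'" "y \<in> carrier A'" for x y
  proof -
    have "k (h (k x \<otimes>\<^bsub>A\<^esub> k y)) = k x \<otimes>\<^bsub>A\<^esub> k y"
      using that by (intro inverse(1)) (simp add: closed)
    then show ?thesis using that by (simp add: hom closed inverse)
  qed
  show "k (x \<oplus>\<^bsub>A'\<^esub> y) = k x \<oplus>\<^bsub>A\<^esub> k y" if "x \<in> carrier A'" "y \<in> carrier A'" for x y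
  proof -
    have "k (h (k x \<oplus>\<^bsub>A\<^esub> k y)) = k x \<oplus>\<^bsub>A\<^esub> k y"
      using that by (intro inverse(1)) (simp add: closed)
    then show ?thesis using that by (simp add: hom closed inverse)
  qed
  show "k \<one>\<^bsub>A'\<^esub> = \<one>\<^bsub>A\<^esub>" using hom(3) inverse(1)[OF A.one_closed] by simp
  show "grade A' d \<subseteq> carrier A'" for d
    unfolding grade[symmetric] by (intro image_subsetI closed(1) subsetD[OF grade_closed])
  show "k ` grade A' d = grade A d" for d
    unfolding grade[symmetric] by (rule image_left_inverse) (rule inverse(1)[OF subsetD[OF grade_closed]])
  show "scalar A' c \<in> carrier A'" for c
    unfolding scalar[symmetric] by (rule closed(1)[OF scalar_closed])
  show "k (scalar A' c) = scalar A c" for c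
    unfolding scalar[symmetric] by (rule inverse(1)[OF scalar_closed])
qed (simp_all add: closed inverse)

lemma ring_hom_ring: "ring_hom_ring A A' h"
  using cring closed hom by (intro ring_hom_ringI cring.axioms(1))

lemma inj: "inj_on h (carrier A)"
  using inverse by (metis inj_onI)

lemma image_carrier: "h ` carrier A = carrier A'"
  using closed inverse by (metis image_eqI subsetI image_subsetI equalityI)

lemma image_inverse: "S \<subseteq> carrier A \<Longrightarrow> k ` h ` S = S"
  by (rule image_left_inverse) (use inverse(1) in blast)

lemma mem_image: "x \<in> carrier A \<Longrightarrow> S \<subseteq> carrier A \<Longrightarrow> h x \<in> h ` S \<longleftrightarrow> x \<in> S"
  using inj by (simp add: inj_on_image_mem_iff)

lemma image_mono_iff: "S \<subseteq> carrier A \<Longrightarrow> T \<subseteq> carrier A \<Longrightarrow> h ` S \<subseteq> h ` T \<longleftrightarrow> S \<subseteq> T"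
  by (metis image_inverse image_mono)

lemma ideal_image:
  assumes "ideal I A"
  shows "ideal (h ` I) A'"
proof (rule idealI)
  interpret A: cring A by (rule cring)
  interpret A': cring A' by (rule cring)
  interpret H: ring_hom_ring A A' h by (rule ring_hom_ring)
  interpret ideal I A by fact
  show "ring A'" by (rule A'.ring_axioms)
  show "subgroup (h ` I) (add_monoid A')"
  proof (rule A'.add.subgroupI)
    show "h ` I \<subseteq> carrier A'" using a_subset closed by auto
    show "h ` I \<noteq> {}" using additive_subgroup.zero_closed[OF ideal.axioms(1)[OF assms]] by blast
    show "\<ominus>\<^bsub>A'\<^esub> a \<in> h ` I" if "a \<in> h ` I" for a
      using that a_inv_closed by (auto intro!: imageI simp: Icarr simp flip: H.hom_a_inv)
    show "a \<oplus>\<^bsub>A'\<^esub> b \<in> h ` I" if "a \<in> h ` I" "b \<in> h ` I" for a b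
      using that a_closed by (auto intro!: imageI simp: Icarr simp flip: hom(2))
  qed
  fix a x assume ax: "a \<in> h ` I" "x \<in> carrier A'"
  then obtain b where b: "b \<in> I" "a = h b" by auto
  have x: "x = h (k x)" "k x \<in> carrier A" using ax inverse closed by auto
  show "x \<otimes>\<^bsub>A'\<^esub> a \<in> h ` I"
    using b x I_l_closed[OF b(1) x(2)] hom(1)[OF x(2) Icarr[OF b(1)]] by (metis image_eqI)
  show "a \<otimes>\<^bsub>A'\<^esub> x \<in> h ` I"
    using b x I_r_closed[OF b(1) x(2)] hom(1)[OF Icarr[OF b(1)] x(2)] by (metis image_eqI)
qed

lemma genideal_closed: "S \<subseteq> carrier A \<Longrightarrow> genideal A S \<subseteq> carrier A"
  using ring.genideal_ideal[OF cring.axioms(1)[OF cring(1)]] by (metis additive_subgroup.a_subset ideal.axioms(1))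

lemma genideal_image_subset:
  assumes "S \<subseteq> carrier A"
  shows "genideal A' (h ` S) \<subseteq> h ` genideal A S"
proof -
  interpret A: cring A by (rule cring)
  interpret A': cring A' by (rule cring)
  show ?thesis
    using ideal_image[OF A.genideal_ideal[OF assms]] A.genideal_self[OF assms]
    by (intro A'.genideal_minimal image_mono)
qed

end

text \<open>
  An interpretation only provides what has been proved before it, so the block is reopened whenever
  new facts are needed for the inverse isomorphism.
\<close>

context graded_iso
begin

interpretation sym: graded_iso A' A k h by (rule symmetric)

lemma genideal_image:
  assumes S: "S \<subseteq> carrier A"
  shows "h ` genideal A S = genideal A' (h ` S)"
proof
  have S': "h ` S \<subseteq> carrier A'" using S closed by auto
  have "genideal A S \<subseteq> k ` genideal A' (h ` S)"
    using sym.genideal_image_subset[OF S'] image_inverse[OF S] by simp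
  then have "h ` genideal A S \<subseteq> h ` k ` genideal A' (h ` S)" by (rule image_mono)
  also have "\<dots> = genideal A' (h ` S)" by (rule sym.image_inverse[OF sym.genideal_closed[OF S']])
  finally show "h ` genideal A S \<subseteq> genideal A' (h ` S)" .
qed (rule genideal_image_subset[OF S])

lemma homogeneous_closed: "homogeneous_elements A \<subseteq> carrier A"
  using grade_closed by (auto simp: homogeneous_elements_def)

lemma homogeneous_image: "h ` homogeneous_elements A = homogeneous_elements A'"
  by (simp add: homogeneous_elements_def image_UN grade)

lemma irrelevant_image: "h ` irrelevant_ideal A = irrelevant_ideal A'"
proof -
  have "(\<Union>d\<in>{0<..}. grade A d) \<subseteq> carrier A" using grade_closed by blast
  then show ?thesis by (simp add: irrelevant_ideal_def genideal_image image_UN grade)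
qed

lemma irrelevant_closed: "irrelevant_ideal A \<subseteq> carrier A"
  unfolding irrelevant_ideal_def using grade_closed by (intro genideal_closed) blast

lemma ideal_closed: "ideal I A \<Longrightarrow> I \<subseteq> carrier A"
  by (metis additive_subgroup.a_subset ideal.axioms(1))

lemma homogeneous_ideal_image:
  assumes "homogeneous_ideal A I"
  shows "homogeneous_ideal A' (h ` I)"
proof -
  have I: "ideal I A" "I = genideal A (I \<inter> homogeneous_elements A)"
    using assms by (auto simp: homogeneous_ideal_def)
  have "h ` (I \<inter> homogeneous_elements A) = h ` I \<inter> homogeneous_elements A'"
    unfolding homogeneous_image[symmetric]
    using inj ideal_closed[OF I(1)] homogeneous_closed by (rule inj_on_image_Int)
  moreover have "h ` I = h ` genideal A (I \<inter> homogeneous_elements A)" using I(2) by simp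
  moreover have "I \<inter> homogeneous_elements A \<subseteq> carrier A" using homogeneous_closed by blast
  ultimately have "h ` I = genideal A' (h ` I \<inter> homogeneous_elements A')"
    using genideal_image by metis
  then show ?thesis using ideal_image[OF I(1)] by (simp add: homogeneous_ideal_def)
qed

lemma point_closed: "P \<in> proj_points A \<Longrightarrow> P \<subseteq> carrier A"
  by (auto simp: proj_points_def homogeneous_ideal_def dest: ideal_closed)

lemma point_image:
  assumes P: "P \<in> proj_points A"
  shows "h ` P \<in> proj_points A'"
proof -
  have prime: "primeideal P A" and hom_P: "homogeneous_ideal A P" and irr: "\<not> irrelevant_ideal A \<subseteq> P"
    using P by (auto simp: proj_points_def)
  interpret primeideal P A by fact
  have "primeideal (h ` P) A'"
  proof (rule primeidealI)
    show "ideal (h ` P) A'" by (rule ideal_image) (rule is_ideal)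
    show "cring A'" by (rule cring)
    show "carrier A' \<noteq> h ` P"
      using I_notcarr image_carrier inj a_subset by (metis inj_on_image_eq_iff order_refl)
    fix a b assume ab: "a \<in> carrier A'" "b \<in> carrier A'" "a \<otimes>\<^bsub>A'\<^esub> b \<in> h ` P"
    then have "h (k a \<otimes>\<^bsub>A\<^esub> k b) \<in> h ` P" using closed inverse hom(1) by simp
    then have "k a \<otimes>\<^bsub>A\<^esub> k b \<in> P" using ab closed a_subset by (subst (asm) mem_image) auto
    then have "k a \<in> P \<or> k b \<in> P" using ab closed by (intro I_prime)
    then show "a \<in> h ` P \<or> b \<in> h ` P" using ab inverse by (metis image_eqI)
  qed
  moreover have "\<not> irrelevant_ideal A' \<subseteq> h ` P"
    using irr image_mono_iff[OF irrelevant_closed a_subset] by (simp add: irrelevant_image)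
  ultimately show ?thesis using homogeneous_ideal_image[OF hom_P] by (simp add: proj_points_def)
qed

lemma point_inverse: "P \<in> proj_points A \<Longrightarrow> k ` h ` P = P"
  by (simp add: image_inverse point_closed)

lemma points_image_inverse: "U \<subseteq> proj_points A \<Longrightarrow> (`) k ` (`) h ` U = U"
  by (rule image_left_inverse) (use point_inverse in blast)

lemma inj_points: "inj_on ((`) h) (proj_points A)"
  using point_inverse by (metis inj_onI)

lemma fraction_closed: "fraction A P a f \<subseteq> carrier A \<times> carrier A"
  using grade_closed by (fastforce simp: fraction_def)

end

context graded_iso
begin

interpretation sym: graded_iso A' A k h by (rule symmetric)

lemma points_image: "(`) h ` proj_points A = proj_points A'"
proof
  show "proj_points A' \<subseteq> (`) h ` proj_points A"
  proof
    fix P assume "P \<in> proj_points A'"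
    then show "P \<in> (`) h ` proj_points A"
      using sym.point_image sym.point_inverse by (intro image_eqI[of _ _ "k ` P"]) simp_all
  qed
qed (use point_image in blast)

lemma openin_subset_points: "openin (proj_topology A) U \<Longrightarrow> U \<subseteq> proj_points A"
  unfolding proj_topology_def openin_topology_generated_by_iff
  by (induction rule: generate_topology_on.induct) auto

lemma openin_image:
  assumes "openin (proj_topology A) U"
  shows "openin (proj_topology A') ((`) h ` U)"
proof -
  have "generate_topology_on {{P \<in> proj_points A. \<not> I \<subseteq> P} | I. homogeneous_ideal A I} U"
    using assms by (simp add: proj_topology_def openin_topology_generated_by_iff)
  then have "U \<subseteq> proj_points A \<and> openin (proj_topology A') ((`) h ` U)"
  proof (induction rule: generate_topology_on.induct)
    case (Int a b)
    then have "(`) h ` (a \<inter> b) = (`) h ` a \<inter> (`) h ` b"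
      using inj_on_image_Int[OF inj_points] by simp
    with Int show ?case by (auto simp: openin_Int)
  next
    case (UN K)
    have "(`) h ` \<Union>K = \<Union>((`) ((`) h) ` K)" by auto
    with UN show ?case by (auto intro!: openin_Union)
  next
    case (Basis s)
    then obtain I where I: "homogeneous_ideal A I" "s = {P \<in> proj_points A. \<not> I \<subseteq> P}" by auto
    have "I \<subseteq> carrier A" using I(1) by (auto simp: homogeneous_ideal_def dest: ideal_closed)
    then have "h ` I \<subseteq> h ` P \<longleftrightarrow> I \<subseteq> P" if "P \<in> proj_points A" for P
      by (rule image_mono_iff[OF _ point_closed[OF that]])
    then have "s = {P \<in> proj_points A. \<not> h ` I \<subseteq> h ` P}"
      unfolding I(2) by (intro Collect_cong conj_cong refl) simp
    moreover have "f ` {P \<in> S. Q (f P)} = {P \<in> f ` S. Q P}"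
      for f :: "'a set \<Rightarrow> 'b set" and S Q by blast
    ultimately have "(`) h ` s = {P \<in> (`) h ` proj_points A. \<not> h ` I \<subseteq> P}" by (simp only:)
    then have "(`) h ` s = {P \<in> proj_points A'. \<not> h ` I \<subseteq> P}" by (simp only: points_image)
    then have "openin (proj_topology A') ((`) h ` s)"
      using homogeneous_ideal_image[OF I(1)]
      by (auto simp: proj_topology_def intro!: topology_generated_by_Basis)
    then show ?case using I(2) by auto
  qed auto
  then show ?thesis ..
qed

lemma fraction_image:
  assumes P: "P \<subseteq> carrier A" and a: "a \<in> carrier A" and f: "f \<in> carrier A"
  shows "map_prod h h ` fraction A P a f = fraction A' (h ` P) (h a) (h f)"
proof -
  interpret A: cring A by (rule cring)
  interpret A': cring A' by (rule cring)
  interpret H: ring_hom_cring A A' h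
    using ring_hom_ring by (intro ring_hom_cring.intro A.is_cring A'.is_cring ring_hom_cring_axioms.intro)
      (simp add: ring_hom_ring_def ring_hom_ring_axioms_def)
  have key: "(h b, h g) \<in> fraction A' (h ` P) (h a) (h f) \<longleftrightarrow> (b, g) \<in> fraction A P a f"
    if b: "b \<in> carrier A" and g: "g \<in> carrier A" for b g
  proof -
    have gr: "h x \<in> grade A' d \<longleftrightarrow> x \<in> grade A d" if "x \<in> carrier A" for x d
      using mem_image[OF that grade_closed] by (simp add: grade)
    have zero: "h t \<otimes>\<^bsub>A'\<^esub> (h a \<otimes>\<^bsub>A'\<^esub> h g \<ominus>\<^bsub>A'\<^esub> h b \<otimes>\<^bsub>A'\<^esub> h f) = \<zero>\<^bsub>A'\<^esub>
      \<longleftrightarrow> t \<otimes>\<^bsub>A\<^esub> (a \<otimes>\<^bsub>A\<^esub> g \<ominus>\<^bsub>A\<^esub> b \<otimes>\<^bsub>A\<^esub> f) = \<zero>\<^bsub>A\<^esub>" if t: "t \<in> carrier A" for t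
    proof -
      let ?x = "t \<otimes>\<^bsub>A\<^esub> (a \<otimes>\<^bsub>A\<^esub> g \<ominus>\<^bsub>A\<^esub> b \<otimes>\<^bsub>A\<^esub> f)"
      have "h ?x = h t \<otimes>\<^bsub>A'\<^esub> (h a \<otimes>\<^bsub>A'\<^esub> h g \<ominus>\<^bsub>A'\<^esub> h b \<otimes>\<^bsub>A'\<^esub> h f)"
        using t a b f g by (simp add: A.minus_eq A'.minus_eq)
      moreover have "h ?x = h \<zero>\<^bsub>A\<^esub> \<longleftrightarrow> ?x = \<zero>\<^bsub>A\<^esub>"
        using t a b f g by (intro inj_on_eq_iff[OF inj]) auto
      ultimately show ?thesis by simp
    qed
    have tt: "h ` (homogeneous_elements A - P) = homogeneous_elements A' - h ` P"
      unfolding homogeneous_image[symmetric]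
      using homogeneous_closed P by (intro inj_on_image_set_diff[OF inj]) auto
    have "(\<exists>t \<in> homogeneous_elements A' - h ` P.
        t \<otimes>\<^bsub>A'\<^esub> (h a \<otimes>\<^bsub>A'\<^esub> h g \<ominus>\<^bsub>A'\<^esub> h b \<otimes>\<^bsub>A'\<^esub> h f) = \<zero>\<^bsub>A'\<^esub>)
      \<longleftrightarrow> (\<exists>t \<in> homogeneous_elements A - P. t \<otimes>\<^bsub>A\<^esub> (a \<otimes>\<^bsub>A\<^esub> g \<ominus>\<^bsub>A\<^esub> b \<otimes>\<^bsub>A\<^esub> f) = \<zero>\<^bsub>A\<^esub>)"
      unfolding tt[symmetric] using zero homogeneous_closed by auto
    then show ?thesis
      using b g by (simp add: fraction_def gr mem_image[OF g P])
  qed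
  show ?thesis
  proof (intro equalityI subsetI)
    fix z assume "z \<in> map_prod h h ` fraction A P a f"
    then obtain b g where z: "z = (h b, h g)" "(b, g) \<in> fraction A P a f" by auto
    moreover have "b \<in> carrier A" "g \<in> carrier A" using z fraction_closed[of P a f] by auto
    ultimately show "z \<in> fraction A' (h ` P) (h a) (h f)" using key by simp
  next
    fix z assume z: "z \<in> fraction A' (h ` P) (h a) (h f)"
    obtain b' g' where [simp]: "z = (b', g')" by (cases z)
    have c: "b' \<in> carrier A'" "g' \<in> carrier A'" using z sym.fraction_closed[of "h ` P" "h a" "h f"] by auto
    then have "(k b', k g') \<in> fraction A P a f" using key[of "k b'" "k g'"] z by (simp add: closed inverse)
    then show "z \<in> map_prod h h ` fraction A P a f"
      by (rule image_eqI[rotated]) (simp add: c inverse)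
  qed
qed

lemma map_prod_inverse: "S \<subseteq> carrier A \<times> carrier A \<Longrightarrow> map_prod k k ` map_prod h h ` S = S"
  by (rule image_left_inverse) (use inverse(1) in auto)

lemma localization_closed:
  "S \<in> carrier (homogeneous_localization A P) \<Longrightarrow> S \<subseteq> carrier A \<times> carrier A"
  using fraction_closed by (fastforce simp: homogeneous_localization_def)

lemma localization_image:
  assumes P: "P \<subseteq> carrier A" and S: "S \<in> carrier (homogeneous_localization A P)"
  shows "map_prod h h ` S \<in> carrier (homogeneous_localization A' (h ` P))"
proof -
  obtain a f d where "S = fraction A P a f" "a \<in> grade A d" "f \<in> grade A d" "f \<notin> P"
    using S by (auto simp: homogeneous_localization_def)
  moreover from this have "a \<in> carrier A" "f \<in> carrier A" using grade_closed by auto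
  ultimately have "map_prod h h ` S = fraction A' (h ` P) (h a) (h f)"
    "h a \<in> grade A' d" "h f \<in> grade A' d" "h f \<notin> h ` P"
    using P by (auto simp: fraction_image mem_image simp flip: grade)
  then show ?thesis by (auto simp: homogeneous_localization_def)
qed

lemma localization_mult_image:
  assumes P: "P \<subseteq> carrier A" and S: "S \<subseteq> carrier A \<times> carrier A" "T \<subseteq> carrier A \<times> carrier A"
  shows "map_prod h h ` (S \<otimes>\<^bsub>homogeneous_localization A P\<^esub> T)
    = map_prod h h ` S \<otimes>\<^bsub>homogeneous_localization A' (h ` P)\<^esub> map_prod h h ` T"
proof -
  interpret A: cring A by (rule cring)
  have "(\<Union>y\<in>T. map_prod h h ` fraction A P (fst x \<otimes>\<^bsub>A\<^esub> fst y) (snd x \<otimes>\<^bsub>A\<^esub> snd y))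
      = (\<Union>y\<in>T. fraction A' (h ` P) (h (fst x) \<otimes>\<^bsub>A'\<^esub> h (fst y)) (h (snd x) \<otimes>\<^bsub>A'\<^esub> h (snd y)))"
    (is "(\<Union>y\<in>T. ?F y) = (\<Union>y\<in>T. ?G y)")
    if "x \<in> S" for x
  proof (intro SUP_cong refl)
    fix y assume "y \<in> T"
    then have "fst x \<in> carrier A" "snd x \<in> carrier A" "fst y \<in> carrier A" "snd y \<in> carrier A"
      using that S by (auto simp: mem_Times_iff)
    then show "?F y = ?G y" by (simp add: fraction_image P hom)
  qed
  then show ?thesis
    by (simp add: homogeneous_localization_def split_def image_UN cong: SUP_cong_simp)
qed

lemma localization_add_image:
  assumes P: "P \<subseteq> carrier A" and S: "S \<subseteq> carrier A \<times> carrier A" "T \<subseteq> carrier A \<times> carrier A"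
  shows "map_prod h h ` (S \<oplus>\<^bsub>homogeneous_localization A P\<^esub> T)
    = map_prod h h ` S \<oplus>\<^bsub>homogeneous_localization A' (h ` P)\<^esub> map_prod h h ` T"
proof -
  interpret A: cring A by (rule cring)
  have "(\<Union>y\<in>T. map_prod h h ` fraction A P (fst x \<otimes>\<^bsub>A\<^esub> snd y \<oplus>\<^bsub>A\<^esub> fst y \<otimes>\<^bsub>A\<^esub> snd x) (snd x \<otimes>\<^bsub>A\<^esub> snd y))
      = (\<Union>y\<in>T. fraction A' (h ` P) (h (fst x) \<otimes>\<^bsub>A'\<^esub> h (snd y) \<oplus>\<^bsub>A'\<^esub> h (fst y) \<otimes>\<^bsub>A'\<^esub> h (snd x))
          (h (snd x) \<otimes>\<^bsub>A'\<^esub> h (snd y)))"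
    (is "(\<Union>y\<in>T. ?F y) = (\<Union>y\<in>T. ?G y)")
    if "x \<in> S" for x
  proof (intro SUP_cong refl)
    fix y assume "y \<in> T"
    then have "fst x \<in> carrier A" "snd x \<in> carrier A" "fst y \<in> carrier A" "snd y \<in> carrier A"
      using that S by (auto simp: mem_Times_iff)
    then show "?F y = ?G y" by (simp add: fraction_image P hom)
  qed
  then show ?thesis
    by (simp add: homogeneous_localization_def split_def image_UN cong: SUP_cong_simp)
qed

definition transport :: "'a set set \<Rightarrow> ('a set \<Rightarrow> ('a \<times> 'a) set) \<Rightarrow> 'b set \<Rightarrow> ('b \<times> 'b) set" where
  "transport U s = (\<lambda>P'\<in>(`) h ` U. map_prod h h ` s (k ` P'))"

lemma transport_apply:
  "U \<subseteq> proj_points A \<Longrightarrow> P \<in> U \<Longrightarrow> transport U s (h ` P) = map_prod h h ` s P"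
  using point_inverse by (auto simp: transport_def subset_iff)

lemma transport_closed:
  assumes U: "openin (proj_topology A) U" and s: "s \<in> carrier (proj_sections A U)"
  shows "transport U s \<in> carrier (proj_sections A' ((`) h ` U))"
proof -
  have UP: "U \<subseteq> proj_points A" by (rule openin_subset_points[OF U])
  note tr = transport_apply[OF UP]
  have s1: "s P \<in> carrier (homogeneous_localization A P)" if "P \<in> U" for P
    using s that by (auto simp: proj_sections_def)
  have "transport U s \<in> (\<Pi>\<^sub>E P\<in>(`) h ` U. carrier (homogeneous_localization A' P))"
  proof (rule PiE_I)
    fix P' assume "P' \<in> (`) h ` U"
    then obtain P where P: "P \<in> U" "P' = h ` P" by auto
    then show "transport U s P' \<in> carrier (homogeneous_localization A' P')"
      using localization_image[OF point_closed s1[OF P(1)]] UP by (auto simp: tr)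
  qed (auto simp: transport_def)
  moreover have "\<exists>W. openin (proj_topology A') W \<and> P' \<in> W \<and> W \<subseteq> (`) h ` U \<and>
      (\<exists>d. \<exists>a \<in> grade A' d. \<exists>f \<in> grade A' d. \<forall>Q\<in>W. f \<notin> Q \<and> transport U s Q = fraction A' Q a f)"
    if P': "P' \<in> (`) h ` U" for P'
  proof -
    obtain P where P: "P \<in> U" "P' = h ` P" using P' by auto
    have "\<exists>W. openin (proj_topology A) W \<and> P \<in> W \<and> W \<subseteq> U \<and>
      (\<exists>d. \<exists>a \<in> grade A d. \<exists>f \<in> grade A d. \<forall>Q\<in>W. f \<notin> Q \<and> s Q = fraction A Q a f)"
      using s P(1) by (simp add: proj_sections_def)
    then obtain W where W': "openin (proj_topology A) W \<and> P \<in> W \<and> W \<subseteq> U \<and>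
      (\<exists>d. \<exists>a \<in> grade A d. \<exists>f \<in> grade A d. \<forall>Q\<in>W. f \<notin> Q \<and> s Q = fraction A Q a f)" by (rule exE)
    note W = W'[THEN conjunct1] W'[THEN conjunct2, THEN conjunct1] W'[THEN conjunct2, THEN conjunct2, THEN conjunct1]
    note ex = W'[THEN conjunct2, THEN conjunct2, THEN conjunct2]
    obtain d a f where af: "a \<in> grade A d" "f \<in> grade A d"
      and sW: "\<And>Q. Q \<in> W \<Longrightarrow> f \<notin> Q \<and> s Q = fraction A Q a f"
      using ex by metis
    have afc: "a \<in> carrier A" "f \<in> carrier A" using af grade_closed by auto
    show ?thesis
    proof (intro exI conjI)
      show "openin (proj_topology A') ((`) h ` W)" by (rule openin_image[OF W(1)])
      show "P' \<in> (`) h ` W" "(`) h ` W \<subseteq> (`) h ` U" using W P by auto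
      show "\<exists>a \<in> grade A' d. \<exists>f \<in> grade A' d. \<forall>Q\<in>(`) h ` W. f \<notin> Q \<and> transport U s Q = fraction A' Q a f"
      proof (rule bexI[of _ "h a"], rule bexI[of _ "h f"], rule ballI)
        show "h a \<in> grade A' d" "h f \<in> grade A' d" using af grade by blast+
        fix Q' assume "Q' \<in> (`) h ` W"
        then obtain Q where Q: "Q \<in> W" "Q' = h ` Q" by auto
        have Qc: "Q \<subseteq> carrier A" using Q W UP point_closed by blast
        show "h f \<notin> Q' \<and> transport U s Q' = fraction A' Q' (h a) (h f)"
          using sW[OF Q(1)] Q W tr[of Q s] afc Qc by (auto simp: fraction_image mem_image)
      qed
    qed
  qed
  ultimately show ?thesis unfolding proj_sections_def by simp
qed

end

context graded_iso
begin

interpretation sym: graded_iso A' A k h by (rule symmetric)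

lemma transport_inverse:
  assumes U: "openin (proj_topology A) U" and s: "s \<in> carrier (proj_sections A U)"
  shows "sym.transport ((`) h ` U) (transport U s) = s"
proof (rule ext)
  have UP: "U \<subseteq> proj_points A" by (rule openin_subset_points[OF U])
  have sE: "s \<in> (\<Pi>\<^sub>E P\<in>U. carrier (homogeneous_localization A P))" using s by (simp add: proj_sections_def)
  fix P
  show "sym.transport ((`) h ` U) (transport U s) P = s P"
  proof (cases "P \<in> U")
    case True
    then have "s P \<subseteq> carrier A \<times> carrier A" using localization_closed sE by blast
    then show ?thesis using True UP
      by (simp add: sym.transport_def points_image_inverse transport_apply map_prod_inverse)
  next
    case False
    then show ?thesis using sE UP by (auto simp: sym.transport_def points_image_inverse PiE_def extensional_def)
  qed
qed

end

context graded_iso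
begin

interpretation sym: graded_iso A' A k h by (rule symmetric)

lemma transport_ring_iso:
  assumes U: "openin (proj_topology A) U"
  shows "transport U \<in> ring_iso (proj_sections A U) (proj_sections A' ((`) h ` U))"
proof -
  interpret A: cring A by (rule cring)
  have UP: "U \<subseteq> proj_points A" by (rule openin_subset_points[OF U])
  have UPc: "P \<subseteq> carrier A" if "P \<in> U" for P using UP that point_closed by blast
  have sc: "s P \<subseteq> carrier A \<times> carrier A" if "s \<in> carrier (proj_sections A U)" "P \<in> U" for s P
    using that localization_closed by (fastforce simp: proj_sections_def)
  have ext: "(\<lambda>P'\<in>(`) h ` U. F P') = (\<lambda>P'\<in>(`) h ` U. G P')" if "\<And>P. P \<in> U \<Longrightarrow> F (h ` P) = G (h ` P)"
    for F G :: "'b set \<Rightarrow> ('b \<times> 'b) set"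
    using that by (auto intro!: restrict_ext)
  have kh: "k ` h ` P = P" if "P \<in> U" for P using that UP point_inverse by blast
  have "transport U \<in> Ring.ring_hom (proj_sections A U) (proj_sections A' ((`) h ` U))"
  proof (rule ring_hom_memI)
    fix s t assume s: "s \<in> carrier (proj_sections A U)"
    then show "transport U s \<in> carrier (proj_sections A' ((`) h ` U))" by (rule transport_closed[OF U])
    assume t: "t \<in> carrier (proj_sections A U)"
    show "transport U (s \<otimes>\<^bsub>proj_sections A U\<^esub> t)
      = transport U s \<otimes>\<^bsub>proj_sections A' ((`) h ` U)\<^esub> transport U t"
      unfolding proj_sections_def monoid.simps transport_def[of _ "restrict _ _"]
      by (rule ext) (simp add: kh transport_apply[OF UP] localization_mult_image[OF UPc sc[OF s] sc[OF t]])
    show "transport U (s \<oplus>\<^bsub>proj_sections A U\<^esub> t)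
      = transport U s \<oplus>\<^bsub>proj_sections A' ((`) h ` U)\<^esub> transport U t"
      unfolding proj_sections_def ring.simps transport_def[of _ "restrict _ _"]
      by (rule ext) (simp add: kh transport_apply[OF UP] localization_add_image[OF UPc sc[OF s] sc[OF t]])
  next
    show "transport U \<one>\<^bsub>proj_sections A U\<^esub> = \<one>\<^bsub>proj_sections A' ((`) h ` U)\<^esub>"
      unfolding proj_sections_def monoid.simps transport_def[of _ "restrict _ _"]
      by (rule ext) (simp add: kh homogeneous_localization_def fraction_image[OF UPc] hom(3))
  qed
  moreover have "bij_betw (transport U) (carrier (proj_sections A U)) (carrier (proj_sections A' ((`) h ` U)))"
  proof (rule bij_betwI)
    show "transport U \<in> carrier (proj_sections A U) \<rightarrow> carrier (proj_sections A' ((`) h ` U))"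
      using transport_closed[OF U] by auto
    show "sym.transport ((`) h ` U) \<in> carrier (proj_sections A' ((`) h ` U)) \<rightarrow> carrier (proj_sections A U)"
      using sym.transport_closed[OF openin_image[OF U]] by (simp add: points_image_inverse[OF UP])
    show "sym.transport ((`) h ` U) (transport U s) = s" if "s \<in> carrier (proj_sections A U)" for s
      using transport_inverse[OF U that] .
    show "transport U (sym.transport ((`) h ` U) s) = s" if "s \<in> carrier (proj_sections A' ((`) h ` U))" for s
      using sym.transport_inverse[OF openin_image[OF U] that]
      by (simp add: points_image_inverse[OF UP] transport_def)
  qed
  ultimately show ?thesis by (simp add: ring_iso_def)
qed

lemma topspace_proj: "topspace (proj_topology A) \<subseteq> proj_points A"
  using openin_subset_points openin_topspace by blast

lemma topspace_image: "(`) h ` topspace (proj_topology A) = topspace (proj_topology A')"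
proof
  show "(`) h ` topspace (proj_topology A) \<subseteq> topspace (proj_topology A')"
    using openin_image[OF openin_topspace] by (rule openin_subset)
  have "(`) k ` topspace (proj_topology A') \<subseteq> topspace (proj_topology A)"
    using sym.openin_image[OF openin_topspace] by (rule openin_subset)
  then have "(`) h ` (`) k ` topspace (proj_topology A') \<subseteq> (`) h ` topspace (proj_topology A)"
    by (rule image_mono)
  then show "topspace (proj_topology A') \<subseteq> (`) h ` topspace (proj_topology A)"
    using sym.points_image_inverse[OF sym.openin_subset_points[OF openin_topspace]] by simp
qed

end

context graded_iso
begin

interpretation sym: graded_iso A' A k h by (rule symmetric)

theorem Proj_isomorphic: "isomorphic_over_complex (Proj A) (Proj A')"
proof -
  let ?X = "proj_topology A" and ?Y = "proj_topology A'"
  have pre: "{P \<in> topspace ?X. h ` P \<in> U} = (`) k ` U" if U: "openin ?Y U" for U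
  proof -
    have UY: "U \<subseteq> proj_points A'" by (rule sym.openin_subset_points[OF U])
    have "(`) k ` U \<subseteq> topspace ?X" using sym.openin_image[OF U] by (rule openin_subset)
    moreover have "h ` k ` P = P" if "P \<in> U" for P using that UY sym.point_inverse by blast
    moreover have "k ` h ` P = P" if "P \<in> topspace ?X" for P using that topspace_proj point_inverse by blast
    ultimately show ?thesis by (auto simp: image_iff) (metis)
  qed
  have homeo: "homeomorphic_map ?X ?Y ((`) h)"
  proof (rule bijective_open_imp_homeomorphic_map)
    show "continuous_map ?X ?Y ((`) h)"
      using topspace_image sym.openin_image by (auto simp: continuous_map_def pre)
    show "open_map ?X ?Y ((`) h)" by (simp add: open_map_def openin_image)
    show "(`) h ` topspace ?X = topspace ?Y" by (rule topspace_image)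
    show "inj_on ((`) h) (topspace ?X)" using inj_points topspace_proj by (rule inj_on_subset)
  qed
  have const: "sym.transport U (\<lambda>P\<in>U. fraction A' P (scalar A' c) \<one>\<^bsub>A'\<^esub>)
      = (\<lambda>P\<in>(`) k ` U. fraction A P (scalar A c) \<one>\<^bsub>A\<^esub>)" if U: "openin ?Y U" for U c
  proof -
    have UY: "U \<subseteq> proj_points A'" by (rule sym.openin_subset_points[OF U])
    show ?thesis unfolding sym.transport_def
    proof (rule restrict_ext)
      fix P' assume "P' \<in> (`) k ` U"
      then obtain P where P: "P \<in> U" "P' = k ` P" by auto
      then have PP: "h ` P' = P" "P \<subseteq> carrier A'" using UY sym.point_inverse sym.point_closed by blast+
      interpret A': cring A' by (rule cring)
      show "map_prod k k ` (\<lambda>P\<in>U. fraction A' P (scalar A' c) \<one>\<^bsub>A'\<^esub>) (h ` P') = fraction A P' (scalar A c) \<one>\<^bsub>A\<^esub>"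
        using P PP sym.fraction_image[OF PP(2) sym.scalar_closed A'.one_closed] by (simp add: sym.scalar sym.hom(3))
    qed
  qed
  have restr: "restrict (sym.transport U s) ((`) k ` W) = sym.transport W (restrict s W)"
    if U: "openin ?Y U" and "W \<subseteq> U" for U W s
  proof -
    have UY: "U \<subseteq> proj_points A'" by (rule sym.openin_subset_points[OF U])
    have hk: "h ` k ` P = P" if "P \<in> W" for P using that \<open>W \<subseteq> U\<close> UY sym.point_inverse by blast
    show ?thesis unfolding sym.transport_def using hk \<open>W \<subseteq> U\<close> by (intro ext) (auto simp: restrict_def)
  qed
  show ?thesis
    unfolding isomorphic_over_complex_def Let_def
    using homeo sym.transport_ring_iso const restr
    by (intro exI[of _ "(`) h"] exI[of _ sym.transport]) (simp add: Proj_def pre)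
qed

end

section \<open>Weights of polynomials in the entries of a symmetric matrix\<close>

definition torus_weight :: "(nat \<times> nat \<Rightarrow>\<^sub>0 nat) \<Rightarrow> nat \<Rightarrow> nat" where
  "torus_weight a i = (\<Sum>k\<in>keys a. lookup a k * ((if fst k = i then 1 else 0) + (if snd k = i then 1 else 0)))"

definition torus_char :: "(nat \<Rightarrow> complex) \<Rightarrow> (nat \<times> nat \<Rightarrow>\<^sub>0 nat) \<Rightarrow> complex" where
  "torus_char z a = (\<Prod>k\<in>keys a. (z (fst k) * z (snd k)) ^ lookup a k)"

lemma torus_weight_superset:
  assumes "finite T" "keys a \<subseteq> T"
  shows "torus_weight a i = (\<Sum>k\<in>T. lookup a k * ((if fst k = i then 1 else 0) + (if snd k = i then 1 else 0)))"
  unfolding torus_weight_def using assms by (intro sum.mono_neutral_left) (auto simp: in_keys_iff)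

lemma torus_weight_add: "torus_weight (a + b) i = torus_weight a i + torus_weight b i"
  by (subst (1 2 3) torus_weight_superset[of "keys a \<union> keys b"])
    (simp_all add: keys_add_nat lookup_add distrib_right sum.distrib)

lemma torus_weight_single:
  "torus_weight (single k 1) i = (if fst k = i then 1 else 0) + (if snd k = i then 1 else 0)"
  by (simp add: torus_weight_def)

lemma torus_char_eq:
  assumes "keys a \<subseteq> upper m"
  shows "torus_char z a = (\<Prod>i<m. z i ^ torus_weight a i)"
proof -
  have e: "(\<Prod>i<m. z i ^ (if j = i then 1 else 0 :: nat)) = z j" if "j < m" for j
  proof -
    have "(\<Prod>i<m. z i ^ (if j = i then 1 else 0 :: nat)) = (\<Prod>i<m. if i = j then z j else 1)"
      by (intro prod.cong) auto
    then show ?thesis using that by simp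
  qed
  have "(\<Prod>i<m. z i ^ torus_weight a i) = (\<Prod>k\<in>keys a. \<Prod>i<m.
      (z i ^ (if fst k = i then 1 else 0 :: nat) * z i ^ (if snd k = i then 1 else 0 :: nat)) ^ lookup a k)"
  proof -
    have "z i ^ (l * (x + y)) = (z i ^ x * z i ^ y) ^ l" for i l and x y :: nat
      by (simp only: mult.commute[of l] power_mult power_add)
    then show ?thesis unfolding torus_weight_def power_sum by (subst prod.swap) (simp only:)
  qed
  also have "\<dots> = (\<Prod>k\<in>keys a. (z (fst k) * z (snd k)) ^ lookup a k)"
  proof (intro prod.cong refl)
    fix k assume "k \<in> keys a"
    then have "fst k < m" "snd k < m" using assms by auto
    then show "(\<Prod>i<m. (z i ^ (if fst k = i then 1 else 0 :: nat) * z i ^ (if snd k = i then 1 else 0 :: nat)) ^ lookup a k)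
        = (z (fst k) * z (snd k)) ^ lookup a k"
      by (simp only: prod_power_distrib[symmetric] prod.distrib e)
  qed
  finally show ?thesis by (simp add: torus_char_def)
qed

lemma lookup_scale_entries: "lookup (scale_entries z p) a = torus_char z a * lookup p a"
proof -
  have "lookup (scale_entries z p) a = (\<Sum>b\<in>keys p. if b = a then torus_char z a * lookup p a else 0)"
    unfolding scale_entries_def lookup_sum
    by (intro sum.cong refl) (auto simp: lookup_single when_def torus_char_def split_def)
  then show ?thesis by (simp add: in_keys_iff)
qed

lemma grade_sym_invariants:
  "grade (sym_invariants m) d = {p \<in> sym_polys m. \<forall>a\<in>keys p. \<forall>i<m. torus_weight a i = d}"
proof (intro equalityI subsetI)
  fix p assume "p \<in> grade (sym_invariants m) d"
  then have p: "p \<in> sym_polys m" and eq: "\<And>z. (\<forall>i<m. z i \<noteq> 0) \<Longrightarrow> scale_entries z p = cst ((\<Prod>i<m. z i) ^ d) * p"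
    by (auto simp: sym_invariants_def)
  have "torus_weight a i = d" if a: "a \<in> keys p" and i: "i < m" for a i
  proof -
    define z where "z = (\<lambda>j. if j = i then 2 else 1 :: complex)"
    have "keys a \<subseteq> upper m" using p a by (auto simp: sym_polys_def)
    then have "torus_char z a = (\<Prod>j<m. z j ^ torus_weight a j)" by (rule torus_char_eq)
    also have "\<dots> = (\<Prod>j<m. if j = i then 2 ^ torus_weight a i else 1)"
      by (intro prod.cong refl) (auto simp: z_def)
    finally have "torus_char z a = 2 ^ torus_weight a i" using i by simp
    moreover have "(\<Prod>j<m. z j) = 2" using i by (simp add: z_def)
    moreover have "lookup (scale_entries z p) a = lookup (cst ((\<Prod>i<m. z i) ^ d) * p) a"
      using eq[of z] by (simp add: z_def)
    ultimately have "(2 :: complex) ^ torus_weight a i = 2 ^ d"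
      using a by (simp add: lookup_scale_entries in_keys_iff)
    then have "cmod (2 ^ torus_weight a i) = cmod (2 ^ d)" by simp
    then show ?thesis by (simp add: norm_power)
  qed
  with p show "p \<in> {p \<in> sym_polys m. \<forall>a\<in>keys p. \<forall>i<m. torus_weight a i = d}" by auto
next
  fix p assume p: "p \<in> {p \<in> sym_polys m. \<forall>a\<in>keys p. \<forall>i<m. torus_weight a i = d}"
  have "scale_entries z p = cst ((\<Prod>i<m. z i) ^ d) * p" for z
  proof (rule poly_mapping_eqI)
    fix a
    have "torus_char z a = (\<Prod>i<m. z i) ^ d" if "a \<in> keys p"
    proof -
      have "keys a \<subseteq> upper m" using p that by (auto simp: sym_polys_def)
      from torus_char_eq[OF this, of z] show ?thesis using p that by (simp add: prod_power_distrib)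
    qed
    then show "lookup (scale_entries z p) a = lookup (cst ((\<Prod>i<m. z i) ^ d) * p) a"
      by (cases "a \<in> keys p") (auto simp: lookup_scale_entries in_keys_iff)
  qed
  with p show "p \<in> grade (sym_invariants m) d" by (simp add: sym_invariants_def)
qed

lemma carrier_sym_invariants:
  "carrier (sym_invariants m) = {p \<in> sym_polys m. \<forall>a\<in>keys p. \<exists>d. \<forall>i<m. torus_weight a i = d}"
proof (intro equalityI subsetI)
  fix p assume "p \<in> carrier (sym_invariants m)"
  then have p: "p \<in> sym_polys m"
    and eq: "\<And>z. (\<forall>i<m. z i \<noteq> 0) \<Longrightarrow> (\<Prod>i<m. z i) = 1 \<Longrightarrow> scale_entries z p = p"
    by (auto simp: sym_invariants_def)
  have "torus_weight a i = torus_weight a j" if a: "a \<in> keys p" and ij: "i < m" "j < m" for a i j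
  proof (cases "i = j")
    case False
    define z where "z = (\<lambda>l. (if l = i then 2 else 1 :: complex) * (if l = j then inverse 2 else 1))"
    have "keys a \<subseteq> upper m" using p a by (auto simp: sym_polys_def)
    then have "torus_char z a = (\<Prod>l<m. z l ^ torus_weight a l)" by (rule torus_char_eq)
    also have "\<dots> = (\<Prod>l<m. (if l = i then 2 ^ torus_weight a i else 1)
        * (if l = j then inverse 2 ^ torus_weight a j else 1))"
      using False by (intro prod.cong refl) (auto simp: z_def)
    also have "\<dots> = 2 ^ torus_weight a i * inverse 2 ^ torus_weight a j"
      using ij by (simp add: prod.distrib)
    finally have c: "torus_char z a = 2 ^ torus_weight a i * inverse 2 ^ torus_weight a j" .
    have "(\<Prod>l<m. z l) = 1" using ij by (simp add: z_def prod.distrib)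
    then have "lookup (scale_entries z p) a = lookup p a"
      using eq[of z] by (simp add: z_def)
    then have "(2 :: complex) ^ torus_weight a i * inverse 2 ^ torus_weight a j = 1"
      using a by (simp add: lookup_scale_entries in_keys_iff c)
    then have "(2 :: complex) ^ torus_weight a i = 2 ^ torus_weight a j"
      by (simp add: power_inverse field_simps)
    then have "cmod (2 ^ torus_weight a i) = cmod (2 ^ torus_weight a j)" by simp
    then show ?thesis by (simp add: norm_power)
  qed simp
  then have "\<exists>d. \<forall>i<m. torus_weight a i = d" if "a \<in> keys p" for a using that by metis
  with p show "p \<in> {p \<in> sym_polys m. \<forall>a\<in>keys p. \<exists>d. \<forall>i<m. torus_weight a i = d}" by auto
next
  fix p assume p: "p \<in> {p \<in> sym_polys m. \<forall>a\<in>keys p. \<exists>d. \<forall>i<m. torus_weight a i = d}"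
  have "scale_entries z p = p" if z: "(\<Prod>i<m. z i) = 1" for z
  proof (rule poly_mapping_eqI)
    fix a
    have "torus_char z a = 1" if "a \<in> keys p"
    proof -
      have "keys a \<subseteq> upper m" using p that by (auto simp: sym_polys_def)
      then have "torus_char z a = (\<Prod>i<m. z i ^ torus_weight a i)" by (rule torus_char_eq)
      moreover have "\<exists>d. \<forall>i<m. torus_weight a i = d" using p that by simp
      then obtain d where d: "\<forall>i<m. torus_weight a i = d" by (rule exE)
      have "(\<Prod>i<m. z i ^ torus_weight a i) = (\<Prod>i<m. z i ^ d)"
        by (intro prod.cong refl) (simp add: d)
      ultimately show ?thesis by (simp add: z prod_power_distrib[symmetric])
    qed
    then show "lookup (scale_entries z p) a = lookup p a"
      by (cases "a \<in> keys p") (auto simp: lookup_scale_entries in_keys_iff)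
  qed
  with p show "p \<in> carrier (sym_invariants m)" by (simp add: sym_invariants_def)
qed

lemma sym_invariants_simps [simp]:
  "monoid.mult (sym_invariants m) = (*)" "add (sym_invariants m) = (+)"
  "one (sym_invariants m) = 1" "zero (sym_invariants m) = 0" "scalar (sym_invariants m) = cst"
  by (simp_all add: sym_invariants_def)

lemma cst_sym_invariants: "cst c \<in> carrier (sym_invariants m)"
  by (auto simp: carrier_sym_invariants sym_polys_eq torus_weight_def)

lemma sym_invariants_add_closed:
  "p \<in> carrier (sym_invariants m) \<Longrightarrow> q \<in> carrier (sym_invariants m) \<Longrightarrow> p + q \<in> carrier (sym_invariants m)"
  using keys_add[of p q] unfolding carrier_sym_invariants sym_polys_eq by blast

lemma sym_invariants_mult_closed:
  assumes "p \<in> carrier (sym_invariants m)" "q \<in> carrier (sym_invariants m)"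
  shows "p * q \<in> carrier (sym_invariants m)"
proof -
  have "\<exists>d. \<forall>i<m. torus_weight c i = d" if "c \<in> keys (p * q)" for c
  proof -
    obtain a b where "c = a + b" "a \<in> keys p" "b \<in> keys q" using keys_mult[of p q] \<open>c \<in> keys (p * q)\<close> by blast
    with assms show ?thesis by (fastforce simp: carrier_sym_invariants torus_weight_add)
  qed
  with assms show ?thesis by (auto simp: carrier_sym_invariants sym_polys_eq)
qed

lemma cring_sym_invariants: "cring (sym_invariants m)"
proof (rule cringI)
  have zero: "0 \<in> carrier (sym_invariants m)" and one: "1 \<in> carrier (sym_invariants m)"
    using cst_sym_invariants[of 0 m] cst_sym_invariants[of 1 m] by simp_all
  show "abelian_group (sym_invariants m)"
  proof (rule abelian_groupI)
    fix x assume "x \<in> carrier (sym_invariants m)"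
    then have "cst (- 1) * x \<in> carrier (sym_invariants m)"
      by (intro sym_invariants_mult_closed cst_sym_invariants)
    then show "\<exists>y\<in>carrier (sym_invariants m). y \<oplus>\<^bsub>sym_invariants m\<^esub> x = \<zero>\<^bsub>sym_invariants m\<^esub>"
      by (intro bexI[of _ "cst (- 1) * x"]) (simp_all add: single_uminus)
  qed (simp_all add: zero sym_invariants_add_closed add_ac)
  show "Group.comm_monoid (sym_invariants m)"
    by (rule Group.comm_monoidI) (simp_all add: one sym_invariants_mult_closed mult_ac)
qed (simp add: distrib_right)

definition restrict_keys :: "('x \<Rightarrow>\<^sub>0 nat) set \<Rightarrow> 'x cpoly \<Rightarrow> 'x cpoly" where
  "restrict_keys S p = (\<Sum>a\<in>keys p \<inter> S. single a (lookup p a))"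

lemma lookup_restrict_keys: "lookup (restrict_keys S p) a = (if a \<in> S then lookup p a else 0)"
proof -
  have "lookup (restrict_keys S p) a = (\<Sum>b\<in>keys p \<inter> S. if b = a then lookup p a else 0)"
    unfolding restrict_keys_def lookup_sum by (intro sum.cong) (auto simp: lookup_single when_def)
  then show ?thesis by (auto simp: in_keys_iff)
qed

lemma keys_restrict_keys: "keys (restrict_keys S p) = keys p \<inter> S"
  by (auto simp: in_keys_iff lookup_restrict_keys split: if_splits)

lemma restrict_keys_polys: "p \<in> polys S \<Longrightarrow> restrict_keys T p \<in> polys S"
  by (simp add: polys_def keys_restrict_keys)

lemma sym_invariants_decompose:
  assumes "p \<in> carrier (sym_invariants m)" "m \<ge> 1"
  obtains K q where "\<And>d. q d \<in> grade (sym_invariants m) d" "p = (\<Sum>d\<le>K. q d)"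
proof -
  define q where "q d = restrict_keys {a. torus_weight a 0 = d} p" for d
  define K where "K = Max (insert 0 ((\<lambda>a. torus_weight a 0) ` keys p))"
  have "q d \<in> grade (sym_invariants m) d" for d
    using assms restrict_keys_polys[of p "upper m"]
    by (fastforce simp: grade_sym_invariants carrier_sym_invariants q_def keys_restrict_keys sym_polys_eq)
  moreover have "p = (\<Sum>d\<le>K. q d)"
  proof (rule poly_mapping_eqI)
    fix a
    have "torus_weight a 0 \<le> K" if "a \<in> keys p" using that by (auto simp: K_def)
    then show "lookup p a = lookup (\<Sum>d\<le>K. q d) a"
      by (cases "a \<in> keys p") (simp_all add: lookup_sum q_def lookup_restrict_keys in_keys_iff)
  qed
  ultimately show ?thesis using that by blast
qed

lemma grade_subset_carrier: "grade (sym_invariants m) d \<subseteq> carrier (sym_invariants m)"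
  by (auto simp: grade_sym_invariants carrier_sym_invariants)

lemma gram_subst_single_weight:
  assumes "keys a \<subseteq> upper m"
  shows "weight_vector m L (torus_weight a) (gram_subst L (single a c))"
  using assms
proof (induction a rule: exponent_induct)
  case zero
  then show ?case by (simp add: weight_vector_iff_pol torus_weight_def)
next
  case (step a k)
  have "single (single k 1 + a) c = var k * single a c"
    by (simp add: mult_single var_def)
  moreover have "weight_vector m L (torus_weight a) (gram_subst L (single a c))"
    using step by (simp add: keys_add_nat)
  ultimately show ?case unfolding weight_vector_iff_pol torus_weight_add torus_weight_single
    by (auto simp: pol_gram_entry cst_hom algebra_simps simp del: One_nat_def)
qed

lemma weight_vector_sum:
  "(\<And>x. x \<in> I \<Longrightarrow> weight_vector M L \<alpha> (f x)) \<Longrightarrow> weight_vector M L \<alpha> (sum f I)"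
  by (simp add: weight_vector_iff_pol sum_distrib_left)

lemma gram_subst_weight_component:
  assumes q: "q \<in> sym_polys m" and w: "weight_vector m L (\<lambda>_. d) (gram_subst L q)"
  obtains p where "p \<in> grade (sym_invariants m) d" "gram_subst L p = gram_subst L q"
proof -
  let ?S = "{a. \<forall>i<m. torus_weight a i = d}"
  define p where "p = restrict_keys ?S q"
  have p: "p \<in> grade (sym_invariants m) d"
    using q restrict_keys_polys[of q "upper m"]
    by (auto simp: p_def grade_sym_invariants keys_restrict_keys sym_polys_eq)
  have sub: "keys a \<subseteq> upper m" if "a \<in> keys q" for a using q that by (auto simp: sym_polys_eq polys_def)
  have wp: "weight_vector m L (\<lambda>_. d) (gram_subst L p)"
  proof -
    have "weight_vector m L (\<lambda>_. d) (gram_subst L (single a c))" if "a \<in> keys q \<inter> ?S" for a c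
      using gram_subst_single_weight[OF sub, of a L c] that by (auto simp: weight_vector_def)
    then show ?thesis by (auto simp: p_def restrict_keys_def intro!: weight_vector_sum)
  qed
  have "gram_subst L (q - p) = 0"
  proof (rule ccontr)
    assume "gram_subst L (q - p) \<noteq> 0"
    then obtain b where b: "b \<in> keys (gram_subst L (q - p))" using keys_eq_empty by fastforce
    have "weight_vector m L (\<lambda>_. d) (gram_subst L (q - p))"
      using w wp by (simp add: weight_vector_iff_pol right_diff_distrib)
    then have d: "row_degree L b i = d" if "i < m" for i using b that by (auto simp: weight_vector_def)
    have "gram_subst L (q - p) = (\<Sum>a\<in>keys (q - p). gram_subst L (single a (lookup (q - p) a)))"
      by (subst cpoly_sum_monomials[of "q - p"]) simp
    then obtain a where a: "a \<in> keys (q - p)" "b \<in> keys (gram_subst L (single a (lookup (q - p) a)))"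
      using b keys_sum[of "\<lambda>a. gram_subst L (single a (lookup (q - p) a))" "keys (q - p)"] by auto
    have "a \<in> keys q" "a \<notin> ?S"
      using a(1) by (auto simp: in_keys_iff lookup_minus p_def lookup_restrict_keys split: if_splits)
    moreover have "row_degree L b i = torus_weight a i" if "i < m" for i
      using gram_subst_single_weight[OF sub[OF \<open>a \<in> keys q\<close>]] a(2) that by (auto simp: weight_vector_def)
    ultimately show False using d by auto
  qed
  then show ?thesis using that[OF p] by simp
qed

section \<open>Orthonormal coordinates\<close>

locale quadratic_space = vector_space scale
  for scale :: "complex \<Rightarrow> 'v::ab_group_add \<Rightarrow> 'v" +
  fixes B :: "'v \<Rightarrow> 'v \<Rightarrow> complex" and N :: nat
  assumes form: "nondegenerate_symmetric_form scale B"
    and dim_UNIV: "dim UNIV = N" and N_pos: "N > 0"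
begin

lemma B_commute: "B x y = B y x"
  using form by (simp add: nondegenerate_symmetric_form_def)

lemma B_linear: "Vector_Spaces.linear scale (*) (\<lambda>x. B x y)"
  using form by (simp add: nondegenerate_symmetric_form_def)

lemma B_add_left: "B (x + y) z = B x z + B y z" and B_scale_left: "B (scale c x) z = c * B x z"
  using B_linear[of z] by (auto simp: Vector_Spaces.linear_iff)

lemma B_add_right: "B z (x + y) = B z x + B z y" and B_scale_right: "B z (scale c x) = c * B z x"
  using B_add_left[of x y z] B_scale_left[of c x z] by (simp_all add: B_commute)

lemma B_zero_left: "B 0 z = 0"
  using B_add_left[of 0 0 z] by simp

lemma B_diff_left: "B (x - y) z = B x z - B y z"
  using B_add_left[of "x - y" y z] by simp

lemma B_diff_right: "B z (x - y) = B z x - B z y"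
  using B_diff_left[of x y z] by (simp add: B_commute)

lemma B_sum_left: "B (sum f I) z = (\<Sum>i\<in>I. B (f i) z)"
  by (induction I rule: infinite_finite_induct) (auto simp: B_zero_left B_add_left)

lemma B_sum_right: "B z (sum f I) = (\<Sum>i\<in>I. B z (f i))"
  using B_sum_left[of f I z] by (simp add: B_commute)

lemma nondegenerate: "(\<And>y. B x y = 0) \<Longrightarrow> x = 0"
  using form by (simp add: nondegenerate_symmetric_form_def)

definition orthonormal :: "(nat \<Rightarrow> 'v) \<Rightarrow> nat \<Rightarrow> bool" where
  "orthonormal e r \<longleftrightarrow> (\<forall>a<r. \<forall>b<r. B (e a) (e b) = (if a = b then 1 else 0))"

lemma orthonormal_le_dim:
  assumes e: "orthonormal e r"
  shows "r \<le> N"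
proof -
  have inj: "inj_on e {..<r}"
    using e by (intro inj_onI) (metis lessThan_iff orthonormal_def zero_neq_one)
  have "independent (e ` {..<r})"
  proof
    assume "dependent (e ` {..<r})"
    then obtain u where u: "\<exists>v\<in>e ` {..<r}. u v \<noteq> 0" "(\<Sum>v\<in>e ` {..<r}. scale (u v) v) = 0"
      using dependent_finite[of "e ` {..<r}"] by auto
    then obtain b where b: "b < r" "u (e b) \<noteq> 0" by auto
    have "0 = B (\<Sum>v\<in>e ` {..<r}. scale (u v) v) (e b)" by (simp add: u B_zero_left)
    also have "\<dots> = (\<Sum>a<r. u (e a) * B (e a) (e b))"
      by (simp add: sum.reindex[OF inj] B_sum_left B_scale_left)
    also have "\<dots> = (\<Sum>a<r. if a = b then u (e b) else 0)"
      using e b by (intro sum.cong) (auto simp: orthonormal_def)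
    finally show False using b by simp
  qed
  moreover obtain S where S: "S \<subseteq> UNIV" "independent S" "UNIV \<subseteq> span S" "card S = N"
    using basis_exists[of UNIV] dim_UNIV by metis
  moreover have "finite S" using S N_pos card_gt_0_iff by metis
  ultimately have "card (e ` {..<r}) \<le> N"
    using independent_span_bound[of S "e ` {..<r}"] by blast
  then show ?thesis by (simp add: card_image[OF inj])
qed

lemma orthonormal_extend:
  assumes e: "orthonormal e r" and x: "x \<noteq> (\<Sum>a<r. scale (B x (e a)) (e a))"
  obtains e' where "orthonormal e' (Suc r)"
proof -
  define pr where "pr x = x - (\<Sum>a<r. scale (B x (e a)) (e a))" for x
  have pr: "B (pr x) (e b) = 0" if "b < r" for x b
  proof -
    have "B (\<Sum>a<r. scale (B x (e a)) (e a)) (e b) = (\<Sum>a<r. if a = b then B x (e b) else 0)"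
      unfolding B_sum_left B_scale_left using e that by (intro sum.cong) (auto simp: orthonormal_def)
    then show ?thesis using that by (simp add: pr_def B_diff_left)
  qed
  have "pr x \<noteq> 0" using x by (simp add: pr_def)
  then obtain y where y: "B (pr x) y \<noteq> 0" using nondegenerate by blast
  have "B (pr x) (pr y) = B (pr x) y"
    unfolding pr_def[of y] B_diff_right B_sum_right B_scale_right by (simp add: pr)
  then have nz: "B (pr x) (pr y) \<noteq> 0" using y by simp
  have "B (pr x + pr y) (pr x + pr y) = B (pr x) (pr x) + 2 * B (pr x) (pr y) + B (pr y) (pr y)"
    by (simp add: B_add_left B_add_right B_commute[of "pr y" "pr x"])
  then have "B (pr x) (pr x) \<noteq> 0 \<or> B (pr y) (pr y) \<noteq> 0 \<or> B (pr x + pr y) (pr x + pr y) \<noteq> 0"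
    using nz by auto
  then obtain u where "u \<in> {pr x, pr y, pr x + pr y}" and u0: "B u u \<noteq> 0" by blast
  then have "B u (e b) = 0" if "b < r" for b using pr[OF that] by (auto simp: B_add_left)
  note u = u0 this
  define s where "s = csqrt (B u u)"
  have s: "s * s = B u u" by (simp add: s_def power2_eq_square[symmetric])
  then have s0: "s \<noteq> 0" using u by auto
  define e' where "e' = e(r := scale (1 / s) u)"
  have "orthonormal e' (Suc r)"
    unfolding orthonormal_def
  proof (intro allI impI)
    fix a b assume ab: "a < Suc r" "b < Suc r"
    consider "a < r" "b < r" | "a = r" "b < r" | "a < r" "b = r" | "a = r" "b = r" using ab by linarith
    then show "B (e' a) (e' b) = (if a = b then 1 else 0)"
    proof cases
      case 1
      then show ?thesis using e by (simp add: e'_def orthonormal_def)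
    next
      case 4
      then show ?thesis using s0 by (simp add: e'_def B_scale_left B_scale_right s[symmetric])
    qed (use u in \<open>auto simp: e'_def B_scale_left B_scale_right B_commute[of "e a" u]\<close>)
  qed
  then show ?thesis using that by blast
qed

lemma orthonormal_basis_exists:
  obtains e where "orthonormal e N" "\<And>x. x = (\<Sum>a<N. scale (B x (e a)) (e a))"
proof -
  define R where "R r \<longleftrightarrow> (\<exists>e. orthonormal e r)" for r
  have R0: "R 0" by (simp add: R_def orthonormal_def)
  have bound: "r \<le> N" if "R r" for r using that orthonormal_le_dim by (auto simp: R_def)
  obtain r where r: "R r" and max: "\<And>r'. R r' \<Longrightarrow> r' \<le> r"
    using GreatestI_nat[of R 0 N] Greatest_le_nat[of R _ N] R0 bound by blast
  obtain e where e: "orthonormal e r" using r by (auto simp: R_def)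
  have ex: "x = (\<Sum>a<r. scale (B x (e a)) (e a))" for x
  proof (rule ccontr)
    assume "x \<noteq> (\<Sum>a<r. scale (B x (e a)) (e a))"
    then obtain e' where "orthonormal e' (Suc r)" using orthonormal_extend[OF e] by blast
    then have "R (Suc r)" unfolding R_def by (rule exI[of _ e'])
    then have "Suc r \<le> r" by (rule max)
    then show False by simp
  qed
  have "UNIV \<subseteq> span (e ` {..<r})"
  proof
    fix x
    have "(\<Sum>a<r. scale (B x (e a)) (e a)) \<in> span (e ` {..<r})"
      by (intro span_sum span_scale span_base) auto
    then show "x \<in> span (e ` {..<r})" using ex[of x] by simp
  qed
  then have "N \<le> card (e ` {..<r})" using dim_le_card[of UNIV "e ` {..<r}"] dim_UNIV by simp
  also have "\<dots> \<le> r" using card_image_le[of "{..<r}" e] by simp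
  finally have "r = N" using bound[OF r] by simp
  show ?thesis by (rule that[OF e[unfolded \<open>r = N\<close>] ex[unfolded \<open>r = N\<close>]])
qed

definition e :: "nat \<Rightarrow> 'v" where
  "e = (SOME e. orthonormal e N \<and> (\<forall>x. x = (\<Sum>a<N. scale (B x (e a)) (e a))))"

lemma e: "orthonormal e N \<and> (\<forall>x. x = (\<Sum>a<N. scale (B x (e a)) (e a)))"
proof -
  have "\<exists>e. orthonormal e N \<and> (\<forall>x. x = (\<Sum>a<N. scale (B x (e a)) (e a)))"
  proof (rule orthonormal_basis_exists)
    fix f assume f: "orthonormal f N" "\<And>x. x = (\<Sum>a<N. scale (B x (f a)) (f a))"
    show ?thesis by (rule exI[of _ f], rule conjI[OF f(1)], rule allI, rule f(2))
  qed
  then show ?thesis unfolding e_def by (rule someI_ex)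
qed

lemma B_e: "a < N \<Longrightarrow> b < N \<Longrightarrow> B (e a) (e b) = (if a = b then 1 else 0)"
  using e[THEN conjunct1] by (simp add: orthonormal_def)

lemma expand: "x = (\<Sum>a<N. scale (B x (e a)) (e a))"
  by (rule e[THEN conjunct2, THEN spec])

definition coords :: "(nat \<Rightarrow> 'v) \<Rightarrow> nat \<times> nat \<Rightarrow> complex" where
  "coords v = (\<lambda>(i, a). B (v i) (e a))"

definition vectors :: "(nat \<times> nat \<Rightarrow> complex) \<Rightarrow> nat \<Rightarrow> 'v" where
  "vectors x i = (\<Sum>a<N. scale (x (i, a)) (e a))"

lemma coords_vectors: "b < N \<Longrightarrow> coords (vectors x) (i, b) = x (i, b)"
proof -
  assume b: "b < N"
  have "coords (vectors x) (i, b) = (\<Sum>a<N. if a = b then x (i, b) else 0)"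
    unfolding coords_def vectors_def prod.case B_sum_left B_scale_left
    using b by (intro sum.cong) (auto simp: B_e)
  then show ?thesis using b by simp
qed

lemma gram_coords: "gram N (coords v) i j = B (v i) (v j)"
proof -
  have "B (v i) (v j) = B (v i) (\<Sum>a<N. scale (B (v j) (e a)) (e a))" by (subst expand[of "v j"]) (rule refl)
  also have "\<dots> = gram N (coords v) i j"
    by (simp add: gram_def coords_def B_sum_right B_scale_right mult.commute)
  finally show ?thesis ..
qed

lemma gram_vectors: "gram N x i j = B (vectors x i) (vectors x j)"
  unfolding gram_coords[symmetric] by (simp add: gram_def coords_vectors)

lemma polynomial_function_coords:
  assumes "f \<in> polynomial_functions scale m"
  obtains p where "p \<in> polys (grid m N)" "\<And>v. f v = eval (coords v) p"
proof -
  have "\<exists>p\<in>polys (grid m N). \<forall>v. f v = eval (coords v) p"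
    using assms
  proof (induction rule: polynomial_functions.induct)
    case (const c)
    then show ?case by (intro bexI[of _ "cst c"]) auto
  next
    case (coord i l)
    interpret l: Vector_Spaces.linear scale "(*)" l by fact
    let ?p = "\<Sum>a<N. cst (l (e a)) * var (i, a)"
    have "l (v i) = eval (coords v) ?p" for v :: "nat \<Rightarrow> 'v"
    proof -
      have "l (v i) = l (\<Sum>a<N. scale (B (v i) (e a)) (e a))" by (subst expand[of "v i"]) (rule refl)
      then show ?thesis by (simp add: l.sum l.scale coords_def mult.commute)
    qed
    then show ?case using coord by (intro bexI[of _ ?p]) auto
  next
    case (add f g)
    then obtain p q where "p \<in> polys (grid m N)" "q \<in> polys (grid m N)"
      "\<forall>v. f v = eval (coords v) p" "\<forall>v. g v = eval (coords v) q" by blast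
    then show ?case by (intro bexI[of _ "p + q"]) auto
  next
    case (mult f g)
    then obtain p q where "p \<in> polys (grid m N)" "q \<in> polys (grid m N)"
      "\<forall>v. f v = eval (coords v) p" "\<forall>v. g v = eval (coords v) q" by blast
    then show ?case by (intro bexI[of _ "p * q"]) auto
  qed
  then show ?thesis using that by blast
qed

definition gram_function :: "sym_poly \<Rightarrow> (nat \<Rightarrow> 'v) \<Rightarrow> complex" where
  "gram_function q v = eval (\<lambda>(i, j). B (v i) (v j)) q"

lemma gram_function_eq: "gram_function q v = eval (coords v) (gram_subst N q)"
  by (simp add: gram_function_def eval_gram_subst gram_coords)

lemma gram_function_polynomial:
  assumes "q \<in> sym_polys m"
  shows "gram_function q \<in> polynomial_functions scale m"
  using assms unfolding sym_polys_eq
proof (induction rule: polys_induct)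
  case (cst c)
  then show ?case using polynomial_functions.const by (simp add: gram_function_def[abs_def])
next
  case (var k)
  obtain i j where k: "k = (i, j)" "i < m" "j < m" using var by auto
  have coord: "(\<lambda>v. B (v i) (e a)) \<in> polynomial_functions scale m" if "i < m" for i a
    using polynomial_functions.coord[OF that B_linear] .
  have "(\<lambda>v. \<Sum>a\<in>I. B (v i) (e a) * B (v j) (e a)) \<in> polynomial_functions scale m" if "finite I" for I
    using that
  proof (induction I)
    case empty
    then show ?case using polynomial_functions.const[of 0] by simp
  next
    case (insert a I)
    then show ?case
      using polynomial_functions.add[OF polynomial_functions.mult[OF coord[OF k(2)] coord[OF k(3)]] insert.IH]
      by simp
  qed
  from this[of "{..<N}"] show ?case
    by (simp add: gram_function_eq[abs_def] k gram_def coords_def)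
next
  case (add p q)
  then show ?case using polynomial_functions.add[OF add.IH] by (simp add: gram_function_def[abs_def])
next
  case (mult p q)
  then show ?case using polynomial_functions.mult[OF mult.IH] by (simp add: gram_function_def[abs_def])
qed

lemma orthogonal_matrix_group:
  assumes g: "orthogonal_matrix N g"
  obtains G where "G \<in> orthogonal_group scale B"
    "\<And>v i b. b < N \<Longrightarrow> coords (\<lambda>i. G (v i)) (i, b) = act N g (coords v) (i, b)"
proof -
  define F where "F g y = (\<Sum>b<N. scale (\<Sum>c<N. g b c * B y (e c)) (e b))" for g :: "nat \<Rightarrow> nat \<Rightarrow> complex" and y
  define g' where "g' a b = g b a" for a b
  have BF: "B (F g y) (e b) = (\<Sum>c<N. g b c * B y (e c))" if "b < N" for g y b
  proof -
    have "B (F g y) (e b) = (\<Sum>a<N. if a = b then (\<Sum>c<N. g b c * B y (e c)) else 0)"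
      unfolding F_def B_sum_left B_scale_left using that by (intro sum.cong) (auto simp: B_e)
    then show ?thesis using that by simp
  qed
  have FF: "F h (F g y) = y" if hg: "\<And>a c. a < N \<Longrightarrow> c < N \<Longrightarrow> (\<Sum>b<N. h a b * g b c) = (if a = c then 1 else 0)"
    for h g y
  proof -
    have "(\<Sum>b<N. h a b * B (F g y) (e b)) = B y (e a)" if a: "a < N" for a
    proof -
      have "(\<Sum>b<N. h a b * B (F g y) (e b)) = (\<Sum>b<N. \<Sum>c<N. h a b * g b c * B y (e c))"
        by (simp add: BF sum_distrib_left mult.assoc)
      also have "\<dots> = (\<Sum>c<N. (\<Sum>b<N. h a b * g b c) * B y (e c))"
        by (subst sum.swap) (simp add: sum_distrib_right)
      also have "\<dots> = (\<Sum>c<N. if c = a then B y (e a) else 0)"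
        using hg a by (intro sum.cong) auto
      finally show ?thesis using a by simp
    qed
    then have "F h (F g y) = (\<Sum>a<N. scale (B y (e a)) (e a))"
      unfolding F_def[of h] by (intro sum.cong refl) simp
    then show ?thesis by (simp only: expand[of y, symmetric])
  qed
  have 1: "F g' (F g y) = y" for y
    using orthogonal_matrix_transpose[OF g] by (intro FF) (simp add: g'_def)
  have 2: "F g (F g' y) = y" for y
    using g by (intro FF) (simp add: g'_def orthogonal_matrix_def)
  have act: "coords (\<lambda>i. F g (v i)) (i, b) = act N g (coords v) (i, b)" if "b < N" for v i b
    using BF[OF that] by (simp add: coords_def act_def)
  have "Vector_Spaces.linear scale scale (F g)"
    unfolding Vector_Spaces.linear_iff F_def
    by (intro conjI allI vector_space_axioms)
      (simp_all add: B_add_left B_scale_left algebra_simps sum.distrib scale_sum_right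
        scale_left_distrib sum_distrib_left)
  moreover have "bij (F g)" using 1 2 by (intro o_bij[of "F g'"]) (auto simp: fun_eq_iff)
  moreover have "B (F g x) (F g y) = B x y" for x y
  proof -
    define v where "v = (\<lambda>i::nat. if i = 0 then x else y)"
    have "B (F g x) (F g y) = gram N (coords (\<lambda>i. F g (v i))) 0 1"
      by (simp add: gram_coords v_def)
    also have "\<dots> = gram N (act N g (coords v)) 0 1" by (simp add: gram_def act)
    also have "\<dots> = B x y" using gram_act[OF g] by (simp add: gram_coords v_def)
    finally show ?thesis .
  qed
  ultimately have "F g \<in> orthogonal_group scale B" by (simp add: orthogonal_group_def)
  then show ?thesis using act that by blast
qed

lemma orthogonally_invariant_coords:
  assumes p: "p \<in> polys (grid m N)" and f: "\<And>v. f v = eval (coords v) p"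
    and inv: "\<And>g v. g \<in> orthogonal_group scale B \<Longrightarrow> f (\<lambda>i. g (v i)) = f v"
  shows "orthogonally_invariant N p"
  unfolding orthogonally_invariant_def
proof (intro allI impI)
  fix g x assume g: "orthogonal_matrix N g"
  obtain G where G: "G \<in> orthogonal_group scale B"
    "\<And>v i b. b < N \<Longrightarrow> coords (\<lambda>i. G (v i)) (i, b) = act N g (coords v) (i, b)"
    using orthogonal_matrix_group[OF g] by blast
  have "eval (act N g x) p = eval (coords (\<lambda>i. G (vectors x i))) p"
    by (rule eval_cong[OF p]) (auto simp: G act_def coords_vectors)
  also have "\<dots> = eval (coords (vectors x)) p" using inv[OF G(1), of "vectors x"] by (simp add: f)
  also have "\<dots> = eval x p" by (rule eval_cong[OF p]) (auto simp: coords_vectors)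
  finally show "eval (act N g x) p = eval x p" .
qed

lemma homogeneous_weight_vector:
  assumes p: "p \<in> polys (grid m N)" and f: "\<And>v. f v = eval (coords v) p"
    and hom: "\<And>i c v. i < m \<Longrightarrow> f (v(i := scale c (v i))) = c ^ d * f v"
  shows "weight_vector m N (\<lambda>_. d) p"
  unfolding weight_vector_iff_pol
proof (intro allI impI cpoly_eqI)
  fix i x assume i: "i < m"
  have "eval (\<lambda>(r, b). x (r, b) + (if r = i then t * x (i, b) else 0)) p = (1 + t) ^ d * eval x p" for t
  proof -
    have "eval (\<lambda>(r, b). x (r, b) + (if r = i then t * x (i, b) else 0)) p
      = eval (coords ((vectors x)(i := scale (1 + t) (vectors x i)))) p"
    proof (rule eval_cong[OF p])
      fix k assume "k \<in> grid m N"
      then obtain r b where [simp]: "k = (r, b)" and b: "b < N" by auto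
      show "(case k of (r, b) \<Rightarrow> x (r, b) + (if r = i then t * x (i, b) else 0))
        = coords ((vectors x)(i := scale (1 + t) (vectors x i))) k"
        using coords_vectors[OF b, of x] by (simp add: coords_def B_scale_left B_add_left distrib_right)
    qed
    also have "\<dots> = (1 + t) ^ d * eval (coords (vectors x)) p" using hom[OF i] by (simp add: f[symmetric])
    also have "eval (coords (vectors x)) p = eval x p" by (rule eval_cong[OF p]) (auto simp: coords_vectors)
    finally show ?thesis .
  qed
  then have "((\<lambda>t. (1 + t) ^ d * eval x p) has_field_derivative eval x (pol N i i p)) (at 0)"
    using eval_curve[OF p i, of x i] by simp
  moreover have "((\<lambda>t. (1 + t) ^ d * eval x p) has_field_derivative of_nat d * eval x p) (at 0)"
    by (auto intro!: derivative_eq_intros)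
  ultimately have "eval x (pol N i i p) = of_nat d * eval x p" by (rule DERIV_unique)
  then show "eval x (pol N i i p) = eval x (cst (of_nat d) * p)" by simp
qed

lemma multihomogeneous_invariants_eq:
  "multihomogeneous_invariants scale B m d = gram_function ` grade (sym_invariants m) d"
proof (intro equalityI subsetI)
  fix f assume f: "f \<in> multihomogeneous_invariants scale B m d"
  then have fp: "f \<in> polynomial_functions scale m"
    and inv: "\<And>g v. g \<in> orthogonal_group scale B \<Longrightarrow> f (\<lambda>i. g (v i)) = f v"
    and hom: "\<And>i c v. i < m \<Longrightarrow> f (v(i := scale c (v i))) = c ^ d * f v"
    by (auto simp: multihomogeneous_invariants_def)
  obtain p where p: "p \<in> polys (grid m N)" "\<And>v. f v = eval (coords v) p"
    using polynomial_function_coords[OF fp] by blast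
  obtain q where q: "q \<in> sym_polys m" "p = gram_subst N q"
    using first_fundamental_theorem[OF p(1) orthogonally_invariant_coords[OF p inv]] by blast
  obtain r where r: "r \<in> grade (sym_invariants m) d" "gram_subst N r = gram_subst N q"
    using gram_subst_weight_component[OF q(1)] homogeneous_weight_vector[OF p hom] q(2) by metis
  have "f = gram_function r" using p q r by (intro ext) (simp add: gram_function_eq)
  with r show "f \<in> gram_function ` grade (sym_invariants m) d" by blast
next
  fix f assume "f \<in> gram_function ` grade (sym_invariants m) d"
  then obtain q where q: "q \<in> sym_polys m" "\<And>a i. a \<in> keys q \<Longrightarrow> i < m \<Longrightarrow> torus_weight a i = d"
    and f: "f = gram_function q" by (auto simp: grade_sym_invariants)
  have "f (\<lambda>i. g (v i)) = f v" if "g \<in> orthogonal_group scale B" for g v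
    using that by (simp add: f gram_function_def orthogonal_group_def)
  moreover have "f (v(i := scale c (v i))) = c ^ d * f v" if i: "i < m" for i c v
  proof -
    define s where "s = (\<lambda>k. if k = i then c else 1)"
    have s: "(\<lambda>(k, l). B ((v(i := scale c (v i))) k) ((v(i := scale c (v i))) l))
      = (\<lambda>(k, l). (s k * s l) * B (v k) (v l))"
      by (auto simp: s_def B_scale_left B_scale_right)
    have "torus_char s a = c ^ d" if a: "a \<in> keys q" for a
    proof -
      have "keys a \<subseteq> upper m" using q(1) a by (auto simp: sym_polys_def)
      then have "torus_char s a = (\<Prod>k<m. s k ^ torus_weight a k)" by (rule torus_char_eq)
      also have "\<dots> = (\<Prod>k<m. if k = i then c ^ d else 1)"
        using q(2)[OF a] by (intro prod.cong refl) (auto simp: s_def)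
      finally have "torus_char s a = (\<Prod>k<m. if k = i then c ^ d else 1)" .
      then show ?thesis using i by simp
    qed
    then have "eval (\<lambda>(k, l). (s k * s l) * B (v k) (v l)) q = c ^ d * f v"
      unfolding f gram_function_def psubst_def sum_distrib_left
      by (intro sum.cong refl)
        (simp add: split_def power_mult_distrib prod.distrib torus_char_def mult_ac)
    then show ?thesis by (simp only: f gram_function_def s)
  qed
  ultimately show "f \<in> multihomogeneous_invariants scale B m d"
    using gram_function_polynomial[OF q(1)] by (simp add: multihomogeneous_invariants_def f)
qed

lemma gram_function_simps:
  "gram_function (p + q) = (\<lambda>v. gram_function p v + gram_function q v)"
  "gram_function (p * q) = (\<lambda>v. gram_function p v * gram_function q v)"
  "gram_function (cst c) = (\<lambda>v. c)" "gram_function 1 = (\<lambda>v. 1)" "gram_function 0 = (\<lambda>v. 0)"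
  "gram_function (sum f I) = (\<lambda>v. \<Sum>i\<in>I. gram_function (f i) v)"
  by (simp_all add: gram_function_def[abs_def])

lemma carrier_orthogonal_invariants:
  assumes "m \<ge> 1"
  shows "carrier (orthogonal_invariants scale B m) = gram_function ` carrier (sym_invariants m)"
proof (intro equalityI subsetI)
  fix f assume "f \<in> carrier (orthogonal_invariants scale B m)"
  then obtain K h where h: "\<And>d. d \<le> K \<Longrightarrow> h d \<in> multihomogeneous_invariants scale B m d"
    and f: "f = (\<lambda>v. \<Sum>d\<le>K. h d v)" by (auto simp: orthogonal_invariants_def)
  have "\<forall>d\<le>K. \<exists>q\<in>grade (sym_invariants m) d. h d = gram_function q"
    using h by (auto simp: multihomogeneous_invariants_eq)
  then obtain q where q: "\<And>d. d \<le> K \<Longrightarrow> q d \<in> grade (sym_invariants m) d \<and> h d = gram_function (q d)"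
    by metis
  have "f = gram_function (\<Sum>d\<le>K. q d)"
    unfolding f gram_function_simps using q by (intro ext sum.cong) auto
  moreover have "(\<Sum>d\<in>D. q d) \<in> carrier (sym_invariants m)" if "finite D" "D \<subseteq> {..K}" for D
    using that
  proof (induction D)
    case empty
    then show ?case using cst_sym_invariants[of 0 m] by simp
  next
    case (insert d D)
    then have "q d \<in> carrier (sym_invariants m)" using q[of d] grade_subset_carrier by auto
    with insert show ?case by (simp add: sym_invariants_add_closed)
  qed
  from this[of "{..K}"] have "(\<Sum>d\<le>K. q d) \<in> carrier (sym_invariants m)" by simp
  ultimately show "f \<in> gram_function ` carrier (sym_invariants m)" by blast
next
  fix f assume "f \<in> gram_function ` carrier (sym_invariants m)"
  then obtain p where p: "p \<in> carrier (sym_invariants m)" "f = gram_function p" by auto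
  obtain K q where q: "\<And>d. q d \<in> grade (sym_invariants m) d" "p = (\<Sum>d\<le>K. q d)"
    using sym_invariants_decompose[OF p(1) assms] by blast
  have "f = (\<lambda>v. \<Sum>d\<le>K. gram_function (q d) v)" by (simp add: p q gram_function_simps)
  moreover have "gram_function (q d) \<in> multihomogeneous_invariants scale B m d" for d
    using q by (auto simp: multihomogeneous_invariants_eq)
  ultimately show "f \<in> carrier (orthogonal_invariants scale B m)"
    unfolding orthogonal_invariants_def partial_object.simps
    by (intro CollectI exI[of _ K] exI[of _ "\<lambda>d. gram_function (q d)"] conjI allI impI)
qed

lemma orthogonal_invariants_simps:
  "monoid.mult (orthogonal_invariants scale B m) = (\<lambda>f g v. f v * g v)"
  "add (orthogonal_invariants scale B m) = (\<lambda>f g v. f v + g v)"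
  "one (orthogonal_invariants scale B m) = (\<lambda>v. 1)" "zero (orthogonal_invariants scale B m) = (\<lambda>v. 0)"
  "scalar (orthogonal_invariants scale B m) = (\<lambda>c v. c)"
  "grade (orthogonal_invariants scale B m) = multihomogeneous_invariants scale B m"
  by (simp_all add: orthogonal_invariants_def)

lemma cring_orthogonal_invariants:
  assumes "m \<ge> 1"
  shows "cring (orthogonal_invariants scale B m)" (is "cring ?O")
proof (rule cringI)
  note simps = carrier_orthogonal_invariants[OF assms] orthogonal_invariants_simps
  interpret S: cring "sym_invariants m" by (rule cring_sym_invariants)
  have add: "(\<lambda>v. f v + g v) \<in> carrier ?O" and mult: "(\<lambda>v. f v * g v) \<in> carrier ?O"
    if "f \<in> carrier ?O" "g \<in> carrier ?O" for f g
    using that sym_invariants_add_closed sym_invariants_mult_closed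
    by (auto simp: simps simp flip: gram_function_simps intro!: imageI)
  have const: "(\<lambda>v. c) \<in> carrier ?O" for c
    using imageI[OF cst_sym_invariants[of c m], of gram_function] by (simp add: simps gram_function_simps)
  show "abelian_group ?O"
  proof (rule abelian_groupI)
    fix f assume "f \<in> carrier ?O"
    from mult[OF const[of "- 1"] this] show "\<exists>g\<in>carrier ?O. g \<oplus>\<^bsub>?O\<^esub> f = \<zero>\<^bsub>?O\<^esub>"
      by (intro bexI[of _ "\<lambda>v. (- 1) * f v"]) (auto simp: orthogonal_invariants_simps)
  qed (auto simp: orthogonal_invariants_simps add const add_ac)
  show "Group.comm_monoid ?O"
    by (rule Group.comm_monoidI) (auto simp: orthogonal_invariants_simps mult const mult_ac)
qed (auto simp: orthogonal_invariants_simps distrib_right)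

lemma gram_function_eq_zero_iff:
  assumes "q \<in> sym_polys m"
  shows "gram_function q = (\<lambda>v. 0) \<longleftrightarrow> q \<in> determinantal_ideal m N"
proof -
  have "(\<forall>x. eval (\<lambda>(i, j). gram N x i j) q = 0) \<longleftrightarrow> (\<forall>v. gram_function q v = 0)"
  proof (intro iffI allI)
    fix v assume "\<forall>x. eval (\<lambda>(i, j). gram N x i j) q = 0"
    then show "gram_function q v = 0" by (metis eval_gram_subst gram_function_eq)
  next
    fix x assume "\<forall>v. gram_function q v = 0"
    then show "eval (\<lambda>(i, j). gram N x i j) q = 0"
      by (simp add: gram_vectors gram_function_def)
  qed
  then show ?thesis using assms by (auto simp: determinantal_ideal_iff fun_eq_iff)
qed

end

lemma cring_transfer:
  assumes "cring R" "carrier S = carrier R" "monoid.mult S = monoid.mult R" "one S = one R"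
    "zero S = zero R" "add S = add R"
  shows "cring S"
proof -
  interpret cring R by fact
  show ?thesis
  proof (rule cringI)
    show "abelian_group S"
    proof (rule abelian_groupI)
      fix x assume "x \<in> carrier S"
      then show "\<exists>y\<in>carrier S. y \<oplus>\<^bsub>S\<^esub> x = \<zero>\<^bsub>S\<^esub>"
        by (intro bexI[of _ "\<ominus>\<^bsub>R\<^esub> x"]) (simp_all add: assms(2-) l_neg)
    qed (simp_all add: assms(2-) a_ac)
    show "Group.comm_monoid S"
      by (rule Group.comm_monoidI) (simp_all add: assms(2-) m_ac)
  qed (auto simp: assms(2-) l_distr)
qed

theorem theorem1p1:
  fixes scale :: "complex \<Rightarrow> 'v::ab_group_add \<Rightarrow> 'v"
    and B :: "'v \<Rightarrow> 'v \<Rightarrow> complex"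
    and n m :: nat
  assumes "vector_space scale"
    and "vector_space.dim scale (UNIV :: 'v set) = n + 1"
    and "nondegenerate_symmetric_form scale B"
    and "m \<ge> 1"
  shows "isomorphic_over_complex
    (Proj (orthogonal_invariants scale B m))
    (closed_subscheme_of_Proj (sym_invariants m)
      (determinantal_ideal m (n + 1) \<inter> carrier (sym_invariants m)))"
proof -
  interpret V: quadratic_space scale B "n + 1"
    using assms by (intro quadratic_space.intro quadratic_space_axioms.intro) auto
  let ?S = "sym_invariants m" and ?O = "orthogonal_invariants scale B m" and ?\<Psi> = V.gram_function
  define I where "I = determinantal_ideal m (n + 1) \<inter> carrier ?S"
  let ?Q = "quotient_algebra ?S I"
  interpret S: cring ?S by (rule cring_sym_invariants)
  interpret O: cring ?O by (rule V.cring_orthogonal_invariants[OF assms(4)])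
  interpret H: ring_hom_ring ?S ?O ?\<Psi>
    by (intro ring_hom_ringI S.ring_axioms O.ring_axioms)
      (auto simp: V.carrier_orthogonal_invariants[OF assms(4)] V.orthogonal_invariants_simps V.gram_function_simps)
  have carS: "q \<in> sym_polys m" if "q \<in> carrier ?S" for q using that by (simp add: carrier_sym_invariants)
  have ker: "a_kernel ?S ?O ?\<Psi> = I"
  proof -
    have "a_kernel ?S ?O ?\<Psi> = {x \<in> carrier ?S. ?\<Psi> x = (\<lambda>v. 0)}"
      unfolding a_kernel_def' V.orthogonal_invariants_simps ..
    also have "\<dots> = {x \<in> carrier ?S. x \<in> determinantal_ideal m (n + 1)}"
      by (intro Collect_cong conj_cong refl V.gram_function_eq_zero_iff carS)
    also have "\<dots> = I" by (auto simp only: I_def Int_iff mem_Collect_eq)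
    finally show ?thesis .
  qed
  interpret I: ideal I ?S using H.kernel_is_ideal by (simp add: ker)
  define \<kappa> where "\<kappa> X = the_elem (?\<Psi> ` X)" for X
  have \<kappa>: "\<kappa> (I +>\<^bsub>?S\<^esub> x) = ?\<Psi> x" if "x \<in> carrier ?S" for x
    using H.the_elem_simp[OF that] by (simp add: ker \<kappa>_def)
  have iso: "\<kappa> \<in> ring_iso (?S Quot I) ?O"
    using H.FactRing_iso_set V.carrier_orthogonal_invariants[OF assms(4)] by (simp add: ker \<kappa>_def[abs_def])
  have Q: "carrier ?Q = carrier (?S Quot I)" "monoid.mult ?Q = monoid.mult (?S Quot I)"
    "one ?Q = one (?S Quot I)" "zero ?Q = zero (?S Quot I)" "add ?Q = add (?S Quot I)"
    by (simp_all add: quotient_algebra_def)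
  have rcos: "I +>\<^bsub>?S\<^esub> x \<in> carrier (?S Quot I)" if "x \<in> carrier ?S" for x
    using that by (auto simp: FactRing_def A_RCOSETS_def' a_r_coset_def')
  have bij: "bij_betw \<kappa> (carrier ?Q) (carrier ?O)" using iso by (simp add: ring_iso_def Q)
  have hom: "\<kappa> \<in> Ring.ring_hom (?S Quot I) ?O" using iso by (simp add: ring_iso_def)
  let ?\<kappa> = "inv_into (carrier ?Q) \<kappa>"
  have "graded_iso ?Q ?O \<kappa> ?\<kappa>"
  proof (rule graded_iso.intro)
    show "cring ?Q" using I.quotient_is_cring[OF S.is_cring] Q by (rule cring_transfer)
    show "cring ?O" by (rule O.is_cring)
    show "\<kappa> x \<in> carrier ?O" if "x \<in> carrier ?Q" for x using that bij bij_betwE by blast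
    show "?\<kappa> y \<in> carrier ?Q" if "y \<in> carrier ?O" for y
      using that bij by (metis bij_betw_imp_surj_on inv_into_into)
    show "?\<kappa> (\<kappa> x) = x" if "x \<in> carrier ?Q" for x using that bij by (rule bij_betw_inv_into_left[rotated])
    show "\<kappa> (?\<kappa> y) = y" if "y \<in> carrier ?O" for y using that bij by (rule bij_betw_inv_into_right[rotated])
    show "\<kappa> (x \<otimes>\<^bsub>?Q\<^esub> y) = \<kappa> x \<otimes>\<^bsub>?O\<^esub> \<kappa> y" if "x \<in> carrier ?Q" "y \<in> carrier ?Q" for x y
      using that ring_hom_mult[OF hom] by (simp add: Q)
    show "\<kappa> (x \<oplus>\<^bsub>?Q\<^esub> y) = \<kappa> x \<oplus>\<^bsub>?O\<^esub> \<kappa> y" if "x \<in> carrier ?Q" "y \<in> carrier ?Q" for x y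
      using that ring_hom_add[OF hom] by (simp add: Q)
    show "\<kappa> \<one>\<^bsub>?Q\<^esub> = \<one>\<^bsub>?O\<^esub>" using ring_hom_one[OF hom] by (simp add: Q)
    have gr: "grade ?Q d = (\<lambda>x. I +>\<^bsub>?S\<^esub> x) ` grade ?S d" for d by (simp add: quotient_algebra_def)
    show "grade ?Q d \<subseteq> carrier ?Q" for d
      using rcos grade_subset_carrier unfolding gr Q by blast
    show "\<kappa> ` grade ?Q d = grade ?O d" for d
    proof -
      have "\<kappa> ` grade ?Q d = ?\<Psi> ` grade ?S d"
        unfolding gr image_image by (rule image_cong[OF refl]) (rule \<kappa>[OF subsetD[OF grade_subset_carrier]])
      then show ?thesis by (simp add: V.orthogonal_invariants_simps V.multihomogeneous_invariants_eq)
    qed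
    have sc: "scalar ?Q c = I +>\<^bsub>?S\<^esub> cst c" for c by (simp add: quotient_algebra_def)
    show "scalar ?Q c \<in> carrier ?Q" for c unfolding sc Q by (rule rcos[OF cst_sym_invariants])
    show "\<kappa> (scalar ?Q c) = scalar ?O c" for c
      unfolding sc \<kappa>[OF cst_sym_invariants] by (simp add: V.gram_function_simps V.orthogonal_invariants_simps)
  qed
  then have "graded_iso ?O ?Q ?\<kappa> \<kappa>" by (rule graded_iso.symmetric)
  then show ?thesis unfolding closed_subscheme_of_Proj_def I_def[symmetric]
    by (rule graded_iso.Proj_isomorphic)
qed

end
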